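(* Let $I$ be an open subinterval of $\mathbb{R}$, $U$ an open subset of $\mathbb{R}^n$, $P$ an open subset of $\mathbb{R}^l$, $\tilde t_0$ a near-standard point in $\tilde I_c$ with $\tilde t_0\approx t_0\in I$, $\tilde x_0\in\tilde U_c$ and $F\in\mathcal{G}(I\times U\times P)^n$. Let $\alpha>0$ be chosen such that $[t_0-\alpha,t_0+\alpha]\subset\subset I$. Let $(\tilde x_{0\varepsilon})_\varepsilon$ be a representative of $\tilde x_0$ and let $L\subset\subset U$, $\varepsilon_0\in(0,1]$ be such that $\tilde x_{0\varepsilon}\in L$ for all $\varepsilon\le\varepsilon_0$. With $\beta>0$ satisfying $L_\beta:=L+\overline{B_\beta(0)}\subset\subset U$ set $$Q:=[t_0-\alpha,t_0+\alpha]\times L_\beta\qquad(\subset\subset I\times U).$$ Assume that $F$ has a representative $(F_\varepsilon)_\varepsilon$ satisfying $$\sup_{(t,x,p)\in Q\times P}|F_\varepsilon(t,x,p)|\le a\qquad(\varepsilon\le\varepsilon_0)$$ for some constant $a>0$ and that for all compact subsets $K$ of $P$ $$\sup_{(t,x,p)\in Q\times K}|\partial_2F_\varepsilon(t,x,p)|=O(|\log\varepsilon|)\quad\text{as }\varepsilon\to0.$$ Then, with $h:=\min(\alpha,\beta/a)$, $J:=(t_0-h,t_0+h)$ and $W:=L+B_\beta(0)$, there exists $u\in\mathcal{G}[P\times J,W]$ such that for all $\tilde p\in\tilde P_c$ the map $u(\tilde p,\,.\,)\in\mathcal{G}[J,W]$ is a solution of the initial value problem $$\dot u(t)=F(t,u(t),\tilde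 p),\quad u(\tilde t_0)=\tilde x_0.$$ The solution $u$ is unique in $\mathcal{G}[P\times J,U]$ (that is, any $v\in\mathcal{G}[P\times J,U]$ such that $v(\tilde p,\,.\,)$ solves this initial value problem for all $\tilde p\in\tilde P_c$ equals $u$).
   Context: Notation. $A\subset\subset B$ means that $A$ is a compact subset of the interior of $B$. $B_r(x)$ is the open ball with centre $x$ and radius $r>0$. $\partial_2F_\varepsilon$ is the derivative with respect to the second slot ($x\in U$). Special Colombeau algebra. For a non-empty open $U\subseteq\mathbb{R}^n$ let $\mathcal{E}(U):=C^\infty(U,\mathbb{R})^{(0,1]}$. $\mathcal{E}_M(U)$ (moderate nets) is the set of $(u_\varepsilon)_\varepsilon\in\mathcal{E}(U)$ such that for all $K\subset\subset U$ and all $\alpha\in\mathbb{N}_0^n$ there is $N\in\mathbb{N}$ with $\sup_{x\in K}|\partial^\alpha u_\varepsilon(x)|=O(\varepsilon^{-N})$ as $\varepsilon\to0$. $\mathcal{N}(U)$ (negligible nets) is the set of $(u_\varepsilon)_\varepsilon\in\mathcal{E}(U)$ such that for all $K\subset\subset U$, $\alpha\in\mathbb{N}_0^n$, $m\in\mathbb{N}$ one has $\sup_{x\in K}|\partial^\alpha u_\varepsilon(x)|=O(\varepsilon^m)$ as $\varepsilon\to0$. $\mathcal{G}(U):=\mathcal{E}_M(U)/\mathcal{N}(U)$; the class of $(u_\varepsilon)_\varepsilon$ is $[(u_\varepsilon)_\varepsilon]$. Derivatives are taken componentwise in $\varepsilon$. Generalized functions with values in $\mathbb{R}^m$ are elements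 of $\mathcal{G}(U)^m$. c-boundedness. For open $U\subseteq\mathbb{R}^n$, $V\subseteq\mathbb{R}^m$, a net $(u_\varepsilon)_\varepsilon\in\mathcal{E}_M(U)^m$ is c-bounded from $U$ into $V$ if (a) there is $\varepsilon_0\in(0,1]$ with $u_\varepsilon(U)\subseteq V$ for all $\varepsilon\le\varepsilon_0$, and (b) for every $K\subset\subset U$ there are $L\subset\subset V$ and $\varepsilon_0\in(0,1]$ with $u_\varepsilon(K)\subseteq L$ for all $\varepsilon\le\varepsilon_0$. $\mathcal{G}[U,V]$ is the set of $u\in\mathcal{G}(U)^m$ having a representative that is c-bounded from $U$ into $V$. For $u\in\mathcal{G}[U,V]$ and $v\in\mathcal{G}(V)^l$ the composition $v\circ u:=[(v_\varepsilon\circ u_\varepsilon)_\varepsilon]\in\mathcal{G}(U)^l$ is well defined (with a c-bounded representative $(u_\varepsilon)_\varepsilon$; only small $\varepsilon$ matter). Generalized points. $U_M$ is the set of nets $(x_\varepsilon)_\varepsilon\in U^{(0,1]}$ with $|x_\varepsilon|=O(\varepsilon^{-N})$ for some $N\in\mathbb{N}$; $(x_\varepsilon)_\varepsilon\sim(y_\varepsilon)_\varepsilon$ iff $|x_\varepsilon-y_\varepsilon|=O(\varepsilon^m)$ for all $m\in\mathbb{N}$; $\tilde U:=U_M/\!\sim$. $\tilde U_c$ (compactly supported points) is the set of $\tilde x=[(\tilde x_\varepsilon)_\varepsilon]\in\tilde U$ for which there are $K\subset\subset U$ and $\varepsilon_0\in(0,1]$ with $\tilde x_\varepsilon\in K$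 for all $\varepsilon\le\varepsilon_0$. For $u\in\mathcal{G}(U)^m$, $\tilde x\in\tilde U_c$, the point value is $u(\tilde x):=[(u_\varepsilon(\tilde x_\varepsilon))_\varepsilon]$. Similarly, inserting a compactly supported point $\tilde p=[(\tilde p_\varepsilon)_\varepsilon]$ into some of the slots is done componentwise, e.g. $u(\tilde p,\,.\,):=[(u_\varepsilon(\tilde p_\varepsilon,\,.\,))_\varepsilon]$. A point $\tilde x\in\tilde U_c$ is near-standard, written $\tilde x\approx x$, if there is $x\in U$ with $\tilde x_\varepsilon\to x$ as $\varepsilon\to0$ for one (hence every) representative. Solutions. For an open subinterval $J$ of $I$ and $G\in\mathcal{G}(I\times U)^n$ (here $G=F(\,.\,,\,.\,,\tilde p)$), a solution of $\dot u(t)=G(t,u(t))$, $u(\tilde t_0)=\tilde x_0$ on $J$ is a $u\in\mathcal{G}[J,U]$ such that the differential equation holds in $\mathcal{G}(J)^n$, where $G(t,u(t))$ is the composition $G\circ(\mathrm{id},u)$, and the initial condition holds as an equality in the set $\tilde U$ of generalized points. *)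

theory Defs
  imports "HOL-Analysis.Analysis" "HOL-Library.Landau_Symbols"
begin

section \<open>Smooth functions and relatively compact subsets\<close>

text \<open>For smooth \<open>f\<close> the order of the directions is immaterial, so letting the list range over
  \<open>lists Basis\<close> amounts to letting \<open>\<partial>\<^sup>\<alpha>\<close> range over all multi-indices.\<close>

primrec iter_pderiv ::
  "'a::euclidean_space list \<Rightarrow> ('a \<Rightarrow> 'b::real_normed_vector) \<Rightarrow> 'a \<Rightarrow> 'b" where
  "iter_pderiv [] f = f"
| "iter_pderiv (b # bs) f = (\<lambda>x. frechet_derivative (iter_pderiv bs f) (at x) b)"

definition smooth_fun_on ::
  "'a::euclidean_space set \<Rightarrow> ('a \<Rightarrow> 'b::real_normed_vector) \<Rightarrow> bool" where
  "smooth_fun_on U f \<longleftrightarrow>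
     (\<forall>bs \<in> lists Basis. \<forall>x \<in> U. iter_pderiv bs f differentiable (at x))"

definition cpt_inside :: "'a::topological_space set \<Rightarrow> 'a set \<Rightarrow> bool"  (infix "\<subset>\<subset>" 50) where
  "A \<subset>\<subset> B \<longleftrightarrow> compact A \<and> A \<subseteq> interior B"

text \<open>\<open>sup\<^bsub>x\<in>K\<^esub> |f\<^sub>\<epsilon>(x)| = O(g(\<epsilon>))\<close> as \<open>\<epsilon> \<rightarrow> 0\<close>.  The supremum is unfolded into a uniform bound because
  \<open>Sup\<close> on the reals is unspecified for the empty set.\<close>

definition sup_bigo ::
  "'a set \<Rightarrow> (real \<Rightarrow> 'a \<Rightarrow> 'b::real_normed_vector) \<Rightarrow> (real \<Rightarrow> real) \<Rightarrow> bool" where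
  "sup_bigo K f g \<longleftrightarrow>
     (\<exists>C. \<forall>\<^sub>F \<epsilon> in at_right 0. \<forall>x \<in> K. norm (f \<epsilon> x) \<le> C * \<bar>g \<epsilon>\<bar>)"


section \<open>The special Colombeau algebra\<close>

text \<open>A net \<open>(u\<^sub>\<epsilon>)\<close> on \<open>U\<close> is a total function \<open>u \<epsilon> x\<close>; its values for \<open>\<epsilon> \<notin> (0,1]\<close> or \<open>x \<notin> U\<close> are
  irrelevant, and the quotient below identifies nets that differ only there.  Elements of
  \<open>\<G>(U)\<^sup>m\<close> are classes of vector-valued nets; taking norms of vector-valued derivatives is the
  same as estimating componentwise.\<close>

type_synonym ('a, 'b) net = "real \<Rightarrow> 'a \<Rightarrow> 'b"

definition smooth_nets :: "'a::euclidean_space set \<Rightarrow> ('a, 'b::euclidean_space) net set" where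
  "smooth_nets U = {u. \<forall>\<epsilon> \<in> {0<..1}. smooth_fun_on U (u \<epsilon>)}"

definition moderate_nets :: "'a::euclidean_space set \<Rightarrow> ('a, 'b::euclidean_space) net set" where
  "moderate_nets U = {u \<in> smooth_nets U. \<forall>K. K \<subset>\<subset> U \<longrightarrow> (\<forall>bs \<in> lists Basis. \<exists>N::nat.
     sup_bigo K (\<lambda>\<epsilon>. iter_pderiv bs (u \<epsilon>)) (\<lambda>\<epsilon>. 1 / \<epsilon> ^ N))}"

definition negligible_nets :: "'a::euclidean_space set \<Rightarrow> ('a, 'b::euclidean_space) net set" where
  "negligible_nets U = {u \<in> smooth_nets U. \<forall>K. K \<subset>\<subset> U \<longrightarrow> (\<forall>bs \<in> lists Basis. \<forall>m::nat.
     sup_bigo K (\<lambda>\<epsilon>. iter_pderiv bs (u \<epsilon>)) (\<lambda>\<epsilon>. \<epsilon> ^ m))}"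

definition colombeau_rel ::
  "'a::euclidean_space set \<Rightarrow> (('a, 'b::euclidean_space) net \<times> ('a, 'b) net) set" where
  "colombeau_rel U = {(u, v). u \<in> moderate_nets U \<and> v \<in> moderate_nets U \<and>
     (\<lambda>\<epsilon> x. u \<epsilon> x - v \<epsilon> x) \<in> negligible_nets U}"

definition colombeau ::
  "'a::euclidean_space set \<Rightarrow> ('a, 'b::euclidean_space) net set set" where
  "colombeau U = moderate_nets U // colombeau_rel U"

text \<open>The class \<open>[(w\<^sub>\<epsilon>)]\<close> in \<open>\<G>(U)\<close>, meaningful also if \<open>w\<^sub>\<epsilon>\<close> is smooth on \<open>U\<close> for small \<open>\<epsilon>\<close> only (as
  happens for compositions).  For moderate \<open>w\<close> it is the equivalence class of \<open>w\<close>,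
  see \<open>colombeau_class_eq\<close> below.\<close>

definition colombeau_class ::
  "'a::euclidean_space set \<Rightarrow> ('a, 'b::euclidean_space) net \<Rightarrow> ('a, 'b) net set" where
  "colombeau_class U w = {w' \<in> moderate_nets U. \<exists>z \<in> negligible_nets U.
     \<forall>\<^sub>F \<epsilon> in at_right 0. \<forall>x \<in> U. w' \<epsilon> x = w \<epsilon> x + z \<epsilon> x}"

definition c_bounded ::
  "'a::euclidean_space set \<Rightarrow> 'b::euclidean_space set \<Rightarrow> ('a, 'b) net \<Rightarrow> bool" where
  "c_bounded U V u \<longleftrightarrow> u \<in> moderate_nets U \<and>
     (\<exists>\<epsilon>\<^sub>0 \<in> {0<..1}. \<forall>\<epsilon> \<in> {0<..\<epsilon>\<^sub>0}. u \<epsilon> ` U \<subseteq> V) \<and>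
     (\<forall>K. K \<subset>\<subset> U \<longrightarrow> (\<exists>L. L \<subset>\<subset> V \<and> (\<exists>\<epsilon>\<^sub>0 \<in> {0<..1}. \<forall>\<epsilon> \<in> {0<..\<epsilon>\<^sub>0}. u \<epsilon> ` K \<subseteq> L)))"

definition colombeau_into ::
  "'a::euclidean_space set \<Rightarrow> 'b::euclidean_space set \<Rightarrow> ('a, 'b) net set set" where
  "colombeau_into U V = {u \<in> colombeau U. \<exists>u' \<in> u. c_bounded U V u'}"

text \<open>Operations on classes are given as the union, over all representatives, of the resulting
  classes; whenever the operation is well defined these classes all coincide.\<close>

definition colombeau_comp ::
  "'a::euclidean_space set \<Rightarrow> 'b::euclidean_space set \<Rightarrow>
   ('b, 'c::euclidean_space) net set \<Rightarrow> ('a, 'b) net set \<Rightarrow> ('a, 'c) net set" where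
  "colombeau_comp U V v u =
     (\<Union>v' \<in> v. \<Union>u' \<in> {u' \<in> u. c_bounded U V u'}. colombeau_class U (\<lambda>\<epsilon>. v' \<epsilon> \<circ> u' \<epsilon>))"

definition colombeau_dot ::
  "real set \<Rightarrow> (real, 'b::euclidean_space) net set \<Rightarrow> (real, 'b) net set" where
  "colombeau_dot J u = (\<Union>u' \<in> u. colombeau_class J (\<lambda>\<epsilon> t. vector_derivative (u' \<epsilon>) (at t)))"

definition colombeau_id_pair ::
  "real set \<Rightarrow> (real, 'b::euclidean_space) net set \<Rightarrow> (real, real \<times> 'b) net set" where
  "colombeau_id_pair J u = (\<Union>u' \<in> u. colombeau_class J (\<lambda>\<epsilon> t. (t, u' \<epsilon> t)))"


section \<open>Generalized points\<close>

type_synonym 'a pnet = "real \<Rightarrow> 'a"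

definition moderate_points :: "'a::euclidean_space set \<Rightarrow> 'a pnet set" where
  "moderate_points U = {x. (\<forall>\<epsilon> \<in> {0<..1}. x \<epsilon> \<in> U) \<and>
     (\<exists>N::nat. (\<lambda>\<epsilon>. norm (x \<epsilon>)) \<in> O[at_right 0](\<lambda>\<epsilon>. 1 / \<epsilon> ^ N))}"

definition points_equiv :: "'a::euclidean_space pnet \<Rightarrow> 'a pnet \<Rightarrow> bool" where
  "points_equiv x y \<longleftrightarrow> (\<forall>m::nat. (\<lambda>\<epsilon>. norm (x \<epsilon> - y \<epsilon>)) \<in> O[at_right 0](\<lambda>\<epsilon>. \<epsilon> ^ m))"

definition gen_points :: "'a::euclidean_space set \<Rightarrow> 'a pnet set set" where
  "gen_points U = moderate_points U //
     {(x, y). x \<in> moderate_points U \<and> y \<in> moderate_points U \<and> points_equiv x y}"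

text \<open>The class of \<open>x\<close> in \<open>\<tilde>U\<close>; here \<open>x \<epsilon> \<in> U\<close> is needed for small \<open>\<epsilon>\<close> only.\<close>

definition point_class :: "'a::euclidean_space set \<Rightarrow> 'a pnet \<Rightarrow> 'a pnet set" where
  "point_class U x = {y \<in> moderate_points U. points_equiv x y}"

definition cpt_points :: "'a::euclidean_space set \<Rightarrow> 'a pnet set set" where
  "cpt_points U = {X \<in> gen_points U. \<exists>x \<in> X. \<exists>K. K \<subset>\<subset> U \<and>
     (\<exists>\<epsilon>\<^sub>0 \<in> {0<..1}. \<forall>\<epsilon> \<in> {0<..\<epsilon>\<^sub>0}. x \<epsilon> \<in> K)}"

definition near_standard_at :: "'a::euclidean_space set \<Rightarrow> 'a pnet set \<Rightarrow> 'a \<Rightarrow> bool" where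
  "near_standard_at U X x\<^sub>0 \<longleftrightarrow>
     X \<in> cpt_points U \<and> x\<^sub>0 \<in> U \<and> (\<exists>x \<in> X. (x \<longlongrightarrow> x\<^sub>0) (at_right 0))"

text \<open>The point value \<open>u(\<tilde>x)\<close> as a generalized point of the set \<open>V\<close>.\<close>

definition point_value ::
  "'b::euclidean_space set \<Rightarrow> ('a::euclidean_space, 'b) net set \<Rightarrow> 'a pnet set \<Rightarrow> 'b pnet set" where
  "point_value V u X = (\<Union>u' \<in> u. \<Union>x \<in> X. point_class V (\<lambda>\<epsilon>. u' \<epsilon> (x \<epsilon>)))"

text \<open>\<open>u(\<tilde>p, .)\<close> in \<open>\<G>(J)\<close> and \<open>F(., ., \<tilde>p)\<close> in \<open>\<G>(I \<times> U)\<close>.\<close>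

definition insert_first ::
  "'a::euclidean_space set \<Rightarrow> ('p::euclidean_space \<times> 'a, 'b::euclidean_space) net set \<Rightarrow>
   'p pnet set \<Rightarrow> ('a, 'b) net set" where
  "insert_first J u p = (\<Union>u' \<in> u. \<Union>p' \<in> p. colombeau_class J (\<lambda>\<epsilon> t. u' \<epsilon> (p' \<epsilon>, t)))"

definition insert_third ::
  "('a::euclidean_space \<times> 'b::euclidean_space) set \<Rightarrow>
   ('a \<times> 'b \<times> 'p::euclidean_space, 'c::euclidean_space) net set \<Rightarrow>
   'p pnet set \<Rightarrow> ('a \<times> 'b, 'c) net set" where
  "insert_third S F p =
     (\<Union>F' \<in> F. \<Union>p' \<in> p. colombeau_class S (\<lambda>\<epsilon> (t, x). F' \<epsilon> (t, x, p' \<epsilon>)))"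


section \<open>Solutions of initial value problems\<close>

text \<open>\<open>u\<close> solves \<open>u'(t) = G(t, u(t))\<close>, \<open>u(T) = X\<close> on the open subinterval \<open>J\<close> of \<open>I\<close>,
  where \<open>G \<in> \<G>(I \<times> U)\<^sup>n\<close>.\<close>

definition ivp_solution ::
  "real set \<Rightarrow> 'x::euclidean_space set \<Rightarrow> (real \<times> 'x, 'x) net set \<Rightarrow> real pnet set \<Rightarrow>
   'x pnet set \<Rightarrow> real set \<Rightarrow> (real, 'x) net set \<Rightarrow> bool" where
  "ivp_solution I U G T X J u \<longleftrightarrow>
     u \<in> colombeau_into J U \<and>
     colombeau_dot J u = colombeau_comp J (I \<times> U) G (colombeau_id_pair J u) \<and>
     point_value U u T = X"


section \<open>Consistency of the class operation\<close>

lemma iter_pderiv_cong: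
  assumes "open U" "\<And>x. x \<in> U \<Longrightarrow> f x = g x" "x \<in> U"
  shows "iter_pderiv bs f x = iter_pderiv bs g x"
  using assms(3)
proof (induction bs arbitrary: x)
  case (Cons b bs)
  have "(iter_pderiv bs f has_derivative D) (at x) \<longleftrightarrow>
        (iter_pderiv bs g has_derivative D) (at x)" for D
    using has_derivative_transform_within_open[OF _ assms(1) Cons.prems] Cons.IH by metis
  then show ?case by (simp add: frechet_derivative_def)
qed (simp add: assms(2))

lemma iter_pderiv_diff:
  assumes "open U" "smooth_fun_on U f" "smooth_fun_on U g" "bs \<in> lists Basis" "x \<in> U"
  shows "iter_pderiv bs (\<lambda>x. f x - g x) x = iter_pderiv bs f x - iter_pderiv bs g x \<and>
         iter_pderiv bs (\<lambda>x. f x - g x) differentiable (at x)"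
  using assms(4,5)
proof (induction bs arbitrary: x rule: list.induct)
  case Nil
  have "[] \<in> lists Basis" by simp
  then have "f differentiable (at x)" "g differentiable (at x)"
    using assms(2,3) Nil.prems(2) unfolding smooth_fun_on_def by (metis iter_pderiv.simps(1))+
  then show ?case by simp
next
  case (Cons b bs)
  have bs: "bs \<in> lists Basis" using Cons.prems(1) by simp
  have key: "(iter_pderiv cs (\<lambda>x. f x - g x) has_derivative
      (\<lambda>h. frechet_derivative (iter_pderiv cs f) (at y) h -
           frechet_derivative (iter_pderiv cs g) (at y) h)) (at y)"
    if cs: "cs \<in> lists Basis" and y: "y \<in> U"
      and eq: "\<And>z. z \<in> U \<Longrightarrow>
        iter_pderiv cs (\<lambda>x. f x - g x) z = iter_pderiv cs f z - iter_pderiv cs g z" for cs y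
  proof (rule has_derivative_transform_within_open[OF _ assms(1) y])
    show "((\<lambda>z. iter_pderiv cs f z - iter_pderiv cs g z) has_derivative
      (\<lambda>h. frechet_derivative (iter_pderiv cs f) (at y) h -
           frechet_derivative (iter_pderiv cs g) (at y) h)) (at y)"
      using assms(2,3) cs y
      by (intro has_derivative_diff) (auto simp: smooth_fun_on_def frechet_derivative_works[symmetric])
  qed (simp add: eq)
  have eq: "iter_pderiv (b # bs) (\<lambda>x. f x - g x) z =
      iter_pderiv (b # bs) f z - iter_pderiv (b # bs) g z" if "z \<in> U" for z
    using frechet_derivative_at[OF key[OF bs that]] Cons.IH[OF bs]
    by (metis (no_types, lifting) iter_pderiv.simps(2))
  show ?case
    using eq Cons.prems key[OF Cons.prems(1,2) eq] by (auto intro: differentiableI simp del: iter_pderiv.simps)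
qed

lemma smooth_nets_diff:
  assumes "open U" "u \<in> smooth_nets U" "v \<in> smooth_nets U"
  shows "(\<lambda>\<epsilon> x. u \<epsilon> x - v \<epsilon> x) \<in> smooth_nets U"
proof -
  have "smooth_fun_on U (\<lambda>x. u \<epsilon> x - v \<epsilon> x)" if "\<epsilon> \<in> {0<..1}" for \<epsilon>
    unfolding smooth_fun_on_def
    using iter_pderiv_diff[OF assms(1), of "u \<epsilon>" "v \<epsilon>"] assms(2,3) that
    by (simp add: smooth_nets_def)
  then show ?thesis by (simp add: smooth_nets_def)
qed

lemma negligible_nets_eventually_eq:
  assumes "open U" "z \<in> negligible_nets U" "y \<in> smooth_nets U"
    and "\<forall>\<^sub>F \<epsilon> in at_right 0. \<forall>x \<in> U. y \<epsilon> x = z \<epsilon> x"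
  shows "y \<in> negligible_nets U"
proof -
  have "sup_bigo K (\<lambda>\<epsilon>. iter_pderiv bs (y \<epsilon>)) (\<lambda>\<epsilon>. \<epsilon> ^ m)"
    if K: "K \<subset>\<subset> U" and bs: "bs \<in> lists Basis" for K bs and m :: nat
  proof -
    have KU: "K \<subseteq> U" using K interior_subset by (auto simp: cpt_inside_def)
    obtain C where "\<forall>\<^sub>F \<epsilon> in at_right 0. \<forall>x \<in> K. norm (iter_pderiv bs (z \<epsilon>) x) \<le> C * \<bar>\<epsilon> ^ m\<bar>"
      using assms(2) K bs unfolding negligible_nets_def sup_bigo_def by blast
    with assms(4)
    have "\<forall>\<^sub>F \<epsilon> in at_right 0. \<forall>x \<in> K. norm (iter_pderiv bs (y \<epsilon>) x) \<le> C * \<bar>\<epsilon> ^ m\<bar>"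
    proof eventually_elim
      case (elim \<epsilon>)
      then show ?case using iter_pderiv_cong[OF assms(1), of "y \<epsilon>" "z \<epsilon>"] KU by (metis subsetD)
    qed
    then show ?thesis unfolding sup_bigo_def by blast
  qed
  then show ?thesis using assms(3) by (simp add: negligible_nets_def)
qed

lemma negligible_nets_diff:
  assumes "open U" "u \<in> negligible_nets U" "v \<in> negligible_nets U"
  shows "(\<lambda>\<epsilon> x. u \<epsilon> x - v \<epsilon> x) \<in> negligible_nets U"
proof -
  have sm: "u \<in> smooth_nets U" "v \<in> smooth_nets U"
    using assms by (auto simp: negligible_nets_def)
  have "sup_bigo K (\<lambda>\<epsilon>. iter_pderiv bs (\<lambda>x. u \<epsilon> x - v \<epsilon> x)) (\<lambda>\<epsilon>. \<epsilon> ^ m)"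
    if K: "K \<subset>\<subset> U" and bs: "bs \<in> lists Basis" for K bs and m :: nat
  proof -
    have KU: "K \<subseteq> U" using K interior_subset by (auto simp: cpt_inside_def)
    obtain C where C: "\<forall>\<^sub>F \<epsilon> in at_right 0. \<forall>x \<in> K. norm (iter_pderiv bs (u \<epsilon>) x) \<le> C * \<bar>\<epsilon> ^ m\<bar>"
      using assms(2) K bs unfolding negligible_nets_def sup_bigo_def by blast
    obtain D where D: "\<forall>\<^sub>F \<epsilon> in at_right 0. \<forall>x \<in> K. norm (iter_pderiv bs (v \<epsilon>) x) \<le> D * \<bar>\<epsilon> ^ m\<bar>"
      using assms(3) K bs unfolding negligible_nets_def sup_bigo_def by blast
    have "\<forall>\<^sub>F \<epsilon>::real in at_right 0. \<epsilon> \<in> {0<..1}"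
      using eventually_at_right_real[of 0 "1::real"] by (auto elim: eventually_mono)
    with C D have "\<forall>\<^sub>F \<epsilon> in at_right 0. \<forall>x \<in> K.
        norm (iter_pderiv bs (\<lambda>x. u \<epsilon> x - v \<epsilon> x) x) \<le> (C + D) * \<bar>\<epsilon> ^ m\<bar>"
    proof eventually_elim
      case (elim \<epsilon>)
      show ?case
      proof
        fix x assume x: "x \<in> K"
        have "iter_pderiv bs (\<lambda>x. u \<epsilon> x - v \<epsilon> x) x = iter_pderiv bs (u \<epsilon>) x - iter_pderiv bs (v \<epsilon>) x"
          using iter_pderiv_diff[OF assms(1)] sm elim bs x KU unfolding smooth_nets_def by blast
        then show "norm (iter_pderiv bs (\<lambda>x. u \<epsilon> x - v \<epsilon> x) x) \<le> (C + D) * \<bar>\<epsilon> ^ m\<bar>"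
          using elim x norm_triangle_ineq4[of "iter_pderiv bs (u \<epsilon>) x" "iter_pderiv bs (v \<epsilon>) x"]
          by (fastforce simp: distrib_right)
      qed
    qed
    then show ?thesis unfolding sup_bigo_def by blast
  qed
  then show ?thesis using smooth_nets_diff[OF assms(1) sm] by (simp add: negligible_nets_def)
qed

lemma equiv_colombeau_rel:
  assumes "open U"
  shows "equiv (moderate_nets U)
    (colombeau_rel U :: (('a::euclidean_space, 'b::euclidean_space) net \<times> _) set)"
proof (rule equivI)
  have zero: "iter_pderiv bs (\<lambda>x::'a. 0::'b) = (\<lambda>x. 0)" for bs
    by (induction bs) (simp_all add: frechet_derivative_const)
  have neg0: "(\<lambda>\<epsilon> x. 0) \<in> (negligible_nets U :: ('a, 'b) net set)"
    by (auto simp: negligible_nets_def smooth_nets_def smooth_fun_on_def sup_bigo_def zero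
        intro!: exI[of _ 0])
  show "colombeau_rel U \<subseteq> moderate_nets U \<times> (moderate_nets U :: ('a, 'b) net set)"
    by (auto simp: colombeau_rel_def)
  show "refl_on (moderate_nets U) (colombeau_rel U :: (('a, 'b) net \<times> _) set)"
    using neg0 by (auto simp: refl_on_def colombeau_rel_def)
  show "sym (colombeau_rel U :: (('a, 'b) net \<times> _) set)"
    using negligible_nets_diff[OF assms neg0] by (fastforce simp: sym_def colombeau_rel_def)
  show "trans (colombeau_rel U :: (('a, 'b) net \<times> _) set)"
  proof (rule transI)
    fix u v w :: "('a, 'b) net"
    assume uv: "(u, v) \<in> colombeau_rel U" and vw: "(v, w) \<in> colombeau_rel U"
    have "(\<lambda>\<epsilon> x. w \<epsilon> x - v \<epsilon> x) \<in> negligible_nets U"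
      using negligible_nets_diff[OF assms neg0, of "\<lambda>\<epsilon> x. v \<epsilon> x - w \<epsilon> x"] vw
      by (simp add: colombeau_rel_def)
    from negligible_nets_diff[OF assms _ this, of "\<lambda>\<epsilon> x. u \<epsilon> x - v \<epsilon> x"] uv vw
    show "(u, w) \<in> colombeau_rel U" by (simp add: colombeau_rel_def)
  qed
qed

lemma colombeau_class_eq:
  fixes w :: "('a::euclidean_space, 'b::euclidean_space) net"
  assumes "open U" "w \<in> moderate_nets U"
  shows "colombeau_class U w = colombeau_rel U `` {w}"
proof -
  have sym: "sym (colombeau_rel U :: (('a, 'b) net \<times> _) set)"
    using equiv_colombeau_rel[OF assms(1)] unfolding equiv_def by blast
  have sm: "v \<in> smooth_nets U" if "v \<in> moderate_nets U" for v :: "('a, 'b) net"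
    using that by (simp add: moderate_nets_def)
  have "w' \<in> colombeau_class U w \<longleftrightarrow> (w', w) \<in> colombeau_rel U" for w'
  proof
    assume "w' \<in> colombeau_class U w"
    then obtain z where w': "w' \<in> moderate_nets U" and z: "z \<in> negligible_nets U"
      and ev: "\<forall>\<^sub>F \<epsilon> in at_right 0. \<forall>x \<in> U. w' \<epsilon> x = w \<epsilon> x + z \<epsilon> x"
      by (auto simp: colombeau_class_def)
    have "(\<lambda>\<epsilon> x. w' \<epsilon> x - w \<epsilon> x) \<in> negligible_nets U"
      using ev by (intro negligible_nets_eventually_eq[OF assms(1) z]
          smooth_nets_diff[OF assms(1) sm[OF w'] sm[OF assms(2)]]) (auto elim: eventually_mono)
    then show "(w', w) \<in> colombeau_rel U" using w' assms(2) by (simp add: colombeau_rel_def)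
  next
    assume "(w', w) \<in> colombeau_rel U"
    then show "w' \<in> colombeau_class U w"
      by (auto simp: colombeau_rel_def colombeau_class_def
          intro!: bexI[of _ "\<lambda>\<epsilon> x. w' \<epsilon> x - w \<epsilon> x"])
  qed
  then show ?thesis using symD[OF sym] by (intro set_eqI) (metis Image_singleton_iff)
qed

end

theory Submission
  imports Defs
begin

text \<open>Fix \<open>\<epsilon>\<close>.  On \<open>cball (x\<^sub>0 \<epsilon>) \<beta>\<close>, a convex subset of \<open>L\<^sub>\<beta>\<close>, the field \<open>F\<^sub>\<epsilon>\<close> is Lipschitz and bounded by
  \<open>a\<close>, so a classical solution starting at \<open>x\<^sub>0 \<epsilon>\<close> needs a time \<open>\<beta> / a\<close> to leave the ball.  The net of these
  solutions, depending smoothly on the parameter \<open>p\<close>, is to represent the generalized solution.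

  \<^bold>\<open>Moderateness.\<close>  The linearized equation along the solution has coefficients of size
  \<open>O(\<bar>ln \<epsilon>\<bar>)\<close>, and Gronwall's inequality turns this into the factor \<open>exp (C \<bar>ln \<epsilon>\<bar>) = \<epsilon> powr -C\<close>,
  a negative power of \<open>\<epsilon>\<close>.  Every derivative of the solution in the parameter solves a
  linear equation with the same coefficients and with an inhomogeneity made of lower derivatives, so an
  induction on the order gives moderateness of all derivatives together with their existence
  (\<open>linear_ode_moderate\<close>, \<open>ode_moderate\<close>).  The induction is carried by the predicate \<open>moderate_upto k\<close>,
  which is closed under sums, products and compositions.

  \<^bold>\<open>The shifted initial time.\<close>  The solution starts at \<open>\<tau> \<epsilon> \<approx> t\<^sub>0\<close> and not at \<open>t\<^sub>0\<close>, so near the ends of \<open>J\<close> it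
  may have travelled for a time slightly longer than \<open>\<beta> / a\<close>.  The field is therefore multiplied by a smooth
  cutoff in time, which switches it off shortly before the ends.  On every compact subset of
  \<open>J\<close> the cutoff is \<open>1\<close> for small \<open>\<epsilon>\<close>, so no generalized function notices it (\<open>flow_net_exists\<close>).

  \<^bold>\<open>Uniqueness.\<close>  A moderate net is negligible as soon as its values are, without a look at its derivatives
  (\<open>moderate_negligible_nets\<close>).  If the values of \<open>v - u\<close> failed to be negligible on some compact set, then the
  parameters at which this happens would form a compactly supported generalized point \<open>p\<close>.  But at \<open>p\<close> both
  nets solve the same problem up to negligible errors, and Gronwall's inequality amplifies such errors only
  by a power of \<open>1 / \<epsilon>\<close> (\<open>ivp_net_unique\<close>, \<open>locally_negligible_by_parameters\<close>).

  The passage between classes and nets is \<open>ivp_solution_insert_first_iff\<close>: for a c-bounded representative, being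
  a solution means that the differential equation holds up to an error whose values are negligible, and
  that the initial values are equivalent.\<close>

section \<open>Gronwall estimates\<close>

text \<open>The square of the norm is differentiable also where \<open>w\<close> vanishes, and
  \<open>2 \<bar>w\<bar> D \<le> \<bar>w\<bar>\<^sup>2 + D\<^sup>2\<close> makes its differential inequality linear.  The price is the harmless
  additional \<open>1\<close> in the exponent.\<close>

lemma gronwall_right:
  fixes w :: "real \<Rightarrow> 'a::real_inner"
  assumes "s \<le> t" "C \<ge> 0"
    and deriv: "\<And>r. r \<in> {s..t} \<Longrightarrow> (w has_vector_derivative w' r) (at r within {s..t})"
    and bound: "\<And>r. r \<in> {s<..<t} \<Longrightarrow> norm (w' r) \<le> C * norm (w r) + D"
  shows "(norm (w t))\<^sup>2 \<le> ((norm (w s))\<^sup>2 + D\<^sup>2 * (t - s)) * exp ((2 * C + 1) * (t - s))"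
proof -
  define c where "c = 2 * C + 1"
  (* The integrating factor turns the differential inequality into monotonicity of q. *)
  define q where "q r = (w r \<bullet> w r) * exp (- c * (r - s)) - D\<^sup>2 * r" for r
  have cont: "continuous_on {s..t} w"
    using deriv has_vector_derivative_continuous continuous_on_eq_continuous_within by blast
  have "q t \<le> q s"
  proof (rule DERIV_nonpos_imp_decreasing_open[OF \<open>s \<le> t\<close>])
    show "continuous_on {s..t} q"
      unfolding q_def by (intro continuous_intros cont)
    fix r assume r: "s < r" "r < t"
    have "(w has_vector_derivative w' r) (at r within {s<..<t})"
      by (rule has_vector_derivative_within_subset[OF deriv]) (use r in auto)
    then have w': "(w has_vector_derivative w' r) (at r)"
      using r by (simp add: at_within_open[of r "{s<..<t}"])
    have "((\<lambda>r. w r \<bullet> w r) has_field_derivative (2 * (w r \<bullet> w' r))) (at r)"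
      unfolding has_field_derivative_def
      by (rule has_derivative_eq_rhs[OF has_derivative_inner
            [OF w'[unfolded has_vector_derivative_def] w'[unfolded has_vector_derivative_def]]])
        (auto simp: fun_eq_iff inner_commute)
    then have d: "(q has_field_derivative
        (2 * (w r \<bullet> w' r) - c * (w r \<bullet> w r)) * exp (- c * (r - s)) - D\<^sup>2) (at r)"
      unfolding q_def by (auto intro!: derivative_eq_intros simp: algebra_simps)
    have "2 * (w r \<bullet> w' r) \<le> 2 * (norm (w r) * norm (w' r))"
      using norm_cauchy_schwarz by simp
    also have "\<dots> \<le> 2 * (norm (w r) * (C * norm (w r) + D))"
      using bound r by (intro mult_left_mono) auto
    also have "\<dots> \<le> c * (w r \<bullet> w r) + D\<^sup>2"
      using zero_le_power2[of "norm (w r) - D"]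
      by (simp add: c_def power2_norm_eq_inner[symmetric] power2_eq_square algebra_simps)
    finally have "2 * (w r \<bullet> w' r) - c * (w r \<bullet> w r) \<le> D\<^sup>2" by simp
    then have "(2 * (w r \<bullet> w' r) - c * (w r \<bullet> w r)) * exp (- c * (r - s)) \<le> D\<^sup>2 * exp (- c * (r - s))"
      by (rule mult_right_mono) simp
    also have "\<dots> \<le> D\<^sup>2 * 1"
      using r \<open>C \<ge> 0\<close> by (intro mult_left_mono) (auto simp: c_def intro!: mult_nonpos_nonneg)
    finally show "\<exists>y. (q has_field_derivative y) (at r) \<and> y \<le> 0"
      using d by (intro exI conjI) auto
  qed
  then have "(norm (w t))\<^sup>2 * exp (- c * (t - s)) \<le> (norm (w s))\<^sup>2 + D\<^sup>2 * (t - s)"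
    by (simp add: q_def power2_norm_eq_inner algebra_simps)
  then have "(norm (w t))\<^sup>2 * exp (- c * (t - s)) * exp (c * (t - s))
      \<le> ((norm (w s))\<^sup>2 + D\<^sup>2 * (t - s)) * exp (c * (t - s))"
    by (rule mult_right_mono) simp
  moreover have "(norm (w t))\<^sup>2 * exp (- c * (t - s)) * exp (c * (t - s)) = (norm (w t))\<^sup>2"
    by (simp add: mult.assoc mult_exp_exp)
  ultimately show ?thesis
    unfolding c_def by metis
qed

text \<open>A bootstrap: at the first time at which \<open>\<bar>w\<bar>\<close> reaches \<open>\<rho>\<close> the estimate is available up to that time and
  contradicts \<open>small\<close>.  This is what allows a Lipschitz condition that is known only near a reference solution.\<close>

lemma gronwall_local_right:
  fixes w :: "real \<Rightarrow> 'a::real_inner"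
  assumes "s \<le> t" "C \<ge> 0" "\<rho> > 0"
    and deriv: "\<And>r. r \<in> {s..t} \<Longrightarrow> (w has_vector_derivative w' r) (at r within {s..t})"
    and bound: "\<And>r. r \<in> {s..t} \<Longrightarrow> norm (w r) \<le> \<rho> \<Longrightarrow> norm (w' r) \<le> C * norm (w r) + D"
    and small: "((norm (w s))\<^sup>2 + D\<^sup>2 * (t - s)) * exp ((2 * C + 1) * (t - s)) < \<rho>\<^sup>2"
  shows "(norm (w t))\<^sup>2 \<le> ((norm (w s))\<^sup>2 + D\<^sup>2 * (t - s)) * exp ((2 * C + 1) * (t - s))"
proof -
  define S where "S = {r \<in> {s..t}. norm (w r) \<in> {\<rho>..}}"
  have cont: "continuous_on {s..t} (\<lambda>r. norm (w r))"
    using deriv has_vector_derivative_continuous continuous_on_eq_continuous_within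
    by (intro continuous_on_norm) blast
  have "S = {}"
  proof (rule ccontr)
    assume ne: "S \<noteq> {}"
    have "closed S"
      using continuous_closed_preimage[OF cont, of "{\<rho>..}"] unfolding S_def vimage_def
      by (simp add: Int_def conj_commute)
    moreover have bd: "bdd_below S" unfolding S_def by (intro bdd_belowI[of _ s]) auto
    ultimately have inf: "Inf S \<in> S" using closed_contains_Inf ne by blast
    define t1 where "t1 = Inf S"
    have t1: "t1 \<in> {s..t}" "norm (w t1) \<ge> \<rho>" using inf by (auto simp: S_def t1_def)
    have less: "norm (w r) < \<rho>" if "r \<in> {s..<t1}" for r
      using cInf_lower[OF _ bd, of r] that t1(1) unfolding t1_def by (force simp: S_def)
    have "(norm (w t1))\<^sup>2 \<le> ((norm (w s))\<^sup>2 + D\<^sup>2 * (t1 - s)) * exp ((2 * C + 1) * (t1 - s))"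
      using t1 less by (intro gronwall_right[OF _ \<open>C \<ge> 0\<close>, where w' = w'] bound
          has_vector_derivative_within_subset[OF deriv]) (auto simp: less_imp_le)
    also have "\<dots> \<le> ((norm (w s))\<^sup>2 + D\<^sup>2 * (t - s)) * exp ((2 * C + 1) * (t - s))"
      using t1 \<open>C \<ge> 0\<close> by (intro mult_mono add_mono mult_left_mono) auto
    finally have "(norm (w t1))\<^sup>2 < \<rho>\<^sup>2" using small by simp
    then show False using t1(2) \<open>\<rho> > 0\<close> by (simp add: power_mono leD)
  qed
  then have "norm (w r) \<le> \<rho>" if "r \<in> {s..t}" for r using that by (force simp: S_def)
  then show ?thesis using assms by (intro gronwall_right[where w' = w'] bound) auto
qed

lemma gronwall_local:
  fixes w :: "real \<Rightarrow> 'a::real_inner"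
  assumes T: "convex T" "s \<in> T" "t \<in> T" and "C \<ge> 0" "\<rho> > 0"
    and deriv: "\<And>r. r \<in> T \<Longrightarrow> (w has_vector_derivative w' r) (at r within T)"
    and bound: "\<And>r. r \<in> T \<Longrightarrow> norm (w r) \<le> \<rho> \<Longrightarrow> norm (w' r) \<le> C * norm (w r) + D"
    and small: "((norm (w s))\<^sup>2 + D\<^sup>2 * \<bar>t - s\<bar>) * exp ((2 * C + 1) * \<bar>t - s\<bar>) < \<rho>\<^sup>2"
  shows "(norm (w t))\<^sup>2 \<le> ((norm (w s))\<^sup>2 + D\<^sup>2 * \<bar>t - s\<bar>) * exp ((2 * C + 1) * \<bar>t - s\<bar>)"
proof -
  have seg: "closed_segment s t \<subseteq> T" using T by (simp add: closed_segment_subset)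
  show ?thesis
  proof (cases "s \<le> t")
    case True
    then have "{s..t} \<subseteq> T" using seg by (simp add: closed_segment_eq_real_ivl)
    with True assms show ?thesis
      by (simp add: abs_of_nonneg)
        (rule gronwall_local_right[where w' = w' and \<rho> = \<rho>],
          auto intro!: has_vector_derivative_within_subset[OF deriv])
  next
    case False
    then have sub: "{t..s} \<subseteq> T" using seg by (simp add: closed_segment_eq_real_ivl)
    have d: "((\<lambda>r. w (- r)) has_vector_derivative - w' (- r)) (at r within {-s..-t})"
      if "r \<in> {-s..-t}" for r
    proof -
      have "(uminus has_real_derivative -1) (at r within {-s..-t})"
        by (auto intro!: derivative_eq_intros)
      moreover have "(w has_vector_derivative w' (- r)) (at (- r) within uminus ` {-s..-t})"
        by (rule has_vector_derivative_within_subset[OF deriv]) (use that sub in auto)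
      ultimately show ?thesis
        using vector_diff_chain_within[of uminus "-1" r "{-s..-t}" w "w' (- r)"]
        by (simp add: o_def has_real_derivative_iff_has_vector_derivative)
    qed
    have "(norm (w (- (- t))))\<^sup>2 \<le> ((norm (w (- (- s))))\<^sup>2 + D\<^sup>2 * (- t - - s)) * exp ((2 * C + 1) * (- t - - s))"
    proof (rule gronwall_local_right[where w' = "\<lambda>r. - w' (- r)" and \<rho> = \<rho>])
      show "norm (- w' (- r)) \<le> C * norm (w (- r)) + D"
        if "r \<in> {- s..- t}" "norm (w (- r)) \<le> \<rho>" for r
        using bound[of "- r"] sub that by (auto simp: subset_iff)
    qed (use assms False d in auto)
    then show ?thesis using False by simp
  qed
qed

text \<open>The local version with any \<open>\<rho>\<close> beyond the right-hand side.\<close>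

lemma gronwall:
  fixes w :: "real \<Rightarrow> 'a::real_inner"
  assumes T: "convex T" "s \<in> T" "t \<in> T" and "C \<ge> 0"
    and deriv: "\<And>r. r \<in> T \<Longrightarrow> (w has_vector_derivative w' r) (at r within T)"
    and bound: "\<And>r. r \<in> T \<Longrightarrow> norm (w' r) \<le> C * norm (w r) + D"
  shows "(norm (w t))\<^sup>2 \<le> ((norm (w s))\<^sup>2 + D\<^sup>2 * \<bar>t - s\<bar>) * exp ((2 * C + 1) * \<bar>t - s\<bar>)" (is "_ \<le> ?R")
proof (rule gronwall_local[OF T \<open>C \<ge> 0\<close> _ deriv bound])
  have "?R \<ge> 0" by simp
  moreover have "x < (x + 1)\<^sup>2" "x + 1 > 0" if "x \<ge> 0" for x :: real
    using that mult_nonneg_nonneg[OF that that] by (simp_all add: power2_eq_square algebra_simps add_pos_nonneg)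
  ultimately show "?R < (?R + 1)\<^sup>2" "?R + 1 > 0" by blast+
qed auto

section \<open>Solutions of Lipschitz equations\<close>

text \<open>Integrating \<open>B \<bar>r - s\<bar> ^ n\<close> in both directions of time.  The case \<open>n = 0\<close> is the mean value inequality; the
  general case produces the factorials in the Picard iteration.\<close>

lemma power_bound_integrated:
  fixes f :: "real \<Rightarrow> 'a::euclidean_space"
  assumes s: "s \<in> {c..d}" and t: "t \<in> {c..d}"
    and deriv: "\<And>r. r \<in> {c..d} \<Longrightarrow> (f has_vector_derivative f' r) (at r within {c..d})"
    and bound: "\<And>r. r \<in> {c..d} \<Longrightarrow> norm (f' r) \<le> B * \<bar>r - s\<bar> ^ n"
  shows "norm (f t - f s) \<le> B * \<bar>t - s\<bar> ^ Suc n / (Suc n)"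
proof -
  have cont: "continuous_on {c..d} f"
    using deriv has_vector_derivative_continuous continuous_on_eq_continuous_within by blast
  have at: "(f has_vector_derivative f' r) (at r)" if "c < r" "r < d" for r
  proof -
    have "(f has_vector_derivative f' r) (at r within {c<..<d})"
      by (rule has_vector_derivative_within_subset[OF deriv]) (use that in auto)
    then show ?thesis using that by (simp add: at_within_open[of r "{c<..<d}"])
  qed
  consider "s = t" | "s < t" | "t < s" by linarith
  then show ?thesis
  proof cases
    case 2
    define \<phi> where "\<phi> r = B * (r - s) ^ Suc n / (Suc n)" for r
    have "norm (f t - f s) \<le> \<phi> t - \<phi> s"
    proof (rule differentiable_bound_general[OF 2])
      show "(\<phi> has_vector_derivative B * (r - s) ^ n) (at r)" for r
        unfolding \<phi>_def has_real_derivative_iff_has_vector_derivative[symmetric]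
        by (auto intro!: derivative_eq_intros simp: field_simps simp del: of_nat_Suc power_Suc)
      show "norm (f' r) \<le> B * (r - s) ^ n" if "s < r" "r < t" for r
        using bound[of r] that s t by auto
      show "(f has_vector_derivative f' r) (at r)" if "s < r" "r < t" for r
        using at that s t by auto
      show "continuous_on {s..t} \<phi>" unfolding \<phi>_def by (intro continuous_intros) auto
      show "continuous_on {s..t} f" by (rule continuous_on_subset[OF cont]) (use s t in auto)
    qed
    then show ?thesis using 2 by (simp add: \<phi>_def)
  next
    case 3
    define \<phi> where "\<phi> r = - B * (s - r) ^ Suc n / (Suc n)" for r
    have "norm (f s - f t) \<le> \<phi> s - \<phi> t"
    proof (rule differentiable_bound_general[OF 3])
      show "(\<phi> has_vector_derivative B * (s - r) ^ n) (at r)" for r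
        unfolding \<phi>_def has_real_derivative_iff_has_vector_derivative[symmetric]
        by (auto intro!: derivative_eq_intros simp: field_simps simp del: of_nat_Suc power_Suc)
      show "norm (f' r) \<le> B * (s - r) ^ n" if "t < r" "r < s" for r
        using bound[of r] that s t by auto
      show "(f has_vector_derivative f' r) (at r)" if "t < r" "r < s" for r
        using at that s t by auto
      show "continuous_on {t..s} \<phi>" unfolding \<phi>_def by (intro continuous_intros) auto
      show "continuous_on {t..s} f" by (rule continuous_on_subset[OF cont]) (use s t in auto)
    qed
    then show ?thesis using 3 by (simp add: \<phi>_def norm_minus_commute)
  qed simp
qed

text \<open>The differences of consecutive Picard iterates are bounded by \<open>M (k \<bar>t - s\<bar>) ^ n / n!\<close>, so the iterates
  converge uniformly on the whole interval, however large \<open>k\<close> and the interval are.\<close>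

lemma picard_lindelof_compact:
  fixes g :: "real \<Rightarrow> 'a::euclidean_space \<Rightarrow> 'a"
  assumes s: "s \<in> {c..d}"
    and cont: "continuous_on ({c..d} \<times> UNIV) (\<lambda>(t, x). g t x)"
    and lip: "\<And>t. t \<in> {c..d} \<Longrightarrow> k-lipschitz_on UNIV (g t)"
  shows "\<exists>y. y s = \<xi> \<and> (\<forall>t \<in> {c..d}. (y has_vector_derivative g t (y t)) (at t within {c..d}))"
proof -
  (* The integral from s to t, with the correct sign also for t < s. *)
  define A where "A f t = integral {c..t} f - integral {c..s} f" for f :: "real \<Rightarrow> 'a" and t
  have A: "(A f has_vector_derivative f t) (at t within {c..d})"
    if "continuous_on {c..d} f" "t \<in> {c..d}" for f t
    using integral_has_vector_derivative[OF that] unfolding A_def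
    by (auto intro: derivative_eq_intros)
  have "A f s = 0" for f by (simp add: A_def)
  define Y where "Y = rec_nat (\<lambda>_. \<xi>) (\<lambda>n y t. \<xi> + A (\<lambda>r. g r (y r)) t)"
  have Y0: "Y 0 = (\<lambda>_. \<xi>)" and YS: "Y (Suc n) = (\<lambda>t. \<xi> + A (\<lambda>r. g r (Y n r)) t)" for n
    by (simp_all add: Y_def)
  have Ys: "Y n s = \<xi>" for n by (cases n) (simp_all add: Y0 YS A_def)
  have comp_cont: "continuous_on {c..d} (\<lambda>r. g r (y r))" if "continuous_on {c..d} y" for y
    using continuous_on_compose2[OF cont continuous_on_Pair[OF continuous_on_id that]] by auto
  have Ycont: "continuous_on {c..d} (Y n)" for n
  proof (induction n)
    case (Suc n)
    show ?case unfolding YS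
      using A[OF comp_cont[OF Suc]] has_vector_derivative_continuous continuous_on_eq_continuous_within
      by (intro continuous_intros) blast
  qed (simp add: Y0)
  have Yd: "(Y (Suc n) has_vector_derivative g t (Y n t)) (at t within {c..d})"
    if "t \<in> {c..d}" for n t
    using has_vector_derivative_add[OF has_vector_derivative_const A[OF comp_cont[OF Ycont] that]]
    unfolding YS by simp
  obtain t0 where t0: "t0 \<in> {c..d}" using s by blast
  have l0: "k \<ge> 0" using lip[OF t0] by (rule lipschitz_on_nonneg)
  obtain M where M: "\<And>t. t \<in> {c..d} \<Longrightarrow> norm (Y 1 t - Y 0 t) \<le> M"
  proof -
    have "bounded ((\<lambda>t. Y 1 t - Y 0 t) ` {c..d})"
      by (intro compact_imp_bounded compact_continuous_image continuous_intros Ycont compact_Icc)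
    then show ?thesis using that unfolding bounded_iff by force
  qed
  have step: "norm (Y (Suc n) t - Y n t) \<le> M * (k * \<bar>t - s\<bar>) ^ n / fact n" if "t \<in> {c..d}" for n t
    using that
  proof (induction n arbitrary: t)
    case (Suc n)
    have "norm ((Y (Suc (Suc n)) t - Y (Suc n) t) - (Y (Suc (Suc n)) s - Y (Suc n) s))
        \<le> (M * k ^ Suc n / fact n) * \<bar>t - s\<bar> ^ Suc n / Suc n"
    proof (rule power_bound_integrated[OF s Suc.prems])
      fix r assume r: "r \<in> {c..d}"
      show "((\<lambda>t. Y (Suc (Suc n)) t - Y (Suc n) t) has_vector_derivative
          g r (Y (Suc n) r) - g r (Y n r)) (at r within {c..d})"
        by (intro has_vector_derivative_diff Yd r)
      have "norm (g r (Y (Suc n) r) - g r (Y n r)) \<le> k * norm (Y (Suc n) r - Y n r)"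
        using lipschitz_onD[OF lip[OF r]] by (auto simp: dist_norm)
      also have "\<dots> \<le> k * (M * (k * \<bar>r - s\<bar>) ^ n / fact n)"
        by (intro mult_left_mono Suc.IH r l0)
      finally show "norm (g r (Y (Suc n) r) - g r (Y n r)) \<le> (M * k ^ Suc n / fact n) * \<bar>r - s\<bar> ^ n"
        by (simp add: power_mult_distrib algebra_simps)
    qed
    then show ?case by (simp add: Ys power_mult_distrib algebra_simps)
  qed (use M in simp)
  have M0: "M \<ge> 0" using M[OF t0] norm_ge_zero order_trans by blast
  have "uniform_limit {c..d} (\<lambda>n t. \<Sum>i<n. Y (Suc i) t - Y i t) (\<lambda>t. suminf (\<lambda>i. Y (Suc i) t - Y i t)) sequentially"
  proof (rule Weierstrass_m_test)
    show "norm (Y (Suc n) t - Y n t) \<le> M * ((k * (d - c)) ^ n /\<^sub>R fact n)" if "t \<in> {c..d}" for n t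
    proof -
      have "M * (k * \<bar>t - s\<bar>) ^ n / fact n \<le> M * (k * (d - c)) ^ n / fact n"
        using that s l0 M0 by (intro divide_right_mono mult_left_mono power_mono) auto
      then show ?thesis using step[OF that, of n] by (simp add: field_simps)
    qed
    show "summable (\<lambda>n. M * ((k * (d - c)) ^ n /\<^sub>R fact n))"
      by (intro summable_mult summable_exp_generic)
  qed
  moreover have "(\<Sum>i<n. Y (Suc i) t - Y i t) = Y n t - \<xi>" for n t
    using sum_lessThan_telescope[of "\<lambda>n. Y n t" n] by (simp add: Y0)
  ultimately obtain z where z: "uniform_limit {c..d} (\<lambda>n t. Y n t - \<xi>) z sequentially"
    by auto
  define y where "y t = \<xi> + z t" for t
  have ylim: "uniform_limit {c..d} Y y sequentially"
    using z by (simp add: uniform_limit_iff dist_norm y_def algebra_simps)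
  have ypt: "(\<lambda>n. Y n t) \<longlonglongrightarrow> y t" if "t \<in> {c..d}" for t
    using tendsto_uniform_limitI[OF ylim that] .
  have "\<exists>u. \<forall>t\<in>{c..d}. (\<lambda>n. Y (Suc n) t) \<longlonglongrightarrow> u t \<and>
      (u has_derivative (\<lambda>h. h *\<^sub>R g t (y t))) (at t within {c..d})"
  proof (rule has_derivative_sequence[OF convex_real_interval(5) _ _ s])
    show "(Y (Suc n) has_derivative (\<lambda>h. h *\<^sub>R g t (Y n t))) (at t within {c..d})" if "t \<in> {c..d}" for n t
      using Yd[OF that] by (simp add: has_vector_derivative_def)
    show "\<forall>\<^sub>F n in sequentially. \<forall>t\<in>{c..d}. \<forall>h. norm (h *\<^sub>R g t (Y n t) - h *\<^sub>R g t (y t)) \<le> e * norm h"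
      if "e > 0" for e
    proof -
      have "e / (k + 1) > 0" using that l0 by simp
      from uniform_limitD[OF ylim this] show ?thesis
      proof eventually_elim
        case (elim n)
        show ?case
        proof safe
          fix t h assume t: "t \<in> {c..d}"
          have "norm (g t (Y n t) - g t (y t)) \<le> k * norm (Y n t - y t)"
            using lipschitz_onD[OF lip[OF t]] by (auto simp: dist_norm)
          also have "\<dots> \<le> k * (e / (k + 1))"
            using elim t l0 by (intro mult_left_mono) (auto simp: dist_norm less_imp_le)
          also have "\<dots> \<le> e" using l0 \<open>e > 0\<close> by (simp add: field_simps)
          finally show "norm (h *\<^sub>R g t (Y n t) - h *\<^sub>R g t (y t)) \<le> e * norm h"
            using mult_left_mono[of _ e "\<bar>h\<bar>"]
            by (simp add: scaleR_diff_right[symmetric] mult.commute[of _ "\<bar>h\<bar>"])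
        qed
      qed
    qed
    show "(\<lambda>n. Y (Suc n) s) \<longlonglongrightarrow> \<xi>" by (simp add: Ys)
  qed
  then obtain u where u: "\<And>t. t \<in> {c..d} \<Longrightarrow> (\<lambda>n. Y (Suc n) t) \<longlonglongrightarrow> u t"
    "\<And>t. t \<in> {c..d} \<Longrightarrow> (u has_vector_derivative g t (y t)) (at t within {c..d})"
    unfolding has_vector_derivative_def by blast
  have "u t = y t" if "t \<in> {c..d}" for t
    using LIMSEQ_unique[OF u(1)[OF that] LIMSEQ_Suc[OF ypt[OF that]]] .
  moreover have "y s = \<xi>" using LIMSEQ_unique[OF ypt[OF s]] by (simp add: Ys)
  ultimately show ?thesis using u(2) s by (intro exI[of _ u]) auto
qed

lemma ode_unique:
  fixes y :: "real \<Rightarrow> 'a::euclidean_space"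
  assumes T: "convex T" "s \<in> T" "t \<in> T"
    and lip: "\<And>r. r \<in> T \<Longrightarrow> k-lipschitz_on UNIV (g r)"
    and y: "\<And>r. r \<in> T \<Longrightarrow> (y has_vector_derivative g r (y r)) (at r within T)"
    and z: "\<And>r. r \<in> T \<Longrightarrow> (z has_vector_derivative g r (z r)) (at r within T)"
    and init: "y s = z s"
  shows "y t = z t"
proof -
  have "(norm (y t - z t))\<^sup>2 \<le> ((norm (y s - z s))\<^sup>2 + 0\<^sup>2 * \<bar>t - s\<bar>) * exp ((2 * k + 1) * \<bar>t - s\<bar>)"
  proof (rule gronwall[OF T])
    show "k \<ge> 0" using lip[OF T(2)] by (rule lipschitz_on_nonneg)
    show "((\<lambda>r. y r - z r) has_vector_derivative g r (y r) - g r (z r)) (at r within T)"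
      if "r \<in> T" for r using y z that by (intro has_vector_derivative_diff) auto
    show "norm (g r (y r) - g r (z r)) \<le> k * norm (y r - z r) + 0" if "r \<in> T" for r
      using lipschitz_onD[OF lip[OF that]] by (auto simp: dist_norm)
  qed
  then show ?thesis using init by simp
qed

text \<open>By uniqueness the solutions on the compact intervals \<open>K a\<close>, which exhaust the open one as \<open>a\<close> decreases to
  \<open>0\<close>, extend each other.  The Lipschitz constants may blow up at the ends; this happens for the linearized equation.\<close>

lemma picard_lindelof_open:
  fixes g :: "real \<Rightarrow> 'a::euclidean_space \<Rightarrow> 'a"
  assumes s: "s \<in> {c<..<d}"
    and cont: "continuous_on ({c<..<d} \<times> UNIV) (\<lambda>(t, x). g t x)"
    and lip: "\<And>c' d'. c < c' \<Longrightarrow> d' < d \<Longrightarrow> \<exists>k. \<forall>t \<in> {c'..d'}. k-lipschitz_on UNIV (g t)"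
  shows "\<exists>y. y s = \<xi> \<and> (\<forall>t \<in> {c<..<d}. (y has_vector_derivative g t (y t)) (at t))"
proof -
  define K where "K a = {c + a * (s - c)..d - a * (d - s)}" for a :: real
  have Ksub: "K a \<subseteq> {c<..<d}" and sK: "s \<in> K a" if "0 < a" "a < 1" for a
  proof -
    have "0 < a * (s - c)" "0 < a * (d - s)" "a * (s - c) \<le> 1 * (s - c)" "a * (d - s) \<le> 1 * (d - s)"
      using that s by (auto intro: mult_pos_pos mult_right_mono)
    then show "K a \<subseteq> {c<..<d}" "s \<in> K a" unfolding K_def by auto
  qed
  have Kmono: "K a \<subseteq> K b" if "b \<le> a" for a b
    using mult_right_mono[OF that, of "s - c"] mult_right_mono[OF that, of "d - s"] s by (auto simp: K_def)
  have lipK: "\<exists>k. \<forall>t \<in> K a. k-lipschitz_on UNIV (g t)" if "0 < a" "a < 1" for a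
    unfolding K_def using that s by (intro lip) auto
  define sol where "sol a y \<longleftrightarrow> y s = \<xi> \<and> (\<forall>t \<in> K a. (y has_vector_derivative g t (y t)) (at t within K a))"
    for a and y :: "real \<Rightarrow> 'a"
  have "\<exists>y. sol a y" if a: "0 < a" "a < 1" for a
  proof -
    obtain k where k: "\<forall>t \<in> K a. k-lipschitz_on UNIV (g t)" using lipK[OF a] by blast
    have "continuous_on (K a \<times> UNIV) (\<lambda>(t, x). g t x)"
      by (rule continuous_on_subset[OF cont]) (use Ksub[OF a] in auto)
    then show ?thesis unfolding sol_def
      using picard_lindelof_compact[of s _ _ g k \<xi>] k sK[OF a] unfolding K_def by blast
  qed
  then obtain Y where Y: "\<And>a. 0 < a \<Longrightarrow> a < 1 \<Longrightarrow> sol a (Y a)" by metis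
  have agree: "Y a t = Y b t" if ab: "0 < b" "b \<le> a" "a < 1" and t: "t \<in> K a" for a b t
  proof -
    obtain k where k: "\<forall>t \<in> K a. k-lipschitz_on UNIV (g t)" using lipK[of a] ab by auto
    show ?thesis
    proof (rule ode_unique[where T = "K a" and s = s and g = g and k = k])
      show "convex (K a)" "s \<in> K a" "t \<in> K a" using sK[of a] ab t by (auto simp: K_def)
      show "(Y a has_vector_derivative g r (Y a r)) (at r within K a)" if "r \<in> K a" for r
        using Y[of a] ab that by (auto simp: sol_def)
      show "(Y b has_vector_derivative g r (Y b r)) (at r within K a)" if "r \<in> K a" for r
        using Y[of b] ab that Kmono[OF \<open>b \<le> a\<close>]
        by (intro has_vector_derivative_within_subset[OF _ Kmono[OF \<open>b \<le> a\<close>]]) (auto simp: sol_def)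
      show "Y a s = Y b s" using Y[of a] Y[of b] ab by (simp add: sol_def)
    qed (use k in auto)
  qed
  (* A number a such that t is in the interior of K a. *)
  define depth where "depth t = min (1/2) (min ((t - c) / (s - c)) ((d - t) / (d - s)) / 2)" for t
  define y where "y t = Y (depth t) t" for t
  have depth: "0 < depth t" "depth t < 1" "t \<in> interior (K (depth t))" if "t \<in> {c<..<d}" for t
  proof -
    have p: "(t - c) / (s - c) > 0" "(d - t) / (d - s) > 0" using that s by auto
    show "0 < depth t" "depth t < 1" using p by (auto simp: depth_def)
    have "min (1/2) (min a b / 2) < a \<and> min (1/2) (min a b / 2) < b" if "a > 0" "b > 0" for a b :: real
      using that by (auto simp: min_def)
    from this[OF p] have "depth t < (t - c) / (s - c)" "depth t < (d - t) / (d - s)"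
      by (auto simp: depth_def)
    then show "t \<in> interior (K (depth t))" using s unfolding K_def interior_atLeastAtMost_real
      by (auto simp: field_simps)
  qed
  have yY: "y r = Y a r" if "0 < a" "a < 1" "r \<in> K a" for a r
  proof -
    have r: "r \<in> {c<..<d}" using Ksub that by blast
    have rK: "r \<in> K (depth r)" using depth(3)[OF r] interior_subset by blast
    show ?thesis using agree[of a "depth r" r] agree[of "depth r" a r] depth[OF r] that rK
      unfolding y_def by (cases "depth r \<le> a") auto
  qed
  have "(y has_vector_derivative g t (y t)) (at t)" if t: "t \<in> {c<..<d}" for t
  proof -
    let ?a = "depth t"
    note a = depth[OF t]
    have tK: "t \<in> K ?a" using a(3) interior_subset by blast
    have "(Y ?a has_vector_derivative g t (Y ?a t)) (at t within interior (K ?a))"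
      using Y[OF a(1,2)] tK unfolding sol_def
      using has_vector_derivative_within_subset[OF _ interior_subset] by blast
    then have "(Y ?a has_vector_derivative g t (Y ?a t)) (at t)"
      by (simp only: at_within_open[OF a(3) open_interior])
    then have "(Y ?a has_vector_derivative g t (y t)) (at t)" by (simp add: y_def)
    then show ?thesis
    proof (rule has_vector_derivative_transform_within_open[OF _ open_interior a(3)])
      show "Y ?a r = y r" if "r \<in> interior (K ?a)" for r
        using yY[OF a(1,2)] that interior_subset by (metis subsetD)
    qed
  qed
  moreover have "y s = \<xi>" using Y[OF depth(1,2)[OF s]] by (simp add: y_def sol_def)
  ultimately show ?thesis by blast
qed

section \<open>Differentiable dependence on parameters\<close>

lemma linear_sum_Basis:
  fixes D :: "'a::euclidean_space \<Rightarrow> 'b::real_vector"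
  assumes "linear D"
  shows "D h = (\<Sum>b\<in>Basis. (h \<bullet> b) *\<^sub>R D b)"
proof -
  have "D h = D (\<Sum>b\<in>Basis. (h \<bullet> b) *\<^sub>R b)" by (simp add: euclidean_representation)
  also have "\<dots> = (\<Sum>b\<in>Basis. (h \<bullet> b) *\<^sub>R D b)"
    using assms by (simp add: linear_sum linear_cmul)
  finally show ?thesis .
qed

lemma Minkowski_ball_eq:
  fixes L :: "'a::real_normed_vector set"
  shows "{x + y |x y. x \<in> L \<and> y \<in> cball 0 \<beta>} = (\<Union>x\<in>L. cball x \<beta>)"
    and "{x + y |x y. x \<in> L \<and> y \<in> ball 0 \<beta>} = (\<Union>x\<in>L. ball x \<beta>)"
proof -
  have eq: "{x + y |x y. x \<in> L \<and> y \<in> C} = (\<Union>x\<in>L. B x)" if "\<And>x z. z \<in> B x \<longleftrightarrow> z - x \<in> C"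
    for B :: "'a \<Rightarrow> 'a set" and C
  proof (intro equalityI subsetI)
    fix z assume "z \<in> {x + y |x y. x \<in> L \<and> y \<in> C}"
    then show "z \<in> (\<Union>x\<in>L. B x)" using that by fastforce
  next
    fix z assume "z \<in> (\<Union>x\<in>L. B x)"
    then obtain x where "x \<in> L" "z \<in> B x" by blast
    then have "z = x + (z - x) \<and> x \<in> L \<and> z - x \<in> C" using that[of z x] by simp
    then show "z \<in> {x + y |x y. x \<in> L \<and> y \<in> C}" by blast
  qed
  show "{x + y |x y. x \<in> L \<and> y \<in> cball 0 \<beta>} = (\<Union>x\<in>L. cball x \<beta>)"
    by (rule eq) (simp add: dist_norm norm_minus_commute)
  show "{x + y |x y. x \<in> L \<and> y \<in> ball 0 \<beta>} = (\<Union>x\<in>L. ball x \<beta>)"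
    by (rule eq) (simp add: dist_norm norm_minus_commute)
qed

lemma compact_Union_cball:
  fixes K :: "'a::euclidean_space set"
  assumes "compact K"
  shows "compact (\<Union>x\<in>K. cball x r)"
  using compact_sums[OF assms compact_cball[of 0 r]] by (simp only: Minkowski_ball_eq)

text \<open>Continuity of the partial derivatives, instead of continuity of the derivative in the operator norm, is what the
  iterated partial derivatives of a net provide directly.\<close>

definition C1_on :: "'a::euclidean_space set \<Rightarrow> ('a \<Rightarrow> 'b::real_normed_vector) \<Rightarrow> bool" where
  "C1_on U f \<longleftrightarrow> (\<forall>x \<in> U. f differentiable (at x)) \<and>
     (\<forall>b \<in> Basis. continuous_on U (\<lambda>x. frechet_derivative f (at x) b))"

lemma C1_on_has_derivative:
  "C1_on U f \<Longrightarrow> x \<in> U \<Longrightarrow> (f has_derivative frechet_derivative f (at x)) (at x)"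
  by (simp add: C1_on_def frechet_derivative_works[symmetric])

lemma C1_on_continuous: "C1_on U f \<Longrightarrow> continuous_on U f"
  by (rule continuous_at_imp_continuous_on, rule ballI, rule has_derivative_continuous[OF C1_on_has_derivative])

lemma C1_on_derivative_bound:
  fixes f :: "'a::euclidean_space \<Rightarrow> 'b::euclidean_space"
  assumes f: "C1_on U f" and K: "compact K" "K \<subseteq> U"
  shows "\<exists>M\<ge>0. \<forall>z\<in>K. \<forall>h. norm (frechet_derivative f (at z) h) \<le> M * norm h"
proof -
  have "\<exists>M. \<forall>z\<in>K. norm (frechet_derivative f (at z) b) \<le> M" if "b \<in> Basis" for b
  proof -
    have "bounded ((\<lambda>z. frechet_derivative f (at z) b) ` K)"
      using f that K
      by (intro compact_imp_bounded compact_continuous_image) (auto simp: C1_on_def intro: continuous_on_subset)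
    then show ?thesis unfolding bounded_iff by auto
  qed
  then obtain M where M: "\<And>b z. b \<in> Basis \<Longrightarrow> z \<in> K \<Longrightarrow> norm (frechet_derivative f (at z) b) \<le> M b"
    by metis
  have "norm (frechet_derivative f (at z) h) \<le> (\<Sum>b\<in>Basis. \<bar>M b\<bar>) * norm h" if "z \<in> K" for z h
  proof -
    have "linear (frechet_derivative f (at z))"
      using f that K by (intro linear_frechet_derivative) (auto simp: C1_on_def)
    then have "norm (frechet_derivative f (at z) h)
        = norm (\<Sum>b\<in>Basis. (h \<bullet> b) *\<^sub>R frechet_derivative f (at z) b)"
      by (subst linear_sum_Basis) auto
    also have "\<dots> \<le> (\<Sum>b\<in>Basis. \<bar>M b\<bar> * norm h)"
    proof (rule sum_norm_le)
      fix b :: 'a assume b: "b \<in> Basis"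
      have "\<bar>h \<bullet> b\<bar> * norm (frechet_derivative f (at z) b) \<le> norm h * \<bar>M b\<bar>"
        using Basis_le_norm[OF b] M[OF b that] by (intro mult_mono) auto
      then show "norm ((h \<bullet> b) *\<^sub>R frechet_derivative f (at z) b) \<le> \<bar>M b\<bar> * norm h"
        by (simp add: mult.commute)
    qed
    finally show ?thesis by (simp add: sum_distrib_right)
  qed
  then show ?thesis by (intro exI[of _ "\<Sum>b\<in>Basis. \<bar>M b\<bar>"]) (auto intro: sum_nonneg)
qed

text \<open>On a compact neighbourhood of \<open>K\<close> the partial derivatives are uniformly continuous, so the mean value
  inequality gives one \<open>\<delta>\<close> for all points of \<open>K\<close>.\<close>

lemma C1_on_uniform_linearization:
  fixes f :: "'a::euclidean_space \<Rightarrow> 'b::euclidean_space"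
  assumes U: "open U" and f: "C1_on U f" and K: "compact K" "K \<subseteq> U" and "\<eta> > 0"
  shows "\<exists>\<delta>>0. \<forall>z\<in>K. \<forall>z'. dist z z' < \<delta> \<longrightarrow>
    norm (f z' - f z - frechet_derivative f (at z) (z' - z)) \<le> \<eta> * norm (z' - z)"
proof -
  obtain r where r: "r > 0" "(\<Union>x\<in>K. cball x r) \<subseteq> U"
    using compact_subset_open_imp_cball_epsilon_subset[OF K(1) U K(2)] by blast
  define K1 where "K1 = (\<Union>x\<in>K. cball x r)"
  have K1: "compact K1" "K1 \<subseteq> U" using compact_Union_cball[OF K(1)] r by (auto simp: K1_def)
  define n where "n = real DIM('a)"
  have "\<exists>\<delta>>0. \<forall>x\<in>K1. \<forall>x'\<in>K1. dist x' x < \<delta> \<longrightarrow>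
      dist (frechet_derivative f (at x') b) (frechet_derivative f (at x) b) < \<eta> / n" if "b \<in> Basis" for b
  proof -
    have "uniformly_continuous_on K1 (\<lambda>x. frechet_derivative f (at x) b)"
      using f that K1 by (intro compact_uniformly_continuous) (auto simp: C1_on_def intro: continuous_on_subset)
    moreover have "\<eta> / n > 0" using \<open>\<eta> > 0\<close> by (simp add: n_def)
    ultimately show ?thesis unfolding uniformly_continuous_on_def by blast
  qed
  then obtain \<delta> where \<delta>: "\<And>b. b \<in> Basis \<Longrightarrow> \<delta> b > 0"
    "\<And>b x x'. b \<in> Basis \<Longrightarrow> x \<in> K1 \<Longrightarrow> x' \<in> K1 \<Longrightarrow> dist x' x < \<delta> b \<Longrightarrow>
      dist (frechet_derivative f (at x') b) (frechet_derivative f (at x) b) < \<eta> / n"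
    by metis
  define d where "d = min r (Min (\<delta> ` Basis))"
  have d: "d > 0" "d \<le> r" "\<And>b. b \<in> Basis \<Longrightarrow> d \<le> \<delta> b"
    using r \<delta>(1) by (auto simp: d_def min_le_iff_disj)
  have "norm (f z' - f z - frechet_derivative f (at z) (z' - z)) \<le> \<eta> * norm (z' - z)"
    if z: "z \<in> K" and z': "dist z z' < d" for z z'
  proof -
    have ball: "ball z d \<subseteq> K1" using z d by (force simp: K1_def)
    have zU: "z \<in> U" using z K by auto
    have "norm (f z' - f z - frechet_derivative f (at z) (z' - z)) \<le> norm (z' - z) * \<eta>"
    proof (rule differentiable_bound_linearization[where S = "ball z d"])
      show "z + t *\<^sub>R (z' - z) \<in> ball z d" if "t \<in> {0..1}" for t
        using convexD_alt[OF convex_ball[of z d], of z z' t] that z' d by (simp add: algebra_simps)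
      show "(f has_derivative frechet_derivative f (at x)) (at x within ball z d)" if "x \<in> ball z d" for x
        by (rule has_derivative_at_withinI[OF C1_on_has_derivative[OF f]]) (use that ball K1 in blast)
      show "onorm (frechet_derivative f (at x) - frechet_derivative f (at z)) \<le> \<eta>" if x: "x \<in> ball z d" for x
      proof (rule onorm_le)
        fix h
        have xU: "x \<in> U" using x ball K1 by auto
        have lin: "linear (frechet_derivative f (at x))" "linear (frechet_derivative f (at z))"
          using f xU zU by (auto simp: C1_on_def intro: linear_frechet_derivative)
        have "norm ((frechet_derivative f (at x) - frechet_derivative f (at z)) h)
            = norm (\<Sum>b\<in>Basis. (h \<bullet> b) *\<^sub>R (frechet_derivative f (at x) b - frechet_derivative f (at z) b))"
          using linear_sum_Basis[OF lin(1), of h] linear_sum_Basis[OF lin(2), of h]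
          by (simp add: sum_subtractf scaleR_diff_right)
        also have "\<dots> \<le> (\<Sum>b\<in>(Basis::'a set). norm h * (\<eta> / n))"
        proof (rule sum_norm_le)
          fix b :: 'a assume b: "b \<in> Basis"
          have "dist (frechet_derivative f (at x) b) (frechet_derivative f (at z) b) < \<eta> / n"
            using x d(3)[OF b] ball \<open>d > 0\<close> by (intro \<delta>(2)[OF b]) (auto simp: dist_commute)
          then show "norm ((h \<bullet> b) *\<^sub>R (frechet_derivative f (at x) b - frechet_derivative f (at z) b))
              \<le> norm h * (\<eta> / n)"
            using mult_mono[OF Basis_le_norm[OF b, of h] less_imp_le]
            by (simp add: dist_norm del: times_divide_eq_right)
        qed
        also have "\<dots> = \<eta> * norm h" by (simp add: n_def)
        finally show "norm ((frechet_derivative f (at x) - frechet_derivative f (at z)) h) \<le> \<eta> * norm h" .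
      qed
      show "z \<in> ball z d" using d by simp
    qed
    then show ?thesis by (simp add: mult.commute)
  qed
  then show ?thesis using d(1) by blast
qed

text \<open>The form with vanishing initial value and a bound that is uniform in time, so that it can be compared for
  different parameters and different \<open>\<epsilon>\<close>.\<close>

lemma gronwall_zero:
  fixes w :: "real \<Rightarrow> 'a::real_inner"
  assumes T: "convex T" "s \<in> T" "t \<in> T" "\<And>r. r \<in> T \<Longrightarrow> \<bar>r - s\<bar> \<le> \<tau>"
    and k: "k \<ge> 0" and init: "w s = 0"
    and deriv: "\<And>r. r \<in> T \<Longrightarrow> (w has_vector_derivative w' r) (at r within T)"
    and bound: "\<And>r. r \<in> T \<Longrightarrow> norm (w' r) \<le> k * norm (w r) + D"
  shows "norm (w t) \<le> D * sqrt (\<tau> * exp ((2 * k + 1) * \<tau>))"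
proof -
  have D0: "D \<ge> 0" using bound[OF T(2)] init order_trans[OF norm_ge_zero, of "w' s" D] by simp
  have "(norm (w t))\<^sup>2 \<le> ((norm (w s))\<^sup>2 + D\<^sup>2 * \<bar>t - s\<bar>) * exp ((2 * k + 1) * \<bar>t - s\<bar>)"
    by (rule gronwall[OF T(1-3) k deriv bound])
  also have "\<dots> \<le> D\<^sup>2 * (\<tau> * exp ((2 * k + 1) * \<tau>))"
  proof -
    have "\<bar>t - s\<bar> * exp ((2 * k + 1) * \<bar>t - s\<bar>) \<le> \<tau> * exp ((2 * k + 1) * \<tau>)"
      using T(4)[OF T(3)] k by (intro mult_mono) (auto intro: mult_left_mono)
    then show ?thesis using init mult_left_mono[of _ _ "D\<^sup>2"] by (simp add: mult.assoc)
  qed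
  finally have "sqrt ((norm (w t))\<^sup>2) \<le> sqrt (D\<^sup>2 * (\<tau> * exp ((2 * k + 1) * \<tau>)))"
    by (rule real_sqrt_le_mono)
  then show ?thesis using D0 by (simp add: real_sqrt_mult)
qed

text \<open>For two parameters the right-hand sides differ by at most \<open>D\<close> along the curve of \<open>p0\<close>; Gronwall's inequality
  carries this over to the solutions.\<close>

lemma parameter_difference_bound:
  fixes y :: "'p::euclidean_space \<times> real \<Rightarrow> 'e::euclidean_space"
  assumes T: "convex T" "s \<in> T" "t \<in> T" "\<And>r. r \<in> T \<Longrightarrow> \<bar>r - s\<bar> \<le> \<tau>"
    and deriv: "\<And>q r. q \<in> {p, p0} \<Longrightarrow> r \<in> T \<Longrightarrow> ((\<lambda>t. y (q, t)) has_vector_derivative g ((q, r), y (q, r))) (at r)"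
    and init: "y (p, s) = y (p0, s)"
    and range: "\<And>q r. q \<in> {p, p0} \<Longrightarrow> r \<in> T \<Longrightarrow> y (q, r) \<in> X"
    and lip: "\<And>r. r \<in> T \<Longrightarrow> k-lipschitz_on X (\<lambda>x. g ((p, r), x))"
    and D: "\<And>r. r \<in> T \<Longrightarrow> norm (g ((p, r), y (p0, r)) - g ((p0, r), y (p0, r))) \<le> D"
  shows "norm (y (p, t) - y (p0, t)) \<le> D * sqrt (\<tau> * exp ((2 * k + 1) * \<tau>))"
proof (rule gronwall_zero[OF T])
  show "k \<ge> 0" using lip[OF T(2)] by (rule lipschitz_on_nonneg)
  show "((\<lambda>r. y (p, r) - y (p0, r)) has_vector_derivative
      g ((p, r), y (p, r)) - g ((p0, r), y (p0, r))) (at r within T)" if "r \<in> T" for r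
    using that by (intro has_vector_derivative_diff has_vector_derivative_at_within[OF deriv]) auto
  show "norm (g ((p, r), y (p, r)) - g ((p0, r), y (p0, r))) \<le> k * norm (y (p, r) - y (p0, r)) + D"
    if r: "r \<in> T" for r
  proof -
    have "norm (g ((p, r), y (p, r)) - g ((p, r), y (p0, r))) \<le> k * norm (y (p, r) - y (p0, r))"
      using lipschitz_onD[OF lip[OF r] range range] r by (auto simp: dist_norm)
    then show ?thesis using D[OF r]
      norm_triangle_ineq[of "g ((p, r), y (p, r)) - g ((p, r), y (p0, r))"
        "g ((p, r), y (p0, r)) - g ((p0, r), y (p0, r))"] by simp
  qed
  show "y (p, s) - y (p0, s) = 0" using init by simp
qed

lemma inner_interval:
  fixes c d s t :: real
  assumes "s \<in> {c<..<d}" "t \<in> {c<..<d}"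
  obtains c' d' where "c < c'" "d' < d" "s \<in> {c'<..<d'}" "t \<in> {c'<..<d'}"
proof
  show "c < (c + min s t) / 2" "(d + max s t) / 2 < d"
    "s \<in> {(c + min s t) / 2<..<(d + max s t) / 2}" "t \<in> {(c + min s t) / 2<..<(d + max s t) / 2}"
    using assms by (auto simp: min_def max_def)
qed

text \<open>The set \<open>X\<close> contains all values of the solution.  It is a ball for the nonlinear equation and the whole
  space for its linearization.\<close>

lemma ode_continuous_parameter:
  fixes y :: "'p::euclidean_space \<times> real \<Rightarrow> 'e::euclidean_space"
  assumes P: "open P" and s: "s \<in> {c<..<d}"
    and deriv: "\<And>p r. p \<in> P \<Longrightarrow> r \<in> {c<..<d} \<Longrightarrow>
      ((\<lambda>t. y (p, t)) has_vector_derivative g ((p, r), y (p, r))) (at r)"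
    and init: "\<And>p. p \<in> P \<Longrightarrow> y (p, s) = \<xi>"
    and range: "\<And>p r. p \<in> P \<Longrightarrow> r \<in> {c<..<d} \<Longrightarrow> y (p, r) \<in> X"
    and cont: "continuous_on ((P \<times> {c<..<d}) \<times> X) g"
    and lip: "\<And>K. compact K \<Longrightarrow> K \<subseteq> P \<times> {c<..<d} \<Longrightarrow> \<exists>k. \<forall>z\<in>K. k-lipschitz_on X (\<lambda>x. g (z, x))"
  shows "continuous_on (P \<times> {c<..<d}) y"
proof (rule continuous_at_imp_continuous_on, safe)
  fix p0 t0 assume p0: "p0 \<in> P" and t0: "t0 \<in> {c<..<d}"
  obtain c' d' where cd: "c < c'" "d' < d" "s \<in> {c'<..<d'}" "t0 \<in> {c'<..<d'}"
    by (rule inner_interval[OF s t0])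
  let ?T = "{c'..d'}"
  obtain r where r: "r > 0" "cball p0 r \<subseteq> P" using P p0 open_contains_cball by blast
  have sub: "cball p0 r \<times> ?T \<subseteq> P \<times> {c<..<d}" using r cd by auto
  obtain k where k: "\<And>z. z \<in> cball p0 r \<times> ?T \<Longrightarrow> k-lipschitz_on X (\<lambda>x. g (z, x))"
    using lip[OF compact_Times[OF compact_cball compact_Icc] sub] by blast
  have y0: "isCont (\<lambda>t. y (p0, t)) t" if "t \<in> {c<..<d}" for t
    using has_vector_derivative_continuous[OF deriv[OF p0 that]] by simp
  have y0on: "continuous_on {c<..<d} (\<lambda>t. y (p0, t))"
    using y0 by (intro continuous_at_imp_continuous_on) auto
  have "continuous_on (cball p0 r \<times> ?T) (\<lambda>z. g (z, y (p0, snd z)))"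
  proof (rule continuous_on_compose2[OF cont])
    show "continuous_on (cball p0 r \<times> ?T) (\<lambda>z. (z, y (p0, snd z)))"
      using cd by (intro continuous_intros continuous_on_compose2[OF y0on]) auto
    show "(\<lambda>z. (z, y (p0, snd z))) ` (cball p0 r \<times> ?T) \<subseteq> (P \<times> {c<..<d}) \<times> X"
      using sub range[OF p0] by auto
  qed
  then have "uniformly_continuous_on (cball p0 r \<times> ?T) (\<lambda>z. g (z, y (p0, snd z)))"
    by (intro compact_uniformly_continuous compact_Times) auto
  note uc = this[unfolded uniformly_continuous_on_def, rule_format]
  define \<tau> where "\<tau> = d' - c'"
  define E where "E = sqrt (\<tau> * exp ((2 * k + 1) * \<tau>))"
  have E: "E \<ge> 0" using cd by (auto simp: E_def \<tau>_def)
  show "isCont y (p0, t0)"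
    unfolding continuous_at_eps_delta
  proof safe
    fix e :: real assume e: "e > 0"
    have "e / (2 * (E + 1)) > 0" using e E by simp
    from uc[OF this] obtain \<delta> where \<delta>: "\<delta> > 0"
      "\<And>z z'. z \<in> cball p0 r \<times> ?T \<Longrightarrow> z' \<in> cball p0 r \<times> ?T \<Longrightarrow> dist z' z < \<delta> \<Longrightarrow>
        dist (g (z', y (p0, snd z'))) (g (z, y (p0, snd z))) < e / (2 * (E + 1))" by blast
    obtain \<delta>' where \<delta>': "\<delta>' > 0" "\<And>t. dist t t0 < \<delta>' \<Longrightarrow> dist (y (p0, t)) (y (p0, t0)) < e / 2"
      using y0[OF t0] e unfolding continuous_at_eps_delta by (meson half_gt_zero)
    define m where "m = min (min \<delta> r) (min \<delta>' (min (t0 - c') (d' - t0)))"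
    show "\<exists>\<delta>>0. \<forall>z. dist z (p0, t0) < \<delta> \<longrightarrow> dist (y z) (y (p0, t0)) < e"
    proof (intro exI conjI allI impI)
      show "m > 0" using r \<delta> \<delta>' cd by (auto simp: m_def)
      fix z assume z: "dist z (p0, t0) < m"
      obtain p t where zpt: "z = (p, t)" by fastforce
      have dz: "dist p p0 < m" "dist t t0 < m"
        using z dist_fst_le[of z "(p0, t0)"] dist_snd_le[of z "(p0, t0)"] by (auto simp: zpt)
      have pt: "p \<in> cball p0 r" "t \<in> ?T" using dz by (auto simp: m_def dist_commute dist_real_def)
      have "norm (y (p, t) - y (p0, t)) \<le> (e / (2 * (E + 1))) * sqrt (\<tau> * exp ((2 * k + 1) * \<tau>))"
      proof (rule parameter_difference_bound[where T = ?T and s = s and g = g and X = X])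
        show "\<bar>x - s\<bar> \<le> \<tau>" if "x \<in> ?T" for x using that cd by (auto simp: \<tau>_def)
        show "norm (g ((p, x), y (p0, x)) - g ((p0, x), y (p0, x))) \<le> e / (2 * (E + 1))" if "x \<in> ?T" for x
          using \<delta>(2)[of "(p0, x)" "(p, x)"] pt that dz r
          by (auto simp: dist_norm m_def norm_Pair1)
        show "k-lipschitz_on X (\<lambda>xa. g ((p, x), xa))" if "x \<in> ?T" for x using k pt that by auto
      qed (use cd pt p0 r init in \<open>auto intro!: deriv range\<close>)
      also have "\<dots> \<le> e / 2" unfolding E_def[symmetric] using E e by (simp add: field_simps)
      finally show "dist (y z) (y (p0, t0)) < e"
        using \<delta>'(2)[of t] dz dist_triangle[of "y (p, t)" "y (p0, t0)" "y (p0, t)"]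
        by (simp add: zpt dist_norm m_def)
    qed
  qed
qed

text \<open>The candidate for the derivative in direction \<open>q\<close> is the combination \<open>W q\<close> of the solutions \<open>w i\<close> of the linearized equation.
  The error \<open>y (p, t) - y (p0, t) - W (p - p0) t\<close> vanishes at time \<open>s\<close> and solves the linearized
  equation up to the linearization error of \<open>g\<close>, which is \<open>o (\<bar>p - p0\<bar>)\<close> because \<open>y\<close> is
  Lipschitz in the parameter.\<close>

lemma ode_differentiable_parameter:
  fixes y :: "'p::euclidean_space \<times> real \<Rightarrow> 'e::euclidean_space"
  assumes P: "open P" and s: "s \<in> {c<..<d}"
    and deriv: "\<And>p r. p \<in> P \<Longrightarrow> r \<in> {c<..<d} \<Longrightarrow>
      ((\<lambda>t. y (p, t)) has_vector_derivative g ((p, r), y (p, r))) (at r)"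
    and init: "\<And>p. p \<in> P \<Longrightarrow> y (p, s) = \<xi>"
    and range: "\<And>p r. p \<in> P \<Longrightarrow> r \<in> {c<..<d} \<Longrightarrow> y (p, r) \<in> X"
    and X': "open X'" "X \<subseteq> X'" and C1: "C1_on ((P \<times> {c<..<d}) \<times> X') g"
    and lip: "\<And>K. compact K \<Longrightarrow> K \<subseteq> P \<times> {c<..<d} \<Longrightarrow> \<exists>k. \<forall>z\<in>K. k-lipschitz_on X (\<lambda>x. g (z, x))"
    and p0: "p0 \<in> P" and t0: "t0 \<in> {c<..<d}"
    and w0: "\<And>i. i \<in> Basis \<Longrightarrow> w i s = 0"
    and w: "\<And>i r. i \<in> Basis \<Longrightarrow> r \<in> {c<..<d} \<Longrightarrow> (w i has_vector_derivative
      frechet_derivative g (at ((p0, r), y (p0, r))) ((i, 0), w i r)) (at r)"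
  shows "((\<lambda>p. y (p, t0)) has_derivative (\<lambda>q. \<Sum>i\<in>Basis. (q \<bullet> i) *\<^sub>R w i t0)) (at p0)"
proof -
  obtain c' d' where cd: "c < c'" "d' < d" "s \<in> {c'<..<d'}" "t0 \<in> {c'<..<d'}"
    by (rule inner_interval[OF s t0])
  let ?T = "{c'..d'}" and ?\<Omega> = "(P \<times> {c<..<d}) \<times> X'"
  have T: "r \<in> {c<..<d}" if "r \<in> ?T" for r using that cd by auto
  have open\<Omega>: "open ?\<Omega>" using P X' by (intro open_Times) auto
  obtain r where r: "r > 0" "cball p0 r \<subseteq> P" using P p0 open_contains_cball by blast
  obtain k where k: "\<And>z. z \<in> cball p0 r \<times> ?T \<Longrightarrow> k-lipschitz_on X (\<lambda>x. g (z, x))"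
    using lip[OF compact_Times[OF compact_cball compact_Icc], of p0 r c' d'] r T by blast
  define z where "z t = ((p0, t), y (p0, t))" for t
  define G where "G t = frechet_derivative g (at (z t))" for t
  have "continuous_on ?T (\<lambda>t. y (p0, t))"
    using has_vector_derivative_continuous[OF deriv[OF p0 T]] by (intro continuous_at_imp_continuous_on) auto
  then have "compact (z ` ?T)" unfolding z_def
    by (intro compact_continuous_image continuous_intros) auto
  moreover have z\<Omega>: "z t \<in> ?\<Omega>" if "t \<in> ?T" for t
    using p0 T[OF that] range X' by (auto simp: z_def)
  ultimately have zK: "compact (z ` ?T)" "z ` ?T \<subseteq> ?\<Omega>" by blast+
  have linG: "linear (G t)" if "t \<in> ?T" for t
    unfolding G_def using C1 z\<Omega>[OF that] by (intro linear_frechet_derivative) (auto simp: C1_on_def)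
  obtain M where M: "M \<ge> 0" "\<And>t h. t \<in> ?T \<Longrightarrow> norm (G t h) \<le> M * norm h"
    using C1_on_derivative_bound[OF C1 zK] by (auto simp: G_def)
  have lin: "\<exists>\<delta>>0. \<forall>t\<in>?T. \<forall>z'. dist (z t) z' < \<delta> \<longrightarrow>
      norm (g z' - g (z t) - G t (z' - z t)) \<le> \<eta> * norm (z' - z t)" if "\<eta> > 0" for \<eta>
    using C1_on_uniform_linearization[OF open\<Omega> C1 zK that] by (auto simp: G_def)
  define W where "W q t = (\<Sum>i\<in>Basis. (q \<bullet> i) *\<^sub>R w i t)" for q t
  have W: "(W q has_vector_derivative G t ((q, 0), W q t)) (at t)" if t: "t \<in> ?T" for q t
  proof -
    have "((q, 0), W q t) = (\<Sum>i\<in>Basis. (q \<bullet> i) *\<^sub>R ((i, 0), w i t))"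
      by (simp add: W_def prod_eq_iff fst_sum snd_sum euclidean_representation)
    then have "G t ((q, 0), W q t) = G t (\<Sum>i\<in>Basis. (q \<bullet> i) *\<^sub>R ((i, 0), w i t))"
      by (rule arg_cong)
    also have "\<dots> = (\<Sum>i\<in>Basis. G t ((q \<bullet> i) *\<^sub>R ((i, 0), w i t)))"
      by (rule linear_sum[OF linG[OF t]])
    also have "\<dots> = (\<Sum>i\<in>Basis. (q \<bullet> i) *\<^sub>R G t ((i, 0), w i t))"
      by (simp only: linear_cmul[OF linG[OF t]])
    finally have G: "G t ((q, 0), W q t) = (\<Sum>i\<in>Basis. (q \<bullet> i) *\<^sub>R G t ((i, 0), w i t))" .
    have wi: "(w i has_derivative (\<lambda>x. x *\<^sub>R G t ((i, 0), w i t))) (at t)" if "i \<in> Basis" for i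
      using w[OF that T[OF t]] by (simp only: has_vector_derivative_def G_def z_def)
    have "(W q has_derivative (\<lambda>x. \<Sum>i\<in>Basis. (q \<bullet> i) *\<^sub>R (x *\<^sub>R G t ((i, 0), w i t)))) (at t)"
      unfolding W_def[abs_def] by (rule has_derivative_sum, rule has_derivative_scaleR_right, rule wi)
    moreover have "(\<lambda>x. \<Sum>i\<in>Basis. (q \<bullet> i) *\<^sub>R (x *\<^sub>R G t ((i, 0), w i t))) = (\<lambda>x. x *\<^sub>R G t ((q, 0), W q t))"
      unfolding G scaleR_sum_right by (simp add: mult.commute)
    ultimately show ?thesis by (simp only: has_vector_derivative_def)
  qed
  define \<tau> where "\<tau> = d' - c'"
  have \<tau>: "\<tau> > 0" "\<And>t. t \<in> ?T \<Longrightarrow> \<bar>t - s\<bar> \<le> \<tau>" using cd by (auto simp: \<tau>_def)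
  define C where "C = (1 + M) * sqrt (\<tau> * exp ((2 * k + 1) * \<tau>))"
  define E where "E = sqrt (\<tau> * exp ((2 * M + 1) * \<tau>))"
  have CE: "C \<ge> 0" "E \<ge> 0" using M \<tau> by (auto simp: C_def E_def)
  obtain \<delta>1 where \<delta>1: "\<delta>1 > 0" "\<And>t z'. t \<in> ?T \<Longrightarrow> dist (z t) z' < \<delta>1 \<Longrightarrow>
      norm (g z' - g (z t) - G t (z' - z t)) \<le> 1 * norm (z' - z t)"
    using lin[of 1] by auto
  have dy: "norm (y (p, t) - y (p0, t)) \<le> C * norm (p - p0)"
    if p: "norm (p - p0) < \<delta>1" "norm (p - p0) \<le> r" and t: "t \<in> ?T" for p t
  proof -
    have pc: "p \<in> cball p0 r" using p by (simp add: dist_norm norm_minus_commute)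
    have "norm (y (p, t) - y (p0, t)) \<le> ((1 + M) * norm (p - p0)) * sqrt (\<tau> * exp ((2 * k + 1) * \<tau>))"
    proof (rule parameter_difference_bound[where T = ?T and s = s and g = g and X = X])
      show "k-lipschitz_on X (\<lambda>xa. g ((p, x), xa))" if "x \<in> ?T" for x using k pc that by auto
      show "norm (g ((p, x), y (p0, x)) - g ((p0, x), y (p0, x))) \<le> (1 + M) * norm (p - p0)"
        if x: "x \<in> ?T" for x
      proof -
        have n: "((p, x), y (p0, x)) - z x = ((p - p0, 0), 0)" "norm ((p - p0, 0::real), 0::'e) = norm (p - p0)"
          by (auto simp: z_def norm_Pair)
        have "norm (g ((p, x), y (p0, x)) - g (z x) - G x ((p - p0, 0), 0)) \<le> 1 * norm (p - p0)"
          using \<delta>1(2)[OF x, of "((p, x), y (p0, x))"] p n by (simp add: dist_norm norm_minus_commute[of "z x"])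
        moreover have "norm (G x ((p - p0, 0), 0)) \<le> M * norm (p - p0)"
          using M(2)[OF x, of "((p - p0, 0), 0)"] n by simp
        ultimately show ?thesis
          using norm_triangle_ineq[of "g ((p, x), y (p0, x)) - g (z x) - G x ((p - p0, 0), 0)" "G x ((p - p0, 0), 0)"]
          by (simp add: z_def distrib_right)
      qed
    qed (use cd pc p0 r init t T \<tau> in \<open>auto intro!: deriv range\<close>)
    then show ?thesis by (simp add: C_def mult_ac)
  qed
  show ?thesis
    unfolding has_derivative_at_alt
  proof (intro conjI allI impI)
    show "bounded_linear (\<lambda>q. \<Sum>i\<in>Basis. (q \<bullet> i) *\<^sub>R w i t0)"
      by (intro bounded_linear_sum bounded_linear_compose[OF bounded_linear_scaleR_left]
          bounded_linear_inner_left)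
    fix e :: real assume e: "e > 0"
    (* Gronwall multiplies the linearization error \<eta> (1 + C) |p - p0| by E; the summand 1 avoids a division by 0. *)
    define \<eta> where "\<eta> = e / ((1 + C) * E + 1)"
    have pos: "(1 + C) * E + 1 > 0" using CE by (intro add_nonneg_pos) auto
    then have \<eta>: "\<eta> > 0" using e by (simp add: \<eta>_def)
    have \<eta>E: "\<eta> * (1 + C) * E \<le> e"
    proof -
      have "\<eta> * ((1 + C) * E + 1) = e" using pos by (simp add: \<eta>_def)
      then show ?thesis using \<eta> by (simp add: algebra_simps)
    qed
    obtain \<delta>2 where \<delta>2: "\<delta>2 > 0" "\<And>t z'. t \<in> ?T \<Longrightarrow> dist (z t) z' < \<delta>2 \<Longrightarrow>
        norm (g z' - g (z t) - G t (z' - z t)) \<le> \<eta> * norm (z' - z t)"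
      using lin[OF \<eta>] by auto
    show "\<exists>\<delta>>0. \<forall>p. norm (p - p0) < \<delta> \<longrightarrow>
        norm (y (p, t0) - y (p0, t0) - (\<Sum>i\<in>Basis. ((p - p0) \<bullet> i) *\<^sub>R w i t0)) \<le> e * norm (p - p0)"
    proof (intro exI conjI allI impI)
      show "min (min \<delta>1 r) (\<delta>2 / (1 + C)) > 0" using \<delta>1 \<delta>2 r CE by auto
      fix p assume p: "norm (p - p0) < min (min \<delta>1 r) (\<delta>2 / (1 + C))"
      let ?n = "norm (p - p0)"
      have n2: "(1 + C) * ?n < \<delta>2" using p CE by (simp add: field_simps)
      have pP: "p \<in> P" using p r by (auto simp: dist_norm norm_minus_commute)
      have "norm (y (p, t0) - y (p0, t0) - W (p - p0) t0) \<le> (\<eta> * ((1 + C) * ?n)) * sqrt (\<tau> * exp ((2 * M + 1) * \<tau>))"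
      proof (rule gronwall_zero[where T = ?T and s = s and
            w' = "\<lambda>t. g ((p, t), y (p, t)) - g (z t) - G t ((p - p0, 0), W (p - p0) t)"])
        show "y (p, s) - y (p0, s) - W (p - p0) s = 0" using init pP p0 w0 by (simp add: W_def)
        fix t assume t: "t \<in> ?T"
        show "((\<lambda>a. y (p, a) - y (p0, a) - W (p - p0) a) has_vector_derivative
            g ((p, t), y (p, t)) - g (z t) - G t ((p - p0, 0), W (p - p0) t)) (at t within ?T)"
          using deriv[OF pP T[OF t]] deriv[OF p0 T[OF t]] W[OF t] unfolding z_def
          by (intro has_vector_derivative_at_within[OF has_vector_derivative_diff] has_vector_derivative_diff) auto
        let ?e = "y (p, t) - y (p0, t) - W (p - p0) t"
        let ?z = "((p, t), y (p, t))"
        have zz: "?z - z t = ((p - p0, 0), y (p, t) - y (p0, t))" by (simp add: z_def)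
        have "norm (?z - z t) \<le> norm (p - p0, 0::real) + norm (y (p, t) - y (p0, t))"
          unfolding zz by (rule norm_Pair_le)
        also have "\<dots> \<le> (1 + C) * ?n" using dy[OF _ _ t, of p] p by (simp add: norm_Pair distrib_right)
        finally have nz: "norm (?z - z t) \<le> (1 + C) * ?n" .
        then have "norm (g ?z - g (z t) - G t (?z - z t)) \<le> \<eta> * norm (?z - z t)"
          using n2 by (intro \<delta>2(2)[OF t]) (simp add: dist_norm norm_minus_commute)
        also have "\<dots> \<le> \<eta> * ((1 + C) * ?n)" using nz \<eta> by (intro mult_left_mono) auto
        finally have A: "norm (g ?z - g (z t) - G t (?z - z t)) \<le> \<eta> * ((1 + C) * ?n)" .
        have "?z - z t - ((p - p0, 0), W (p - p0) t) = ((0, 0), ?e)" unfolding zz by (simp add: zero_prod_def)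
        then have "G t (?z - z t) - G t ((p - p0, 0), W (p - p0) t) = G t ((0, 0), ?e)"
          using linear_diff[OF linG[OF t]] by metis
        moreover have "u - x = (u - v) + x'" if "v - x = x'" for u v x x' :: 'e
          using that by auto
        ultimately have eq: "g ?z - g (z t) - G t ((p - p0, 0), W (p - p0) t)
            = (g ?z - g (z t) - G t (?z - z t)) + G t ((0, 0), ?e)"
          by blast
        have "norm (G t ((0, 0), ?e)) \<le> M * norm ?e"
          using M(2)[OF t, of "((0, 0), ?e)"] by (simp add: norm_Pair)
        from norm_triangle_mono[OF A this]
        show "norm (g ?z - g (z t) - G t ((p - p0, 0), W (p - p0) t))
            \<le> M * norm ?e + \<eta> * ((1 + C) * ?n)"
          unfolding eq by simp
      qed (use cd \<tau> M in auto)
      also have "\<dots> = (\<eta> * (1 + C) * E) * ?n" by (simp add: E_def mult_ac)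
      also have "\<dots> \<le> e * ?n" using \<eta>E by (intro mult_right_mono) auto
      finally show "norm (y (p, t0) - y (p0, t0) - (\<Sum>i\<in>Basis. ((p - p0) \<bullet> i) *\<^sub>R w i t0)) \<le> e * ?n"
        by (simp add: W_def)
    qed
  qed
qed

text \<open>The equation itself shows that the partial derivative in time is jointly continuous; together with the
  existence of the derivative in the parameter this suffices for joint differentiability.\<close>

lemma ode_joint_derivative:
  fixes y :: "'p::euclidean_space \<times> real \<Rightarrow> 'e::euclidean_space"
  assumes P: "open P" and J: "open J" and p: "p \<in> P" and t: "t \<in> J"
    and dp: "((\<lambda>p. y (p, t)) has_derivative D) (at p)"
    and dt: "\<And>p t. p \<in> P \<Longrightarrow> t \<in> J \<Longrightarrow> ((\<lambda>t. y (p, t)) has_vector_derivative h (p, t)) (at t)"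
    and cont: "continuous_on (P \<times> J) h"
  shows "(y has_derivative (\<lambda>(q, r). D q + r *\<^sub>R h (p, t))) (at (p, t))"
proof -
  obtain e where e: "e > 0" "ball t e \<subseteq> J" using J t open_contains_ball by blast
  let ?Y = "ball t e"
  have "((\<lambda>(p, t). y (p, t)) has_derivative (\<lambda>(q, r). D q + blinfun_apply (blinfun_scaleR_left (h (p, t))) r))
      (at (p, t) within P \<times> ?Y)"
  proof (rule has_derivative_partialsI[where f = "\<lambda>p t. y (p, t)" and fy = "\<lambda>p t. blinfun_scaleR_left (h (p, t))"])
    show "((\<lambda>p. y (p, t)) has_derivative D) (at p within P)" using dp by (rule has_derivative_at_withinI)
    show "((\<lambda>t. y (p', t)) has_derivative blinfun_apply (blinfun_scaleR_left (h (p', t')))) (at t' within ?Y)"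
      if "p' \<in> P" "t' \<in> ?Y" for p' t'
    proof -
      have "t' \<in> J" using that e by auto
      from dt[OF that(1) this] show ?thesis
        unfolding has_vector_derivative_def blinfun_scaleR_left.rep_eq by (rule has_derivative_at_withinI)
    qed
    have "continuous (at (p, t) within P \<times> ?Y) h"
      by (rule continuous_within_subset[of _ "P \<times> J"]) (use cont p t e continuous_on_eq_continuous_within in blast)+
    then have "continuous (at (p, t) within P \<times> ?Y) (\<lambda>z. blinfun_scaleR_left (h z))"
      by (rule bounded_linear.continuous[OF bounded_linear_blinfun_scaleR_left])
    then show "continuous (at (p, t) within P \<times> ?Y) (\<lambda>(x, y). blinfun_scaleR_left (h (x, y)))"
      by (simp add: split_def)
  qed (use e in auto)
  moreover have "at (p, t) within P \<times> ?Y = at (p, t)"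
    using P p e by (intro at_within_open open_Times) auto
  ultimately show ?thesis by (simp add: blinfun_scaleR_left.rep_eq)
qed

section \<open>A calculus of moderate nets\<close>

lemma eventually_at_right_0_Ioc: "e > 0 \<Longrightarrow> \<forall>\<^sub>F \<epsilon>::real in at_right 0. \<epsilon> \<in> {0<..e}"
  using eventually_at_right_real[of 0 e] by (auto elim: eventually_mono)

lemmas eventually_at_right_0_Ioc1 = eventually_at_right_0_Ioc[OF zero_less_one]

text \<open>The constant of \<open>O(\<epsilon> ^ -N)\<close> is absorbed by raising \<open>N\<close>, see \<open>moderate_on_iff\<close>.\<close>

definition moderate_on :: "'a set \<Rightarrow> (real \<Rightarrow> 'a \<Rightarrow> 'b::real_normed_vector) \<Rightarrow> bool" where
  "moderate_on K f \<longleftrightarrow> (\<exists>N::nat. \<forall>\<^sub>F \<epsilon> in at_right 0. \<forall>x\<in>K. norm (f \<epsilon> x) \<le> (1 / \<epsilon>) ^ N)"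

definition negligible_on :: "'a set \<Rightarrow> (real \<Rightarrow> 'a \<Rightarrow> 'b::real_normed_vector) \<Rightarrow> bool" where
  "negligible_on K f \<longleftrightarrow> (\<forall>m::nat. \<forall>\<^sub>F \<epsilon> in at_right 0. \<forall>x\<in>K. norm (f \<epsilon> x) \<le> \<epsilon> ^ m)"

lemma moderate_onI:
  assumes "\<forall>\<^sub>F \<epsilon> in at_right 0. \<forall>x\<in>K. norm (f \<epsilon> x) \<le> C * (1 / \<epsilon>) ^ N"
  shows "moderate_on K f"
  unfolding moderate_on_def
proof (intro exI)
  have "1 / (\<bar>C\<bar> + 1) > 0" by simp
  from assms eventually_at_right_0_Ioc[OF this]
  show "\<forall>\<^sub>F \<epsilon> in at_right 0. \<forall>x\<in>K. norm (f \<epsilon> x) \<le> (1 / \<epsilon>) ^ Suc N"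
  proof eventually_elim
    case (elim \<epsilon>)
    have "\<bar>C\<bar> + 1 \<le> 1 / \<epsilon>" using elim(2) by (simp add: field_simps)
    then have "C * (1 / \<epsilon>) ^ N \<le> (1 / \<epsilon>) * (1 / \<epsilon>) ^ N"
      using elim(2) by (intro mult_right_mono) auto
    then show ?case using elim(1) by fastforce
  qed
qed

lemma moderate_on_iff: "(\<exists>N::nat. sup_bigo K f (\<lambda>\<epsilon>. 1 / \<epsilon> ^ N)) \<longleftrightarrow> moderate_on K f"
proof
  assume "\<exists>N::nat. sup_bigo K f (\<lambda>\<epsilon>. 1 / \<epsilon> ^ N)"
  then obtain N C where "\<forall>\<^sub>F \<epsilon> in at_right 0. \<forall>x\<in>K. norm (f \<epsilon> x) \<le> C * \<bar>1 / \<epsilon> ^ N\<bar>"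
    unfolding sup_bigo_def by blast
  with eventually_at_right_0_Ioc1
  have "\<forall>\<^sub>F \<epsilon> in at_right 0. \<forall>x\<in>K. norm (f \<epsilon> x) \<le> C * (1 / \<epsilon>) ^ N"
    by eventually_elim (auto simp: power_one_over)
  then show "moderate_on K f" by (rule moderate_onI)
next
  assume "moderate_on K f"
  then obtain N where "\<forall>\<^sub>F \<epsilon> in at_right 0. \<forall>x\<in>K. norm (f \<epsilon> x) \<le> (1 / \<epsilon>) ^ N"
    unfolding moderate_on_def by blast
  with eventually_at_right_0_Ioc1
  have "\<forall>\<^sub>F \<epsilon> in at_right 0. \<forall>x\<in>K. norm (f \<epsilon> x) \<le> 1 * \<bar>1 / \<epsilon> ^ N\<bar>"
    by eventually_elim (auto simp: power_one_over)
  then show "\<exists>N::nat. sup_bigo K f (\<lambda>\<epsilon>. 1 / \<epsilon> ^ N)" unfolding sup_bigo_def by blast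
qed

lemma negligible_onI:
  assumes "\<And>m::nat. \<exists>C. \<forall>\<^sub>F \<epsilon> in at_right 0. \<forall>x\<in>K. norm (f \<epsilon> x) \<le> C * \<epsilon> ^ m"
  shows "negligible_on K f"
  unfolding negligible_on_def
proof
  fix m
  obtain C where C: "\<forall>\<^sub>F \<epsilon> in at_right 0. \<forall>x\<in>K. norm (f \<epsilon> x) \<le> C * \<epsilon> ^ Suc m"
    using assms[of "Suc m"] by blast
  have "1 / (\<bar>C\<bar> + 1) > 0" by simp
  from C eventually_at_right_0_Ioc[OF this]
  show "\<forall>\<^sub>F \<epsilon> in at_right 0. \<forall>x\<in>K. norm (f \<epsilon> x) \<le> \<epsilon> ^ m"
  proof eventually_elim
    case (elim \<epsilon>)
    have "C * \<epsilon> \<le> (\<bar>C\<bar> + 1) * \<epsilon>" using elim(2) by (intro mult_right_mono) auto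
    also have "\<dots> \<le> 1" using elim(2) by (simp add: field_simps)
    finally have "C * \<epsilon> * \<epsilon> ^ m \<le> 1 * \<epsilon> ^ m"
      using elim(2) by (intro mult_right_mono) auto
    then show ?case using elim(1) by (fastforce simp: mult.assoc)
  qed
qed

lemma negligible_on_iff: "(\<forall>m::nat. sup_bigo K f (\<lambda>\<epsilon>. \<epsilon> ^ m)) \<longleftrightarrow> negligible_on K f"
proof
  assume *: "\<forall>m::nat. sup_bigo K f (\<lambda>\<epsilon>. \<epsilon> ^ m)"
  show "negligible_on K f"
  proof (rule negligible_onI)
    fix m
    obtain C where "\<forall>\<^sub>F \<epsilon> in at_right 0. \<forall>x\<in>K. norm (f \<epsilon> x) \<le> C * \<bar>\<epsilon> ^ m\<bar>"
      using * unfolding sup_bigo_def by blast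
    with eventually_at_right_0_Ioc1
    have "\<forall>\<^sub>F \<epsilon> in at_right 0. \<forall>x\<in>K. norm (f \<epsilon> x) \<le> C * \<epsilon> ^ m"
      by eventually_elim auto
    then show "\<exists>C. \<forall>\<^sub>F \<epsilon> in at_right 0. \<forall>x\<in>K. norm (f \<epsilon> x) \<le> C * \<epsilon> ^ m" by blast
  qed
next
  assume *: "negligible_on K f"
  show "\<forall>m::nat. sup_bigo K f (\<lambda>\<epsilon>. \<epsilon> ^ m)"
  proof
    fix m
    have "\<forall>\<^sub>F \<epsilon> in at_right 0. \<forall>x\<in>K. norm (f \<epsilon> x) \<le> \<epsilon> ^ m"
      using * unfolding negligible_on_def by blast
    with eventually_at_right_0_Ioc1
    have "\<forall>\<^sub>F \<epsilon> in at_right 0. \<forall>x\<in>K. norm (f \<epsilon> x) \<le> 1 * \<bar>\<epsilon> ^ m\<bar>"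
      by eventually_elim auto
    then show "sup_bigo K f (\<lambda>\<epsilon>. \<epsilon> ^ m)" unfolding sup_bigo_def by blast
  qed
qed

lemma moderate_on_dominated:
  assumes "moderate_on K f" "\<forall>\<^sub>F \<epsilon> in at_right 0. \<forall>x\<in>K. norm (g \<epsilon> x) \<le> norm (f \<epsilon> x)"
  shows "moderate_on K g"
proof -
  obtain N where "\<forall>\<^sub>F \<epsilon> in at_right 0. \<forall>x\<in>K. norm (f \<epsilon> x) \<le> (1 / \<epsilon>) ^ N"
    using assms(1) unfolding moderate_on_def by blast
  with assms(2) have "\<forall>\<^sub>F \<epsilon> in at_right 0. \<forall>x\<in>K. norm (g \<epsilon> x) \<le> (1 / \<epsilon>) ^ N"
    by eventually_elim force
  then show ?thesis unfolding moderate_on_def by blast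
qed

lemma moderate_on_bounded:
  assumes "\<forall>\<^sub>F \<epsilon> in at_right 0. \<forall>x\<in>K. norm (f \<epsilon> x) \<le> C"
  shows "moderate_on K f"
  using assms by (intro moderate_onI[where N = 0 and C = C]) simp

lemma moderate_on_product_bound:
  assumes f: "moderate_on K f" and g: "moderate_on K g"
    and h: "\<forall>\<^sub>F \<epsilon> in at_right 0. \<forall>x\<in>K. norm (h \<epsilon> x) \<le> norm (f \<epsilon> x) * norm (g \<epsilon> x) * B"
  shows "moderate_on K h"
proof -
  obtain N where N: "\<forall>\<^sub>F \<epsilon> in at_right 0. \<forall>x\<in>K. norm (f \<epsilon> x) \<le> (1 / \<epsilon>) ^ N"
    using f unfolding moderate_on_def by blast
  obtain M where M: "\<forall>\<^sub>F \<epsilon> in at_right 0. \<forall>x\<in>K. norm (g \<epsilon> x) \<le> (1 / \<epsilon>) ^ M"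
    using g unfolding moderate_on_def by blast
  from N M h eventually_at_right_0_Ioc1
  have "\<forall>\<^sub>F \<epsilon> in at_right 0. \<forall>x\<in>K. norm (h \<epsilon> x) \<le> \<bar>B\<bar> * (1 / \<epsilon>) ^ (N + M)"
  proof eventually_elim
    case (elim \<epsilon>)
    show ?case
    proof
      fix x assume x: "x \<in> K"
      have "norm (h \<epsilon> x) \<le> norm (f \<epsilon> x) * norm (g \<epsilon> x) * B" using elim x by blast
      also have "\<dots> \<le> norm (f \<epsilon> x) * norm (g \<epsilon> x) * \<bar>B\<bar>" by (intro mult_left_mono) auto
      also have "\<dots> \<le> ((1 / \<epsilon>) ^ N * (1 / \<epsilon>) ^ M) * \<bar>B\<bar>"
        using elim x by (intro mult_right_mono mult_mono) (auto intro!: zero_le_power)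
      finally show "norm (h \<epsilon> x) \<le> \<bar>B\<bar> * (1 / \<epsilon>) ^ (N + M)" by (simp add: power_add mult_ac)
    qed
  qed
  then show ?thesis by (rule moderate_onI)
qed

lemma moderate_on_add:
  assumes f: "moderate_on K f" and g: "moderate_on K g"
  shows "moderate_on K (\<lambda>\<epsilon> x. f \<epsilon> x + g \<epsilon> x)"
proof -
  obtain N where N: "\<forall>\<^sub>F \<epsilon> in at_right 0. \<forall>x\<in>K. norm (f \<epsilon> x) \<le> (1 / \<epsilon>) ^ N"
    using f unfolding moderate_on_def by blast
  obtain M where M: "\<forall>\<^sub>F \<epsilon> in at_right 0. \<forall>x\<in>K. norm (g \<epsilon> x) \<le> (1 / \<epsilon>) ^ M"
    using g unfolding moderate_on_def by blast
  from N M eventually_at_right_0_Ioc1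
  have "\<forall>\<^sub>F \<epsilon> in at_right 0. \<forall>x\<in>K. norm (f \<epsilon> x + g \<epsilon> x) \<le> 2 * (1 / \<epsilon>) ^ (N + M)"
  proof eventually_elim
    case (elim \<epsilon>)
    show ?case
    proof
      fix x assume x: "x \<in> K"
      have "(1 / \<epsilon>) ^ N \<le> (1 / \<epsilon>) ^ (N + M)" "(1 / \<epsilon>) ^ M \<le> (1 / \<epsilon>) ^ (N + M)"
        using elim by (auto intro!: power_increasing)
      moreover have "norm (f \<epsilon> x) \<le> (1 / \<epsilon>) ^ N" "norm (g \<epsilon> x) \<le> (1 / \<epsilon>) ^ M" using elim x by auto
      ultimately show "norm (f \<epsilon> x + g \<epsilon> x) \<le> 2 * (1 / \<epsilon>) ^ (N + M)"
        using norm_triangle_ineq[of "f \<epsilon> x" "g \<epsilon> x"] by linarith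
    qed
  qed
  then show ?thesis by (rule moderate_onI)
qed

lemma cpt_insideD: "K \<subset>\<subset> U \<Longrightarrow> compact K" "K \<subset>\<subset> U \<Longrightarrow> K \<subseteq> U"
  using interior_subset by (auto simp: cpt_inside_def)

lemma cpt_insideI: "compact K \<Longrightarrow> K \<subseteq> U \<Longrightarrow> open U \<Longrightarrow> K \<subset>\<subset> U"
  by (simp add: cpt_inside_def interior_open)

text \<open>Bounds for the values of a net only, in contrast to \<open>moderate_nets\<close> and \<open>negligible_nets\<close>, which bound all derivatives.\<close>

definition locally_moderate :: "'a::euclidean_space set \<Rightarrow> ('a, 'b::real_normed_vector) net \<Rightarrow> bool" where
  "locally_moderate U f \<longleftrightarrow> (\<forall>K. K \<subset>\<subset> U \<longrightarrow> moderate_on K f)"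

definition locally_negligible :: "'a::euclidean_space set \<Rightarrow> ('a, 'b::real_normed_vector) net \<Rightarrow> bool" where
  "locally_negligible U f \<longleftrightarrow> (\<forall>K. K \<subset>\<subset> U \<longrightarrow> negligible_on K f)"

text \<open>Nets whose derivatives up to order \<open>k\<close> exist for \<open>\<epsilon> \<le> e\<close> and are moderate.  Differentiating the net first and
  recursing afterwards, the reverse of the order in \<open>iter_pderiv\<close>, makes the rules of differentiation directly usable in
  inductions on \<open>k\<close>.  The bound \<open>e\<close> is there because compositions and solutions exist for small \<open>\<epsilon>\<close> only.  A
  net that does not depend on \<open>\<epsilon>\<close> is \<open>moderate_upto k\<close> iff it is \<open>k\<close> times
  continuously differentiable, so the same calculus serves for plain smoothness.\<close>

primrec moderate_upto ::
  "nat \<Rightarrow> real \<Rightarrow> 'a::euclidean_space set \<Rightarrow> ('a, 'b::euclidean_space) net \<Rightarrow> bool" where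
  "moderate_upto 0 e U f \<longleftrightarrow> (\<forall>\<epsilon>\<in>{0<..e}. continuous_on U (f \<epsilon>)) \<and> locally_moderate U f"
| "moderate_upto (Suc k) e U f \<longleftrightarrow>
     (\<forall>\<epsilon>\<in>{0<..e}. \<forall>x\<in>U. f \<epsilon> differentiable (at x)) \<and> locally_moderate U f \<and>
     (\<forall>b\<in>Basis. moderate_upto k e U (\<lambda>\<epsilon> x. frechet_derivative (f \<epsilon>) (at x) b))"

lemma moderate_upto_moderate: "moderate_upto k e U f \<Longrightarrow> locally_moderate U f"
  by (cases k) auto

lemma moderate_upto_continuous:
  "moderate_upto k e U f \<Longrightarrow> \<epsilon> \<in> {0<..e} \<Longrightarrow> continuous_on U (f \<epsilon>)"
  by (cases k) (auto intro!: continuous_at_imp_continuous_on differentiable_imp_continuous_within)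

lemma moderate_upto_SucD: "moderate_upto (Suc k) e U f \<Longrightarrow> moderate_upto k e U f"
proof (induction k arbitrary: f)
  case 0
  then show ?case using moderate_upto_continuous[OF 0] by simp
next
  case (Suc k)
  note f = iffD1[OF moderate_upto.simps(2) Suc.prems]
  have "moderate_upto k e U (\<lambda>\<epsilon> x. frechet_derivative (f \<epsilon>) (at x) b)" if "b \<in> Basis" for b
    using f that by (intro Suc.IH) blast
  then show ?case using f by simp
qed

lemma moderate_upto_e_mono: "moderate_upto k e U f \<Longrightarrow> e' \<le> e \<Longrightarrow> moderate_upto k e' U f"
  by (induction k arbitrary: f) auto

lemma locally_moderate_subset: "locally_moderate U f \<Longrightarrow> open V \<Longrightarrow> V \<subseteq> U \<Longrightarrow> locally_moderate V f"
  unfolding locally_moderate_def cpt_inside_def by (metis interior_mono order_trans)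

lemma moderate_upto_subset:
  "moderate_upto k e U f \<Longrightarrow> open V \<Longrightarrow> V \<subseteq> U \<Longrightarrow> moderate_upto k e V f"
  by (induction k arbitrary: f) (auto intro: continuous_on_subset locally_moderate_subset)

lemma locally_moderate_cong:
  assumes "locally_moderate U f" "e > 0" "\<And>\<epsilon> x. \<epsilon> \<in> {0<..e} \<Longrightarrow> x \<in> U \<Longrightarrow> f \<epsilon> x = g \<epsilon> x"
  shows "locally_moderate U g"
  unfolding locally_moderate_def
proof (intro allI impI)
  fix K assume K: "K \<subset>\<subset> U"
  show "moderate_on K g"
  proof (rule moderate_on_dominated)
    show "moderate_on K f" using assms(1) K by (simp add: locally_moderate_def)
    show "\<forall>\<^sub>F \<epsilon> in at_right 0. \<forall>x\<in>K. norm (g \<epsilon> x) \<le> norm (f \<epsilon> x)"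
      using eventually_at_right_0_Ioc[OF assms(2)]
      by eventually_elim (use assms(3) cpt_insideD(2)[OF K] in auto)
  qed
qed

lemma moderate_upto_cong:
  assumes "open U" "e > 0" "moderate_upto k e U f"
    and "\<And>\<epsilon> x. \<epsilon> \<in> {0<..e} \<Longrightarrow> x \<in> U \<Longrightarrow> f \<epsilon> x = g \<epsilon> x"
  shows "moderate_upto k e U g"
  using assms(3,4)
proof (induction k arbitrary: f g)
  case 0
  then show ?case using locally_moderate_cong[OF _ assms(2), of U f g]
    by (auto cong: continuous_on_cong)
next
  case (Suc k)
  have d: "(g \<epsilon> has_derivative frechet_derivative (f \<epsilon>) (at x)) (at x)" if "\<epsilon> \<in> {0<..e}" "x \<in> U" for \<epsilon> x
  proof (rule has_derivative_transform_within_open[OF _ assms(1) \<open>x \<in> U\<close>])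
    show "(f \<epsilon> has_derivative frechet_derivative (f \<epsilon>) (at x)) (at x)"
      using Suc.prems(1) that by (simp add: frechet_derivative_works[symmetric])
  qed (use Suc.prems(2) that in auto)
  have "frechet_derivative (f \<epsilon>) (at x) = frechet_derivative (g \<epsilon>) (at x)" if "\<epsilon> \<in> {0<..e}" "x \<in> U" for \<epsilon> x
    using frechet_derivative_at[OF d[OF that]] .
  note * = this
  have "moderate_upto k e U (\<lambda>\<epsilon> x. frechet_derivative (g \<epsilon>) (at x) b)" if "b \<in> Basis" for b
  proof (rule Suc.IH)
    show "moderate_upto k e U (\<lambda>\<epsilon> x. frechet_derivative (f \<epsilon>) (at x) b)"
      using Suc.prems(1) that by simp
  qed (simp add: *)
  moreover have "locally_moderate U g"
    by (rule locally_moderate_cong[OF moderate_upto_moderate[OF Suc.prems(1)] assms(2) Suc.prems(2)])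
  moreover have "g \<epsilon> differentiable (at x)" if "\<epsilon> \<in> {0<..e}" "x \<in> U" for \<epsilon> x
    using d[OF that] by (rule differentiableI)
  ultimately show ?case by simp
qed

lemma moderate_upto_SucI:
  assumes "open U" "e > 0" "locally_moderate U f"
    and D: "\<And>\<epsilon> x. \<epsilon> \<in> {0<..e} \<Longrightarrow> x \<in> U \<Longrightarrow> (f \<epsilon> has_derivative D \<epsilon> x) (at x)"
    and k: "\<And>b. b \<in> Basis \<Longrightarrow> moderate_upto k e U (\<lambda>\<epsilon> x. D \<epsilon> x b)"
  shows "moderate_upto (Suc k) e U f"
proof -
  have "moderate_upto k e U (\<lambda>\<epsilon> x. frechet_derivative (f \<epsilon>) (at x) b)" if "b \<in> Basis" for b
    using frechet_derivative_at[OF D] by (intro moderate_upto_cong[OF assms(1,2) k[OF that]]) metis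
  moreover have "f \<epsilon> differentiable (at x)" if "\<epsilon> \<in> {0<..e}" "x \<in> U" for \<epsilon> x
    using D[OF that] by (rule differentiableI)
  ultimately show ?thesis using assms(3) by simp
qed

lemma moderate_upto_has_derivative:
  assumes "moderate_upto (Suc k) e U f" "\<epsilon> \<in> {0<..e}" "x \<in> U"
  shows "(f \<epsilon> has_derivative frechet_derivative (f \<epsilon>) (at x)) (at x)"
  using assms by (simp add: frechet_derivative_works[symmetric])

lemma moderate_upto_C1_on:
  assumes "moderate_upto (Suc k) e U f" "\<epsilon> \<in> {0<..e}"
  shows "C1_on U (f \<epsilon>)"
  using assms moderate_upto_continuous[of k e U "\<lambda>\<epsilon> x. frechet_derivative (f \<epsilon>) (at x) _" \<epsilon>]
  by (auto simp: C1_on_def)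

lemma locally_moderate_const: "locally_moderate U (\<lambda>_ _. c)"
  unfolding locally_moderate_def by (intro allI impI moderate_on_bounded[where C = "norm c"]) auto

lemma moderate_upto_const: "moderate_upto k e U (\<lambda>_ _. c)"
  by (induction k arbitrary: c) (auto simp: locally_moderate_const)

lemma locally_moderate_linear: "bounded_linear L \<Longrightarrow> locally_moderate U f \<Longrightarrow> locally_moderate U (\<lambda>\<epsilon> x. L (f \<epsilon> x))"
proof -
  assume L: "bounded_linear L" and f: "locally_moderate U f"
  obtain B where B: "\<And>x. norm (L x) \<le> norm x * B" using bounded_linear.bounded[OF L] by blast
  show "locally_moderate U (\<lambda>\<epsilon> x. L (f \<epsilon> x))"
    unfolding locally_moderate_def
  proof (intro allI impI)
    fix K assume K: "K \<subset>\<subset> U"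
    show "moderate_on K (\<lambda>\<epsilon> x. L (f \<epsilon> x))"
    proof (rule moderate_on_product_bound[where f = f and g = "\<lambda>_ _. 1::real" and B = B])
      show "moderate_on K f" using f K by (simp add: locally_moderate_def)
      show "moderate_on K (\<lambda>_ _. 1::real)" by (rule moderate_on_bounded[where C = 1]) simp
      show "\<forall>\<^sub>F \<epsilon> in at_right 0. \<forall>x\<in>K. norm (L (f \<epsilon> x)) \<le> norm (f \<epsilon> x) * norm (1::real) * B"
        by (rule always_eventually) (simp add: B)
    qed
  qed
qed

lemma moderate_upto_linear:
  assumes L: "bounded_linear L" and U: "open U" "e > 0" and f: "moderate_upto k e U f"
  shows "moderate_upto k e U (\<lambda>\<epsilon> x. L (f \<epsilon> x))"
  using f
proof (induction k arbitrary: f)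
  case 0
  then show ?case using locally_moderate_linear[OF L]
    by (auto intro!: bounded_linear.continuous_on[OF L])
next
  case (Suc k)
  show ?case
  proof (rule moderate_upto_SucI[OF U])
    show "locally_moderate U (\<lambda>\<epsilon> x. L (f \<epsilon> x))"
      using Suc.prems by (intro locally_moderate_linear[OF L]) simp
    show "((\<lambda>x. L (f \<epsilon> x)) has_derivative (\<lambda>h. L (frechet_derivative (f \<epsilon>) (at x) h))) (at x)"
      if "\<epsilon> \<in> {0<..e}" "x \<in> U" for \<epsilon> x
      by (rule bounded_linear.has_derivative[OF L moderate_upto_has_derivative[OF Suc.prems that]])
    show "moderate_upto k e U (\<lambda>\<epsilon> x. L (frechet_derivative (f \<epsilon>) (at x) b))" if "b \<in> Basis" for b
      using Suc.prems that by (intro Suc.IH) simp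
  qed
qed

lemma moderate_upto_add:
  assumes U: "open U" "e > 0" and f: "moderate_upto k e U f" and g: "moderate_upto k e U g"
  shows "moderate_upto k e U (\<lambda>\<epsilon> x. f \<epsilon> x + g \<epsilon> x)"
  using f g
proof (induction k arbitrary: f g)
  case 0
  then show ?case by (auto intro!: continuous_on_add moderate_on_add simp: locally_moderate_def)
next
  case (Suc k)
  show ?case
  proof (rule moderate_upto_SucI[OF U])
    show "locally_moderate U (\<lambda>\<epsilon> x. f \<epsilon> x + g \<epsilon> x)"
      using Suc.prems by (auto intro!: moderate_on_add simp: locally_moderate_def)
    show "((\<lambda>x. f \<epsilon> x + g \<epsilon> x) has_derivative
        (\<lambda>h. frechet_derivative (f \<epsilon>) (at x) h + frechet_derivative (g \<epsilon>) (at x) h)) (at x)"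
      if "\<epsilon> \<in> {0<..e}" "x \<in> U" for \<epsilon> x
      using Suc.prems that by (intro has_derivative_add moderate_upto_has_derivative)
    show "moderate_upto k e U (\<lambda>\<epsilon> x. frechet_derivative (f \<epsilon>) (at x) b + frechet_derivative (g \<epsilon>) (at x) b)"
      if "b \<in> Basis" for b
      using Suc.prems that by (intro Suc.IH) auto
  qed
qed

lemma moderate_upto_sum:
  assumes "open U" "e > 0" "\<And>i. i \<in> I \<Longrightarrow> moderate_upto k e U (f i)"
  shows "moderate_upto k e U (\<lambda>\<epsilon> x. \<Sum>i\<in>I. f i \<epsilon> x)"
  using assms(3)
proof (induction I rule: infinite_finite_induct)
  case (insert i I)
  have "moderate_upto k e U (\<lambda>\<epsilon> x. f i \<epsilon> x + (\<Sum>i\<in>I. f i \<epsilon> x))"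
    by (rule moderate_upto_add[OF assms(1,2)]) (use insert in auto)
  then show ?case using insert.hyps by simp
qed (simp_all add: moderate_upto_const)

lemma moderate_upto_bilinear:
  assumes B: "bounded_bilinear B" and U: "open U" "e > 0"
    and f: "moderate_upto k e U f" and g: "moderate_upto k e U g"
  shows "moderate_upto k e U (\<lambda>\<epsilon> x. B (f \<epsilon> x) (g \<epsilon> x))"
  using f g
proof (induction k arbitrary: f g)
  have m: "locally_moderate U (\<lambda>\<epsilon> x. B (f \<epsilon> x) (g \<epsilon> x))"
    if "locally_moderate U f" "locally_moderate U g" for f g
  proof -
    obtain C where C: "\<And>x y. norm (B x y) \<le> norm x * norm y * C"
      using bounded_bilinear.bounded[OF B] by blast
    show ?thesis unfolding locally_moderate_def
    proof (intro allI impI)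
      fix K assume K: "K \<subset>\<subset> U"
      show "moderate_on K (\<lambda>\<epsilon> x. B (f \<epsilon> x) (g \<epsilon> x))"
      proof (rule moderate_on_product_bound[where f = f and g = g and B = C])
        show "moderate_on K f" "moderate_on K g" using that K by (auto simp: locally_moderate_def)
        show "\<forall>\<^sub>F \<epsilon> in at_right 0. \<forall>x\<in>K. norm (B (f \<epsilon> x) (g \<epsilon> x)) \<le> norm (f \<epsilon> x) * norm (g \<epsilon> x) * C"
          by (rule always_eventually) (simp add: C)
      qed
    qed
  qed
  {
    case 0
    then show ?case using m by (auto intro!: bounded_bilinear.continuous_on[OF B])
  next
    case (Suc k)
    show ?case
    proof (rule moderate_upto_SucI[OF U])
      show "locally_moderate U (\<lambda>\<epsilon> x. B (f \<epsilon> x) (g \<epsilon> x))" using m Suc.prems by simp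
      show "((\<lambda>x. B (f \<epsilon> x) (g \<epsilon> x)) has_derivative
          (\<lambda>h. B (f \<epsilon> x) (frechet_derivative (g \<epsilon>) (at x) h) + B (frechet_derivative (f \<epsilon>) (at x) h) (g \<epsilon> x))) (at x)"
        if "\<epsilon> \<in> {0<..e}" "x \<in> U" for \<epsilon> x
        using Suc.prems that by (intro bounded_bilinear.FDERIV[OF B] moderate_upto_has_derivative)
      show "moderate_upto k e U (\<lambda>\<epsilon> x. B (f \<epsilon> x) (frechet_derivative (g \<epsilon>) (at x) b) +
          B (frechet_derivative (f \<epsilon>) (at x) b) (g \<epsilon> x))" if "b \<in> Basis" for b
        using Suc.prems that moderate_upto_SucD[OF Suc.prems(1)] moderate_upto_SucD[OF Suc.prems(2)]
        by (intro moderate_upto_add[OF U] Suc.IH) auto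
    qed
  }
qed

lemmas moderate_upto_scaleR = moderate_upto_bilinear[OF bounded_bilinear_scaleR]
lemmas moderate_upto_inner_left = moderate_upto_linear[OF bounded_linear_inner_left]

text \<open>Condition (b) of c-boundedness.\<close>

definition compactly_maps :: "'a::euclidean_space set \<Rightarrow> 'b::euclidean_space set \<Rightarrow> ('a, 'b) net \<Rightarrow> bool" where
  "compactly_maps U V g \<longleftrightarrow>
     (\<forall>K. K \<subset>\<subset> U \<longrightarrow> (\<exists>L. L \<subset>\<subset> V \<and> (\<forall>\<^sub>F \<epsilon> in at_right 0. g \<epsilon> ` K \<subseteq> L)))"

text \<open>The chain rule expresses a derivative of the composition as a sum of products of derivatives of \<open>g\<close> and
  compositions of derivatives of \<open>f\<close> with \<open>g\<close>; the latter are covered by the induction hypothesis.\<close>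

lemma moderate_upto_compose:
  assumes U: "open U" "e > 0" and V: "open V"
    and f: "moderate_upto k e V f" and g: "moderate_upto k e U g"
    and into: "\<And>\<epsilon> x. \<epsilon> \<in> {0<..e} \<Longrightarrow> x \<in> U \<Longrightarrow> g \<epsilon> x \<in> V"
    and cpt: "compactly_maps U V g"
  shows "moderate_upto k e U (\<lambda>\<epsilon> x. f \<epsilon> (g \<epsilon> x))"
  using f g
proof (induction k arbitrary: f)
  have m: "locally_moderate U (\<lambda>\<epsilon> x. f \<epsilon> (g \<epsilon> x))" if f: "locally_moderate V f"
    for f :: "('b, 'c) net"
    unfolding locally_moderate_def
  proof (intro allI impI)
    fix K assume "K \<subset>\<subset> U"
    then obtain L where L: "L \<subset>\<subset> V" "\<forall>\<^sub>F \<epsilon> in at_right 0. g \<epsilon> ` K \<subseteq> L"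
      using cpt unfolding compactly_maps_def by blast
    obtain N where "\<forall>\<^sub>F \<epsilon> in at_right 0. \<forall>x\<in>L. norm (f \<epsilon> x) \<le> (1 / \<epsilon>) ^ N"
      using f L(1) unfolding locally_moderate_def moderate_on_def by blast
    with L(2) have "\<forall>\<^sub>F \<epsilon> in at_right 0. \<forall>x\<in>K. norm (f \<epsilon> (g \<epsilon> x)) \<le> (1 / \<epsilon>) ^ N"
      by eventually_elim auto
    then show "moderate_on K (\<lambda>\<epsilon> x. f \<epsilon> (g \<epsilon> x))" unfolding moderate_on_def by blast
  qed
  {
    case 0
    have "continuous_on U (\<lambda>x. f \<epsilon> (g \<epsilon> x))" if "\<epsilon> \<in> {0<..e}" for \<epsilon>
      using 0 that into by (intro continuous_on_compose2[of V "f \<epsilon>" U "g \<epsilon>"]) auto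
    then show ?case using m 0 by simp
  next
    case (Suc k)
    define D where "D \<epsilon> x h = (\<Sum>j\<in>Basis. (frechet_derivative (g \<epsilon>) (at x) h \<bullet> j) *\<^sub>R
        frechet_derivative (f \<epsilon>) (at (g \<epsilon> x)) j)" for \<epsilon> x h
    show ?case
    proof (rule moderate_upto_SucI[OF U])
      show "locally_moderate U (\<lambda>\<epsilon> x. f \<epsilon> (g \<epsilon> x))" using m Suc.prems by simp
      show "((\<lambda>x. f \<epsilon> (g \<epsilon> x)) has_derivative D \<epsilon> x) (at x)" if \<epsilon>: "\<epsilon> \<in> {0<..e}" and x: "x \<in> U" for \<epsilon> x
      proof -
        note df = moderate_upto_has_derivative[OF Suc.prems(1) \<epsilon> into[OF \<epsilon> x]]
        have "((\<lambda>x. f \<epsilon> (g \<epsilon> x)) has_derivative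
            (\<lambda>h. frechet_derivative (f \<epsilon>) (at (g \<epsilon> x)) (frechet_derivative (g \<epsilon>) (at x) h))) (at x)"
          by (rule has_derivative_compose[OF moderate_upto_has_derivative[OF Suc.prems(2) \<epsilon> x] df])
        moreover have "frechet_derivative (f \<epsilon>) (at (g \<epsilon> x)) (frechet_derivative (g \<epsilon>) (at x) h) = D \<epsilon> x h" for h
          unfolding D_def by (rule linear_sum_Basis[OF has_derivative_linear[OF df]])
        ultimately show ?thesis by simp
      qed
      show "moderate_upto k e U (\<lambda>\<epsilon> x. D \<epsilon> x b)" if b: "b \<in> Basis" for b
        unfolding D_def
      proof (intro moderate_upto_sum[OF U] moderate_upto_scaleR[OF U] moderate_upto_inner_left[OF U])
        show "moderate_upto k e U (\<lambda>\<epsilon> x. frechet_derivative (g \<epsilon>) (at x) b)"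
          using Suc.prems(2) b by simp
        show "moderate_upto k e U (\<lambda>\<epsilon> x. frechet_derivative (f \<epsilon>) (at (g \<epsilon> x)) j)" if "j \<in> Basis" for j
          using Suc.prems that moderate_upto_SucD[OF Suc.prems(2)]
          by (intro Suc.IH[of "\<lambda>\<epsilon> y. frechet_derivative (f \<epsilon>) (at y) j"]) auto
      qed
    qed
  }
qed

lemma locally_moderate_static:
  assumes "continuous_on U f"
  shows "locally_moderate U (\<lambda>_. f)"
  unfolding locally_moderate_def
proof (intro allI impI)
  fix K assume K: "K \<subset>\<subset> U"
  have "bounded (f ` K)"
    using cpt_insideD[OF K] assms by (intro compact_imp_bounded compact_continuous_image) (auto intro: continuous_on_subset)
  then obtain C where "\<forall>x\<in>K. norm (f x) \<le> C" unfolding bounded_iff by auto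
  then show "moderate_on K (\<lambda>_. f)" by (intro moderate_on_bounded[where C = C]) auto
qed

lemma moderate_upto_id_linear:
  assumes L: "bounded_linear L" and U: "open U" "e > 0"
  shows "moderate_upto k e U (\<lambda>_. L)"
proof (cases k)
  case 0
  then show ?thesis using locally_moderate_static[of U L] linear_continuous_on[OF L] by simp
next
  case (Suc j)
  show ?thesis unfolding Suc
    using bounded_linear_imp_has_derivative[OF L] locally_moderate_static[OF linear_continuous_on[OF L]]
    by (intro moderate_upto_SucI[OF U, where D = "\<lambda>_ _. L"] moderate_upto_const) auto
qed

lemma moderate_upto_Pair:
  assumes U: "open U" "e > 0" and f: "moderate_upto k e U f" and g: "moderate_upto k e U g"
  shows "moderate_upto k e U (\<lambda>\<epsilon> x. (f \<epsilon> x, g \<epsilon> x))"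
proof -
  have 1: "bounded_linear (\<lambda>x::'b. (x, 0::'c))" "bounded_linear (\<lambda>y::'c. (0::'b, y))"
    by (intro bounded_linear_Pair bounded_linear_ident bounded_linear_zero)+
  show ?thesis
    using moderate_upto_add[OF U moderate_upto_linear[OF 1(1) U f] moderate_upto_linear[OF 1(2) U g]] by simp
qed

lemma iter_pderiv_append: "iter_pderiv (as @ bs) f = iter_pderiv as (iter_pderiv bs f)"
  by (induction as) auto

lemma moderate_upto_iter_pderiv:
  assumes "moderate_upto (k + length bs) e U f" "bs \<in> lists Basis"
  shows "moderate_upto k e U (\<lambda>\<epsilon>. iter_pderiv bs (f \<epsilon>))"
  using assms
proof (induction bs arbitrary: f rule: rev_induct)
  case (snoc b bs)
  have "moderate_upto k e U (\<lambda>\<epsilon>. iter_pderiv bs (\<lambda>x. frechet_derivative (f \<epsilon>) (at x) b))"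
    using snoc.prems by (intro snoc.IH) auto
  then show ?case by (simp add: iter_pderiv_append)
qed simp

text \<open>The link to the definition of moderate nets: both sides bound the same iterated partial derivatives.\<close>

lemma moderate_nets_iff: "f \<in> moderate_nets U \<longleftrightarrow> (\<forall>k. moderate_upto k 1 U f)"
proof
  assume f: "f \<in> moderate_nets U"
  have "moderate_upto k 1 U (\<lambda>\<epsilon>. iter_pderiv bs (f \<epsilon>))" if "bs \<in> lists Basis" for k bs
    using that
  proof (induction k arbitrary: bs)
    have diff: "iter_pderiv bs (f \<epsilon>) differentiable (at x)" if "bs \<in> lists Basis" "\<epsilon> \<in> {0<..1}" "x \<in> U" for bs \<epsilon> x
      using f that by (auto simp: moderate_nets_def smooth_nets_def smooth_fun_on_def)
    have mod: "locally_moderate U (\<lambda>\<epsilon>. iter_pderiv bs (f \<epsilon>))" if "bs \<in> lists Basis" for bs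
      using f that by (auto simp: moderate_nets_def locally_moderate_def moderate_on_iff[symmetric])
    {
      case 0
      have "continuous_on U (iter_pderiv bs (f \<epsilon>))" if "\<epsilon> \<in> {0<..1}" for \<epsilon>
        using diff[OF 0 that]
        by (intro continuous_at_imp_continuous_on ballI differentiable_imp_continuous_within)
      then show ?case using mod[OF 0] by simp
    next
      case (Suc k)
      have "moderate_upto k 1 U (\<lambda>\<epsilon>. iter_pderiv (b # bs) (f \<epsilon>))" if "b \<in> Basis" for b
        by (rule Suc.IH) (use Suc.prems that in auto)
      then show ?case using diff[OF Suc.prems] mod[OF Suc.prems] by simp
    }
  qed
  from this[of "[]"] show "\<forall>k. moderate_upto k 1 U f" by simp
next
  assume f: "\<forall>k. moderate_upto k 1 U f"
  have 1: "moderate_upto 1 1 U (\<lambda>\<epsilon>. iter_pderiv bs (f \<epsilon>))" if "bs \<in> lists Basis" for bs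
    using f that by (intro moderate_upto_iter_pderiv) auto
  have "f \<in> smooth_nets U"
    using 1 by (auto simp: smooth_nets_def smooth_fun_on_def)
  moreover have "\<exists>N::nat. sup_bigo K (\<lambda>\<epsilon>. iter_pderiv bs (f \<epsilon>)) (\<lambda>\<epsilon>. 1 / \<epsilon> ^ N)"
    if "K \<subset>\<subset> U" "bs \<in> lists Basis" for K bs
    using moderate_upto_moderate[OF 1[OF that(2)]] that(1)
    by (simp add: moderate_on_iff locally_moderate_def)
  ultimately show "f \<in> moderate_nets U" by (simp add: moderate_nets_def)
qed

lemma moderate_upto_derivative:
  "moderate_upto (Suc k) e U f \<Longrightarrow> b \<in> Basis \<Longrightarrow> moderate_upto k e U (\<lambda>\<epsilon> x. frechet_derivative (f \<epsilon>) (at x) b)"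
  by simp

section \<open>Moderate solutions of ordinary differential equations\<close>

text \<open>The equation \<open>w' = A w + b\<close> with initial value \<open>0\<close> at time \<open>s\<close> for every parameter.  The operator is given by
  its columns \<open>A j\<close>, so that its entries are nets with values in the same Euclidean space.\<close>

definition linear_ode_solution ::
  "'p::euclidean_space set \<Rightarrow> real set \<Rightarrow> real \<Rightarrow> ('e::euclidean_space \<Rightarrow> 'p \<times> real \<Rightarrow> 'e) \<Rightarrow>
   ('p \<times> real \<Rightarrow> 'e) \<Rightarrow> ('p \<times> real \<Rightarrow> 'e) \<Rightarrow> bool" where
  "linear_ode_solution P J s A b w \<longleftrightarrow> (\<forall>p\<in>P. w (p, s) = 0 \<and>
     (\<forall>t\<in>J. ((\<lambda>t. w (p, t)) has_vector_derivative
        (\<Sum>j\<in>Basis. (w (p, t) \<bullet> j) *\<^sub>R A j (p, t)) + b (p, t)) (at t)))"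

lemma linear_combination_lipschitz:
  fixes A :: "'e::euclidean_space \<Rightarrow> 'z::topological_space \<Rightarrow> 'e"
  assumes "compact K" "\<And>j. j \<in> Basis \<Longrightarrow> continuous_on K (A j)"
  shows "\<exists>k. \<forall>z\<in>K. k-lipschitz_on UNIV (\<lambda>x. (\<Sum>j\<in>Basis. (x \<bullet> j) *\<^sub>R A j z) + b z)"
proof -
  have "\<exists>M. \<forall>z\<in>K. norm (A j z) \<le> M" if "j \<in> Basis" for j
  proof -
    have "bounded (A j ` K)" using assms that by (intro compact_imp_bounded compact_continuous_image)
    then show ?thesis unfolding bounded_iff by auto
  qed
  then obtain M where M: "\<And>j z. j \<in> Basis \<Longrightarrow> z \<in> K \<Longrightarrow> norm (A j z) \<le> M j" by metis
  have "(\<Sum>j\<in>(Basis::'e set). \<bar>M j\<bar>)-lipschitz_on UNIV (\<lambda>x. (\<Sum>j\<in>Basis. (x \<bullet> j) *\<^sub>R A j z) + b z)" if z: "z \<in> K" for z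
  proof (rule lipschitz_onI)
    fix x y :: 'e
    have "dist ((\<Sum>j\<in>Basis. (x \<bullet> j) *\<^sub>R A j z) + b z) ((\<Sum>j\<in>Basis. (y \<bullet> j) *\<^sub>R A j z) + b z)
        = norm (\<Sum>j\<in>Basis. ((x - y) \<bullet> j) *\<^sub>R A j z)"
      by (simp add: dist_norm sum_subtractf inner_diff_left scaleR_diff_left)
    also have "\<dots> \<le> (\<Sum>j\<in>(Basis::'e set). \<bar>M j\<bar> * norm (x - y))"
    proof (rule sum_norm_le)
      fix j :: 'e assume j: "j \<in> Basis"
      have "\<bar>(x - y) \<bullet> j\<bar> * norm (A j z) \<le> norm (x - y) * \<bar>M j\<bar>"
        using Basis_le_norm[OF j, of "x - y"] order_trans[OF M[OF j z] abs_ge_self] by (intro mult_mono) auto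
      then show "norm (((x - y) \<bullet> j) *\<^sub>R A j z) \<le> \<bar>M j\<bar> * norm (x - y)" by (simp add: mult.commute)
    qed
    finally show "dist ((\<Sum>j\<in>Basis. (x \<bullet> j) *\<^sub>R A j z) + b z) ((\<Sum>j\<in>Basis. (y \<bullet> j) *\<^sub>R A j z) + b z)
        \<le> (\<Sum>j\<in>Basis. \<bar>M j\<bar>) * dist x y" by (simp add: sum_distrib_right dist_norm)
  qed (auto intro: sum_nonneg)
  then show ?thesis by blast
qed

lemma linear_ode_solution_exists:
  fixes A :: "'e::euclidean_space \<Rightarrow> 'p::euclidean_space \<times> real \<Rightarrow> 'e"
  assumes s: "s \<in> {c<..<d}"
    and A: "\<And>j. j \<in> Basis \<Longrightarrow> continuous_on (P \<times> {c<..<d}) (A j)"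
    and b: "continuous_on (P \<times> {c<..<d}) b"
  shows "\<exists>w. linear_ode_solution P {c<..<d} s A b w"
proof -
  have "\<exists>y. y s = 0 \<and> (\<forall>t\<in>{c<..<d}. (y has_vector_derivative
      (\<Sum>j\<in>Basis. (y t \<bullet> j) *\<^sub>R A j (p, t)) + b (p, t)) (at t))" if p: "p \<in> P" for p
  proof -
    have slice: "continuous_on (S \<times> UNIV) (\<lambda>z::real \<times> 'e. f (p, fst z))" "continuous_on S (\<lambda>t. f (p, t))"
      if "continuous_on (P \<times> {c<..<d}) f" "S \<subseteq> {c<..<d}" for f :: "'p \<times> real \<Rightarrow> 'e" and S
      using p that by (auto intro!: continuous_on_compose2[OF that(1)] continuous_intros)
    show ?thesis
    proof (rule picard_lindelof_open[OF s, of "\<lambda>t x. (\<Sum>j\<in>Basis. (x \<bullet> j) *\<^sub>R A j (p, t)) + b (p, t)"])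
      show "continuous_on ({c<..<d} \<times> UNIV) (\<lambda>(t, x). (\<Sum>j\<in>Basis. (x \<bullet> j) *\<^sub>R A j (p, t)) + b (p, t))"
        unfolding split_def by (intro continuous_intros slice A b order_refl) auto
      show "\<exists>k. \<forall>t\<in>{c'..d'}. k-lipschitz_on UNIV (\<lambda>x. (\<Sum>j\<in>Basis. (x \<bullet> j) *\<^sub>R A j (p, t)) + b (p, t))"
        if "c < c'" "d' < d" for c' d'
      proof (rule linear_combination_lipschitz[OF compact_Icc])
        have "{c'..d'} \<subseteq> {c<..<d}" using that by auto
        then show "continuous_on {c'..d'} (\<lambda>t. A j (p, t))" if "j \<in> Basis" for j
          using slice(2)[OF A[OF that]] by blast
      qed
    qed
  qed
  then obtain Y where Y: "\<And>p. p \<in> P \<Longrightarrow> Y p s = 0" "\<And>p t. p \<in> P \<Longrightarrow> t \<in> {c<..<d} \<Longrightarrow>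
      (Y p has_vector_derivative (\<Sum>j\<in>Basis. (Y p t \<bullet> j) *\<^sub>R A j (p, t)) + b (p, t)) (at t)"
    by metis
  have "linear_ode_solution P {c<..<d} s A b (\<lambda>(p, t). Y p t)"
    unfolding linear_ode_solution_def using Y by simp
  then show ?thesis by blast
qed

text \<open>Here \<open>A\<close> and \<open>B i\<close> are the coefficients of the linearization of \<open>g\<close> along \<open>y\<close>, in the state and in the
  direction \<open>i\<close> of the parameter.\<close>

lemma ode_solution_has_derivative:
  fixes y :: "'p::euclidean_space \<times> real \<Rightarrow> 'e::euclidean_space"
  assumes P: "open P" and s: "s \<in> {c<..<d}"
    and deriv: "\<And>p r. p \<in> P \<Longrightarrow> r \<in> {c<..<d} \<Longrightarrow>
      ((\<lambda>t. y (p, t)) has_vector_derivative g ((p, r), y (p, r))) (at r)"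
    and init: "\<And>p. p \<in> P \<Longrightarrow> y (p, s) = \<xi>"
    and range: "\<And>p r. p \<in> P \<Longrightarrow> r \<in> {c<..<d} \<Longrightarrow> y (p, r) \<in> X"
    and X': "open X'" "X \<subseteq> X'" and C1: "C1_on ((P \<times> {c<..<d}) \<times> X') g"
    and lip: "\<And>K. compact K \<Longrightarrow> K \<subseteq> P \<times> {c<..<d} \<Longrightarrow> \<exists>k. \<forall>z\<in>K. k-lipschitz_on X (\<lambda>x. g (z, x))"
    and A: "\<And>j z. j \<in> Basis \<Longrightarrow> z \<in> P \<times> {c<..<d} \<Longrightarrow> frechet_derivative g (at (z, y z)) (0, j) = A j z"
    and B: "\<And>i z. i \<in> Basis \<Longrightarrow> z \<in> P \<times> {c<..<d} \<Longrightarrow> frechet_derivative g (at (z, y z)) ((i, 0), 0) = B i z"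
    and w: "\<And>i. i \<in> Basis \<Longrightarrow> linear_ode_solution P {c<..<d} s A (B i) (w i)"
    and cont: "continuous_on (P \<times> {c<..<d}) (\<lambda>z. g (z, y z))"
    and p: "p \<in> P" and t: "t \<in> {c<..<d}"
  shows "(y has_derivative (\<lambda>(q, r). (\<Sum>i\<in>Basis. (q \<bullet> i) *\<^sub>R w i (p, t)) + r *\<^sub>R g ((p, t), y (p, t)))) (at (p, t))"
proof (rule ode_joint_derivative[OF P open_greaterThanLessThan p t _ deriv cont])
  show "((\<lambda>p. y (p, t)) has_derivative (\<lambda>q. \<Sum>i\<in>Basis. (q \<bullet> i) *\<^sub>R w i (p, t))) (at p)"
  proof (rule ode_differentiable_parameter[OF P s deriv init range X' C1 lip p t,
        where w = "\<lambda>i t. w i (p, t)"])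
    show "w i (p, s) = 0" if "i \<in> Basis" for i
      using w[OF that] p by (simp add: linear_ode_solution_def)
    show "((\<lambda>t. w i (p, t)) has_vector_derivative
        frechet_derivative g (at ((p, r), y (p, r))) ((i, 0), w i (p, r))) (at r)"
      if i: "i \<in> Basis" and r: "r \<in> {c<..<d}" for i r
    proof -
      let ?D = "frechet_derivative g (at ((p, r), y (p, r)))"
      have z: "(p, r) \<in> P \<times> {c<..<d}" using p r by simp
      have lin: "linear ?D"
        using C1 range[OF p r] X' z by (intro linear_frechet_derivative) (auto simp: C1_on_def)
      then have lin0: "linear (\<lambda>v. ?D (0, v))"
        using linear_compose[of "\<lambda>v. (0, v)" ?D] by (simp add: o_def linear_iff)
      have "?D ((i, 0), w i (p, r)) = ?D ((0, w i (p, r)) + ((i, 0), 0))" by simp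
      also have "\<dots> = ?D (0, w i (p, r)) + ?D ((i, 0), 0)" by (rule linear_add[OF lin])
      also have "\<dots> = (\<Sum>j\<in>Basis. (w i (p, r) \<bullet> j) *\<^sub>R A j (p, r)) + B i (p, r)"
        using linear_sum_Basis[OF lin0, of "w i (p, r)"] A z B[OF i z] by (simp cong: sum.cong)
      finally show ?thesis
        using w[OF i] p r by (simp add: linear_ode_solution_def)
    qed
  qed
qed

text \<open>The induction step common to the linear and the nonlinear equation.  The partial derivatives of \<open>y\<close> are \<open>g\<close> along
  \<open>y\<close> for the time direction, and solutions of the linearized equation for the directions of the
  parameter.  If these are moderate up to order \<open>k\<close>, then \<open>y\<close> is so up to order \<open>k + 1\<close>.\<close>

lemma moderate_upto_Suc_ode:
  fixes y :: "('p::euclidean_space \<times> real, 'e::euclidean_space) net"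
  assumes P: "open P" and e: "e > 0" and s: "\<And>\<epsilon>. \<epsilon> \<in> {0<..e} \<Longrightarrow> s \<epsilon> \<in> {c<..<d}"
    and deriv: "\<And>\<epsilon> p r. \<epsilon> \<in> {0<..e} \<Longrightarrow> p \<in> P \<Longrightarrow> r \<in> {c<..<d} \<Longrightarrow>
      ((\<lambda>t. y \<epsilon> (p, t)) has_vector_derivative g \<epsilon> ((p, r), y \<epsilon> (p, r))) (at r)"
    and init: "\<And>\<epsilon> p. \<epsilon> \<in> {0<..e} \<Longrightarrow> p \<in> P \<Longrightarrow> y \<epsilon> (p, s \<epsilon>) = \<xi> \<epsilon>"
    and range: "\<And>\<epsilon> p r. \<epsilon> \<in> {0<..e} \<Longrightarrow> p \<in> P \<Longrightarrow> r \<in> {c<..<d} \<Longrightarrow> y \<epsilon> (p, r) \<in> X \<epsilon>"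
    and X': "open X'" "\<And>\<epsilon>. \<epsilon> \<in> {0<..e} \<Longrightarrow> X \<epsilon> \<subseteq> X'"
    and C1: "\<And>\<epsilon>. \<epsilon> \<in> {0<..e} \<Longrightarrow> C1_on ((P \<times> {c<..<d}) \<times> X') (g \<epsilon>)"
    and lip: "\<And>\<epsilon> K. \<epsilon> \<in> {0<..e} \<Longrightarrow> compact K \<Longrightarrow> K \<subseteq> P \<times> {c<..<d} \<Longrightarrow>
      \<exists>k. \<forall>z\<in>K. k-lipschitz_on (X \<epsilon>) (\<lambda>x. g \<epsilon> (z, x))"
    and A: "\<And>\<epsilon> j z. \<epsilon> \<in> {0<..e} \<Longrightarrow> j \<in> Basis \<Longrightarrow> z \<in> P \<times> {c<..<d} \<Longrightarrow>
      frechet_derivative (g \<epsilon>) (at (z, y \<epsilon> z)) (0, j) = A j \<epsilon> z"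
    and B: "\<And>\<epsilon> i z. \<epsilon> \<in> {0<..e} \<Longrightarrow> i \<in> Basis \<Longrightarrow> z \<in> P \<times> {c<..<d} \<Longrightarrow>
      frechet_derivative (g \<epsilon>) (at (z, y \<epsilon> z)) ((i, 0), 0) = B i \<epsilon> z"
    and mod: "\<And>j. j \<in> Basis \<Longrightarrow> moderate_upto k e (P \<times> {c<..<d}) (A j)"
      "\<And>i. i \<in> Basis \<Longrightarrow> moderate_upto k e (P \<times> {c<..<d}) (B i)"
      "moderate_upto k e (P \<times> {c<..<d}) (\<lambda>\<epsilon> z. g \<epsilon> (z, y \<epsilon> z))"
      "locally_moderate (P \<times> {c<..<d}) y"
    and linear: "\<And>i w. i \<in> Basis \<Longrightarrow> (\<And>\<epsilon>. \<epsilon> \<in> {0<..e} \<Longrightarrow>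
        linear_ode_solution P {c<..<d} (s \<epsilon>) (\<lambda>j. A j \<epsilon>) (B i \<epsilon>) (w \<epsilon>)) \<Longrightarrow>
      moderate_upto k e (P \<times> {c<..<d}) w"
  shows "moderate_upto (Suc k) e (P \<times> {c<..<d}) y"
proof -
  let ?J = "{c<..<d}"
  have "\<exists>w. linear_ode_solution P ?J (s \<epsilon>) (\<lambda>j. A j \<epsilon>) (B i \<epsilon>) w" if "i \<in> Basis" "\<epsilon> \<in> {0<..e}" for i \<epsilon>
    using moderate_upto_continuous[OF mod(1) that(2)] moderate_upto_continuous[OF mod(2)[OF that(1)] that(2)]
    by (intro linear_ode_solution_exists s that)
  then obtain w where w: "\<And>i \<epsilon>. i \<in> Basis \<Longrightarrow> \<epsilon> \<in> {0<..e} \<Longrightarrow>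
      linear_ode_solution P ?J (s \<epsilon>) (\<lambda>j. A j \<epsilon>) (B i \<epsilon>) (w i \<epsilon>)" by metis
  define D where "D \<epsilon> z = (\<lambda>(q, r). (\<Sum>i\<in>Basis. (q \<bullet> i) *\<^sub>R w i \<epsilon> z) + r *\<^sub>R g \<epsilon> (z, y \<epsilon> z))" for \<epsilon> z
  have op: "open (P \<times> ?J)" by (intro open_Times P open_greaterThanLessThan)
  show ?thesis
  proof (rule moderate_upto_SucI[OF op e mod(4)])
    show "(y \<epsilon> has_derivative D \<epsilon> z) (at z)" if \<epsilon>: "\<epsilon> \<in> {0<..e}" and z: "z \<in> P \<times> ?J" for \<epsilon> z
    proof -
      obtain p t where pt: "z = (p, t)" "p \<in> P" "t \<in> ?J" using z by auto
      show ?thesis unfolding pt(1) D_def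
        by (rule ode_solution_has_derivative[OF P s[OF \<epsilon>] deriv[OF \<epsilon>] init[OF \<epsilon>] range[OF \<epsilon>]
              X'(1) X'(2)[OF \<epsilon>] C1[OF \<epsilon>] lip[OF \<epsilon>] A[OF \<epsilon>] B[OF \<epsilon>] w[OF _ \<epsilon>]
              moderate_upto_continuous[OF mod(3) \<epsilon>] pt(2,3)])
    qed
    show "moderate_upto k e (P \<times> ?J) (\<lambda>\<epsilon> z. D \<epsilon> z b)" if "b \<in> Basis" for b
    proof -
      consider i where "i \<in> Basis" "b = (i, 0)" | "b = (0, 1)" using \<open>b \<in> Basis\<close> by (auto simp: Basis_prod_def)
      then show ?thesis
      proof cases
        case 1
        have "(\<Sum>i'\<in>Basis. (i \<bullet> i') *\<^sub>R w i' \<epsilon> z) = w i \<epsilon> z" for \<epsilon> z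
          using 1(1) by (simp add: inner_Basis if_distrib[of "\<lambda>c. c *\<^sub>R _"] cong: if_cong)
        then have "(\<lambda>\<epsilon> z. D \<epsilon> z b) = w i" by (simp add: D_def 1(2) fun_eq_iff)
        then show ?thesis using linear[OF 1(1) w[OF 1(1)]] by simp
      next
        case 2
        then have "(\<lambda>\<epsilon> z. D \<epsilon> z b) = (\<lambda>\<epsilon> z. g \<epsilon> (z, y \<epsilon> z))" by (simp add: D_def fun_eq_iff)
        then show ?thesis using mod(3) by simp
      qed
    qed
  qed
qed

text \<open>The reason for the growth condition on \<open>\<partial>\<^sub>2 F\<close>: with a Lipschitz constant \<open>C \<bar>ln \<epsilon>\<bar>\<close> the factor in Gronwall's inequality is
  of the order of \<open>\<epsilon> powr (- C \<tau>)\<close>, hence moderate.\<close>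

lemma gronwall_log_factor:
  fixes C \<tau> :: real
  assumes "C \<ge> 0" "\<tau> \<ge> 0"
  shows "\<exists>N::nat. \<forall>\<^sub>F \<epsilon> in at_right 0. sqrt (\<tau> * exp ((2 * (C * \<bar>ln \<epsilon>\<bar>) + 1) * \<tau>)) \<le> (1 / \<epsilon>) ^ N"
proof -
  obtain N :: nat where N: "2 * C * \<tau> \<le> real N" using real_arch_simple by blast
  define M where "M = 1 + \<tau> * exp \<tau>"
  have M: "M \<ge> 1" using assms by (simp add: M_def)
  then have "1 / M > 0" by simp
  from eventually_at_right_0_Ioc[OF this] eventually_at_right_0_Ioc1
  have "\<forall>\<^sub>F \<epsilon> in at_right 0. sqrt (\<tau> * exp ((2 * (C * \<bar>ln \<epsilon>\<bar>) + 1) * \<tau>)) \<le> (1 / \<epsilon>) ^ Suc N"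
  proof eventually_elim
    case (elim \<epsilon>)
    then have \<epsilon>: "0 < \<epsilon>" "\<epsilon> \<le> 1" "M \<le> 1 / \<epsilon>" using M by (auto simp: field_simps)
    have ln: "\<bar>ln \<epsilon>\<bar> = ln (1 / \<epsilon>)" "ln (1 / \<epsilon>) \<ge> 0" using \<epsilon> by (auto simp: ln_div)
    have "exp ((2 * (C * \<bar>ln \<epsilon>\<bar>) + 1) * \<tau>) = exp \<tau> * exp ((2 * C * \<tau>) * ln (1 / \<epsilon>))"
      unfolding ln(1) mult_exp_exp by (simp add: algebra_simps)
    also have "\<dots> \<le> exp \<tau> * exp (real N * ln (1 / \<epsilon>))"
      using N ln(2) by (intro mult_left_mono) (auto intro: mult_right_mono)
    also have "exp (real N * ln (1 / \<epsilon>)) = (1 / \<epsilon>) ^ N"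
      using \<epsilon> by (simp add: exp_of_nat_mult)
    finally have E: "exp ((2 * (C * \<bar>ln \<epsilon>\<bar>) + 1) * \<tau>) \<le> exp \<tau> * (1 / \<epsilon>) ^ N" .
    have sqrt_le: "sqrt x \<le> 1 + x" if "x \<ge> 0" for x :: real
    proof (rule real_le_lsqrt)
      show "x \<le> (1 + x)\<^sup>2" using that by (simp add: power2_eq_square algebra_simps)
    qed (use that in auto)
    have "sqrt (\<tau> * exp ((2 * (C * \<bar>ln \<epsilon>\<bar>) + 1) * \<tau>)) \<le> 1 + \<tau> * exp ((2 * (C * \<bar>ln \<epsilon>\<bar>) + 1) * \<tau>)"
      using assms by (intro sqrt_le) auto
    also have "\<dots> \<le> 1 + \<tau> * (exp \<tau> * (1 / \<epsilon>) ^ N)"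
      using E assms by (intro add_left_mono mult_left_mono)
    also have "\<dots> \<le> M * (1 / \<epsilon>) ^ N"
      using one_le_power[of "1 / \<epsilon>" N] \<epsilon> by (simp add: M_def distrib_right mult.assoc del: power_divide)
    also have "\<dots> \<le> (1 / \<epsilon>) * (1 / \<epsilon>) ^ N" using \<epsilon> by (intro mult_right_mono) auto
    finally show ?case by simp
  qed
  then show ?thesis by blast
qed

lemma compact_in_open_interval:
  fixes K :: "real set"
  assumes K: "compact K" "K \<subseteq> {c<..<d}" and cd: "c < c'" "c' \<le> d'" "d' < d"
  obtains c1 d1 where "c < c1" "d1 < d" "K \<subseteq> {c1..d1}" "c1 \<le> c'" "d' \<le> d1"
proof -
  let ?K = "insert c' (insert d' K)"
  have "compact ?K" "?K \<noteq> {}" using K by auto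
  then obtain c1 d1 where h: "c1 \<in> ?K" "\<forall>t\<in>?K. c1 \<le> t" "d1 \<in> ?K" "\<forall>t\<in>?K. t \<le> d1"
    using compact_attains_inf[of ?K] compact_attains_sup[of ?K] by blast
  have "?K \<subseteq> {c<..<d}" using K cd by auto
  then have "c < c1" "d1 < d" using h(1,3) by auto
  moreover have "K \<subseteq> {c1..d1}" "c1 \<le> c'" "d' \<le> d1" using h(2,4) by auto
  ultimately show ?thesis by (rule that)
qed

text \<open>Differentiating the equation in direction \<open>i\<close> of the parameter yields an equation with the same \<open>A\<close>, the inhomogeneity
  \<open>(\<partial>\<^sub>i A) v + \<partial>\<^sub>i b\<close> and initial value \<open>0\<close>.  By the induction hypothesis \<open>v\<close>, hence this
  inhomogeneity, hence the solution of the new equation, is moderate up to order \<open>k\<close>.  The logarithmic bound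
  concerns \<open>A\<close> alone and is therefore inherited; at order \<open>0\<close> it gives the estimate.\<close>

lemma linear_ode_moderate:
  fixes A :: "'e::euclidean_space \<Rightarrow> ('p::euclidean_space \<times> real, 'e) net"
  assumes P: "open P" and e: "e > 0" and cd: "c < c'" "d' < d"
    and s: "\<And>\<epsilon>. \<epsilon> \<in> {0<..e} \<Longrightarrow> s \<epsilon> \<in> {c'..d'}"
    and A: "\<And>j. j \<in> Basis \<Longrightarrow> moderate_upto k e (P \<times> {c<..<d}) (A j)"
    and log: "\<And>K. K \<subset>\<subset> P \<times> {c<..<d} \<Longrightarrow> \<exists>C. \<forall>\<^sub>F \<epsilon> in at_right 0. \<forall>z\<in>K. \<forall>x.
      norm (\<Sum>j\<in>Basis. (x \<bullet> j) *\<^sub>R A j \<epsilon> z) \<le> C * \<bar>ln \<epsilon>\<bar> * norm x"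
    and b: "moderate_upto k e (P \<times> {c<..<d}) b"
    and v: "\<And>\<epsilon>. \<epsilon> \<in> {0<..e} \<Longrightarrow> linear_ode_solution P {c<..<d} (s \<epsilon>) (\<lambda>j. A j \<epsilon>) (b \<epsilon>) (v \<epsilon>)"
  shows "moderate_upto k e (P \<times> {c<..<d}) v"
  using A b v
proof (induction k arbitrary: b v)
  let ?J = "{c<..<d}"
  have sJ: "s \<epsilon> \<in> ?J" if "\<epsilon> \<in> {0<..e}" for \<epsilon> using s[OF that] cd by auto
  have op: "open (P \<times> ?J)" by (intro open_Times P open_greaterThanLessThan)
  define g where "g b \<epsilon> = (\<lambda>(z, x). (\<Sum>j\<in>Basis. (x \<bullet> j) *\<^sub>R A j \<epsilon> z) + b \<epsilon> z)"
    for b :: "('p \<times> real, 'e) net" and \<epsilon>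
  have lip: "\<exists>k. \<forall>z\<in>K. k-lipschitz_on UNIV (\<lambda>x. g b \<epsilon> (z, x))"
    if "\<And>j. j \<in> Basis \<Longrightarrow> continuous_on (P \<times> ?J) (A j \<epsilon>)" "compact K" "K \<subseteq> P \<times> ?J" for b \<epsilon> K
    unfolding g_def case_prod_conv
    using that by (intro linear_combination_lipschitz) (auto intro: continuous_on_subset)
  {
    case 0
    have Ac: "continuous_on (P \<times> ?J) (A j \<epsilon>)" if "j \<in> Basis" "\<epsilon> \<in> {0<..e}" for j \<epsilon>
      using 0(1)[OF that(1)] that(2) by simp
    have bc: "continuous_on (P \<times> ?J) (b \<epsilon>)" if "\<epsilon> \<in> {0<..e}" for \<epsilon>
      using 0(2) that by simp
    have vd: "((\<lambda>t. v \<epsilon> (p, t)) has_vector_derivative (\<Sum>j\<in>Basis. (v \<epsilon> (p, t) \<bullet> j) *\<^sub>R A j \<epsilon> (p, t)) + b \<epsilon> (p, t)) (at t)"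
      "v \<epsilon> (p, s \<epsilon>) = 0"
      if "\<epsilon> \<in> {0<..e}" "p \<in> P" "t \<in> ?J" for \<epsilon> p t
      using 0(3)[OF that(1)] that(2,3) by (auto simp: linear_ode_solution_def)
    have "continuous_on (P \<times> ?J) (v \<epsilon>)" if \<epsilon>: "\<epsilon> \<in> {0<..e}" for \<epsilon>
    proof (rule ode_continuous_parameter[OF P sJ[OF \<epsilon>], where g = "g b \<epsilon>" and X = UNIV and \<xi> = 0])
      show "continuous_on ((P \<times> ?J) \<times> UNIV) (g b \<epsilon>)"
        unfolding g_def split_def
        by (intro continuous_intros continuous_on_compose2[OF Ac[OF _ \<epsilon>]] continuous_on_compose2[OF bc[OF \<epsilon>]]) auto
      show "((\<lambda>t. v \<epsilon> (p, t)) has_vector_derivative g b \<epsilon> ((p, r), v \<epsilon> (p, r))) (at r)"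
        if "p \<in> P" "r \<in> ?J" for p r using vd(1)[OF \<epsilon> that] by (simp add: g_def)
      show "\<exists>k. \<forall>z\<in>K. k-lipschitz_on UNIV (\<lambda>x. g b \<epsilon> (z, x))" if "compact K" "K \<subseteq> P \<times> ?J" for K
        by (rule lip[OF Ac[OF _ \<epsilon>] that])
      show "v \<epsilon> (p, s \<epsilon>) = 0" if "p \<in> P" for p by (rule vd(2)[OF \<epsilon> that sJ[OF \<epsilon>]])
    qed simp
    moreover have "moderate_on K (v)" if K: "K \<subset>\<subset> P \<times> ?J" for K
    proof -
      have cK: "compact K" "K \<subseteq> P \<times> ?J" using cpt_insideD[OF K] by auto
      have "c' \<le> d'" using s[of e] e by force
      moreover have "compact (snd ` K)" "snd ` K \<subseteq> ?J"
        using cK by (auto intro!: compact_continuous_image continuous_intros)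
      ultimately obtain c1 d1 where c1: "c < c1" "d1 < d" "snd ` K \<subseteq> {c1..d1}" "c1 \<le> c'" "d' \<le> d1"
        using compact_in_open_interval[of "snd ` K" c d c' d'] cd by blast
      define K' where "K' = fst ` K \<times> {c1..d1}"
      have "compact (fst ` K)" using cK by (auto intro!: compact_continuous_image continuous_intros)
      then have K': "K' \<subset>\<subset> P \<times> ?J" using cK c1 op
        by (intro cpt_insideI) (auto simp: K'_def intro!: compact_Times)
      obtain C where C: "\<forall>\<^sub>F \<epsilon> in at_right 0. \<forall>z\<in>K'. \<forall>x. norm (\<Sum>j\<in>Basis. (x \<bullet> j) *\<^sub>R A j \<epsilon> z) \<le> C * \<bar>ln \<epsilon>\<bar> * norm x"
        using log[OF K'] by blast
      obtain N where N: "\<forall>\<^sub>F \<epsilon> in at_right 0. \<forall>z\<in>K'. norm (b \<epsilon> z) \<le> (1 / \<epsilon>) ^ N"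
        using 0(2) K' by (auto simp: locally_moderate_def moderate_on_def)
      define \<tau> where "\<tau> = d1 - c1"
      have "\<tau> \<ge> 0" using c1 \<open>c' \<le> d'\<close> by (simp add: \<tau>_def)
      then obtain M where M: "\<forall>\<^sub>F \<epsilon> in at_right 0. sqrt (\<tau> * exp ((2 * (\<bar>C\<bar> * \<bar>ln \<epsilon>\<bar>) + 1) * \<tau>)) \<le> (1 / \<epsilon>) ^ M"
        using gronwall_log_factor[of "\<bar>C\<bar>" \<tau>] by auto
      from C N M eventually_at_right_0_Ioc[OF e]
      have "\<forall>\<^sub>F \<epsilon> in at_right 0. \<forall>z\<in>K. norm (v \<epsilon> z) \<le> (1 / \<epsilon>) ^ (N + M)"
      proof eventually_elim
        case (elim \<epsilon>)
        show ?case
        proof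
          fix z assume z: "z \<in> K"
          obtain p t where pt: "z = (p, t)" by fastforce
          have p: "p \<in> P" "p \<in> fst ` K" and t: "t \<in> {c1..d1}" using z cK c1 by (force simp: pt)+
          have "norm (v \<epsilon> (p, t)) \<le> (1 / \<epsilon>) ^ N * sqrt (\<tau> * exp ((2 * (\<bar>C\<bar> * \<bar>ln \<epsilon>\<bar>) + 1) * \<tau>))"
          proof (rule gronwall_zero[where T = "{c1..d1}" and s = "s \<epsilon>"])
            have sc: "s \<epsilon> \<in> {c1..d1}" using s[OF elim(4)] c1 by auto
            then show "s \<epsilon> \<in> {c1..d1}" .
            show "\<bar>r - s \<epsilon>\<bar> \<le> \<tau>" if "r \<in> {c1..d1}" for r using that sc by (auto simp: \<tau>_def)
            show "v \<epsilon> (p, s \<epsilon>) = 0" by (rule vd(2)[OF elim(4) p(1) sJ[OF elim(4)]])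
            fix r assume r: "r \<in> {c1..d1}"
            then have rJ: "r \<in> ?J" using c1 by auto
            show "((\<lambda>t. v \<epsilon> (p, t)) has_vector_derivative
                (\<Sum>j\<in>Basis. (v \<epsilon> (p, r) \<bullet> j) *\<^sub>R A j \<epsilon> (p, r)) + b \<epsilon> (p, r)) (at r within {c1..d1})"
              by (rule has_vector_derivative_at_within[OF vd(1)[OF elim(4) p(1) rJ]])
            have z': "(p, r) \<in> K'" using p r by (simp add: K'_def)
            have "norm (\<Sum>j\<in>Basis. (v \<epsilon> (p, r) \<bullet> j) *\<^sub>R A j \<epsilon> (p, r)) \<le> C * \<bar>ln \<epsilon>\<bar> * norm (v \<epsilon> (p, r))"
              using elim(1) z' by blast
            also have "\<dots> \<le> \<bar>C\<bar> * \<bar>ln \<epsilon>\<bar> * norm (v \<epsilon> (p, r))" by (intro mult_right_mono) auto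
            finally show "norm ((\<Sum>j\<in>Basis. (v \<epsilon> (p, r) \<bullet> j) *\<^sub>R A j \<epsilon> (p, r)) + b \<epsilon> (p, r))
                \<le> \<bar>C\<bar> * \<bar>ln \<epsilon>\<bar> * norm (v \<epsilon> (p, r)) + (1 / \<epsilon>) ^ N"
              using elim(2) z' by (blast intro: norm_triangle_mono)
          qed (use t in auto)
          also have "\<dots> \<le> (1 / \<epsilon>) ^ N * (1 / \<epsilon>) ^ M"
            using elim by (intro mult_left_mono zero_le_power) auto
          finally show "norm (v \<epsilon> z) \<le> (1 / \<epsilon>) ^ (N + M)" by (simp add: pt power_add)
        qed
      qed
      then show ?thesis unfolding moderate_on_def by blast
    qed
    ultimately show ?case by (simp add: locally_moderate_def)
  next
    case (Suc k)
    note A = Suc.prems(1) and b = Suc.prems(2) and v = Suc.prems(3)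
    have A': "moderate_upto k e (P \<times> ?J) (A j)" if "j \<in> Basis" for j
      by (rule moderate_upto_SucD[OF A[OF that]])
    have vk: "moderate_upto k e (P \<times> ?J) v"
      by (rule Suc.IH[OF A' moderate_upto_SucD[OF b] v])
    define B where "B i \<epsilon> z = (\<Sum>j\<in>Basis. (v \<epsilon> z \<bullet> j) *\<^sub>R frechet_derivative (A j \<epsilon>) (at z) (i, 0)) +
        frechet_derivative (b \<epsilon>) (at z) (i, 0)" for i \<epsilon> z
    have i0: "(i, 0) \<in> Basis" if "i \<in> Basis" for i :: 'p using that by (simp add: Basis_prod_def)
    have Bk: "moderate_upto k e (P \<times> ?J) (B i)" if "i \<in> Basis" for i
      unfolding B_def
    proof (intro moderate_upto_add[OF op e] moderate_upto_sum[OF op e] moderate_upto_scaleR[OF op e]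
        moderate_upto_inner_left[OF op e] vk)
      show "moderate_upto k e (P \<times> ?J) (\<lambda>\<epsilon> z. frechet_derivative (A j \<epsilon>) (at z) (i, 0))" if "j \<in> Basis" for j
        by (rule moderate_upto_derivative[OF A[OF that] i0[OF \<open>i \<in> Basis\<close>]])
      show "moderate_upto k e (P \<times> ?J) (\<lambda>\<epsilon> z. frechet_derivative (b \<epsilon>) (at z) (i, 0))"
        by (rule moderate_upto_derivative[OF b i0[OF \<open>i \<in> Basis\<close>]])
    qed
    have op': "open ((P \<times> ?J) \<times> (UNIV :: 'e set))" by (rule open_Times[OF op open_UNIV])
    have fst_maps: "compactly_maps ((P \<times> ?J) \<times> (UNIV :: 'e set)) (P \<times> ?J) (\<lambda>_. fst)"
      unfolding compactly_maps_def
    proof (intro allI impI)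
      fix K assume K: "K \<subset>\<subset> (P \<times> ?J) \<times> (UNIV :: 'e set)"
      have "compact (fst ` K)"
        by (rule compact_continuous_image[OF continuous_on_fst[OF continuous_on_id] cpt_insideD(1)[OF K]])
      moreover have "fst ` K \<subseteq> P \<times> ?J" using cpt_insideD(2)[OF K] by auto
      ultimately have "fst ` K \<subset>\<subset> P \<times> ?J" by (rule cpt_insideI[OF _ _ op])
      then show "\<exists>L. L \<subset>\<subset> P \<times> ?J \<and> (\<forall>\<^sub>F \<epsilon>::real in at_right 0. fst ` K \<subseteq> L)" by auto
    qed
    have lift: "moderate_upto (Suc k) e ((P \<times> ?J) \<times> (UNIV :: 'e set)) (\<lambda>\<epsilon> x. f \<epsilon> (fst x))"
      if "moderate_upto (Suc k) e (P \<times> ?J) f" for f :: "('p \<times> real, 'e) net"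
      by (rule moderate_upto_compose[where f = f and g = "\<lambda>_. fst", OF op' e op that
            moderate_upto_id_linear[OF bounded_linear_fst op' e] _ fst_maps]) auto
    have gm: "moderate_upto (Suc k) e ((P \<times> ?J) \<times> UNIV) (g b)"
      unfolding g_def split_def
      by (intro moderate_upto_add[OF op' e] moderate_upto_sum[OF op' e] moderate_upto_scaleR[OF op' e]
          lift A b moderate_upto_inner_left[OF op' e] moderate_upto_id_linear[OF bounded_linear_snd op' e])
    have gd: "frechet_derivative (g b \<epsilon>) (at (z, x)) h =
        (\<Sum>j\<in>Basis. (x \<bullet> j) *\<^sub>R frechet_derivative (A j \<epsilon>) (at z) (fst h) + (snd h \<bullet> j) *\<^sub>R A j \<epsilon> z) +
        frechet_derivative (b \<epsilon>) (at z) (fst h)"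
      if \<epsilon>: "\<epsilon> \<in> {0<..e}" and z: "z \<in> P \<times> ?J" for \<epsilon> z x h
    proof -
      have df: "((\<lambda>x. f \<epsilon> (fst x)) has_derivative (\<lambda>h. frechet_derivative (f \<epsilon>) (at z) (fst h))) (at (z, x))"
        if "moderate_upto (Suc k) e (P \<times> ?J) f" for f :: "('p \<times> real, 'e) net"
        using has_derivative_compose[OF has_derivative_fst[OF has_derivative_ident], of "f \<epsilon>" _ "(z, x)" UNIV]
          moderate_upto_has_derivative[OF that \<epsilon> z] by simp
      have "(g b \<epsilon> has_derivative (\<lambda>h. (\<Sum>j\<in>Basis. (snd (z, x) \<bullet> j) *\<^sub>R frechet_derivative (A j \<epsilon>) (at z) (fst h) +
          (snd h \<bullet> j) *\<^sub>R A j \<epsilon> (fst (z, x))) + frechet_derivative (b \<epsilon>) (at z) (fst h))) (at (z, x))"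
        unfolding g_def split_def
        by (intro has_derivative_add has_derivative_sum has_derivative_scaleR df A b
            has_derivative_inner_left has_derivative_snd has_derivative_ident)
      from fun_cong[OF frechet_derivative_at[OF this], of h, symmetric]
      show ?thesis by (simp only: fst_conv snd_conv)
    qed
    have "linear_ode_solution P ?J (s \<epsilon>) (\<lambda>j. A j \<epsilon>) (b \<epsilon>) (v \<epsilon>)" if "\<epsilon> \<in> {0<..e}" for \<epsilon>
      using v that .
    note v' = this[unfolded linear_ode_solution_def, rule_format]
    show ?case
    proof (rule moderate_upto_Suc_ode[OF P e sJ, where g = "g b" and X = "\<lambda>_. UNIV" and X' = UNIV
          and A = A and B = B and \<xi> = "\<lambda>_. 0"])
      show "((\<lambda>t. v \<epsilon> (p, t)) has_vector_derivative g b \<epsilon> ((p, r), v \<epsilon> (p, r))) (at r)"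
        if "\<epsilon> \<in> {0<..e}" "p \<in> P" "r \<in> ?J" for \<epsilon> p r
        using v'[OF that(1,2)] that(3) by (simp add: g_def)
      show "v \<epsilon> (p, s \<epsilon>) = 0" if "\<epsilon> \<in> {0<..e}" "p \<in> P" for \<epsilon> p using v'[OF that] by simp
      show "C1_on ((P \<times> ?J) \<times> UNIV) (g b \<epsilon>)" if "\<epsilon> \<in> {0<..e}" for \<epsilon>
        by (rule moderate_upto_C1_on[OF gm that])
      show "\<exists>k. \<forall>z\<in>K. k-lipschitz_on UNIV (\<lambda>x. g b \<epsilon> (z, x))"
        if "\<epsilon> \<in> {0<..e}" "compact K" "K \<subseteq> P \<times> ?J" for \<epsilon> K
        by (rule lip[OF moderate_upto_continuous[OF A that(1)] that(2,3)])
      show "frechet_derivative (g b \<epsilon>) (at (z, v \<epsilon> z)) (0, j) = A j \<epsilon> z"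
        if "\<epsilon> \<in> {0<..e}" "j \<in> Basis" "z \<in> P \<times> ?J" for \<epsilon> j z
      proof -
        have "frechet_derivative (f \<epsilon>) (at z) 0 = 0"
          if "moderate_upto (Suc k) e (P \<times> ?J) f" for f :: "('p \<times> real, 'e) net"
          using moderate_upto_has_derivative[OF that \<open>\<epsilon> \<in> {0<..e}\<close> \<open>z \<in> _\<close>] has_derivative_linear linear_0 by blast
        then show ?thesis using gd[OF that(1,3), of "v \<epsilon> z" "(0, j)"] A b that(2)
          by (simp add: inner_Basis if_distrib[of "\<lambda>c. c *\<^sub>R _"] cong: if_cong)
      qed
      show "frechet_derivative (g b \<epsilon>) (at (z, v \<epsilon> z)) ((i, 0), 0) = B i \<epsilon> z"
        if "\<epsilon> \<in> {0<..e}" "i \<in> Basis" "z \<in> P \<times> ?J" for \<epsilon> i z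
        using gd[OF that(1,3), of "v \<epsilon> z" "((i, 0), 0)"] by (simp add: B_def)
      show "moderate_upto k e (P \<times> ?J) (\<lambda>\<epsilon> z. g b \<epsilon> (z, v \<epsilon> z))"
        unfolding g_def case_prod_conv
        by (intro moderate_upto_add[OF op e] moderate_upto_sum[OF op e] moderate_upto_scaleR[OF op e]
            moderate_upto_inner_left[OF op e] vk A' moderate_upto_SucD[OF b])
      show "moderate_upto k e (P \<times> ?J) w" if "i \<in> Basis"
        "\<And>\<epsilon>. \<epsilon> \<in> {0<..e} \<Longrightarrow> linear_ode_solution P ?J (s \<epsilon>) (\<lambda>j. A j \<epsilon>) (B i \<epsilon>) (w \<epsilon>)" for i w
        by (rule Suc.IH[OF A' Bk[OF that(1)] that(2)])
    qed (use A' Bk moderate_upto_moderate[OF vk] in auto)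
  }
qed

lemma C1_on_lipschitz_second:
  fixes g :: "'z::euclidean_space \<times> 'e::euclidean_space \<Rightarrow> 'f::euclidean_space"
  assumes g: "C1_on (\<Omega> \<times> U) g" and K: "compact K" "K \<subseteq> \<Omega>" and X: "compact X" "convex X" "X \<subseteq> U"
  shows "\<exists>k. \<forall>z\<in>K. k-lipschitz_on X (\<lambda>x. g (z, x))"
proof -
  have "compact (K \<times> X)" "K \<times> X \<subseteq> \<Omega> \<times> U" using K X by (auto intro: compact_Times)
  from C1_on_derivative_bound[OF g this] obtain M where
    "M \<ge> 0" "\<forall>z\<in>K \<times> X. \<forall>h. norm (frechet_derivative g (at z) h) \<le> M * norm h" by blast
  then have M: "M \<ge> 0" "\<And>z x h. z \<in> K \<Longrightarrow> x \<in> X \<Longrightarrow> norm (frechet_derivative g (at (z, x)) h) \<le> M * norm h"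
    by blast+
  have "M-lipschitz_on X (\<lambda>x. g (z, x))" if z: "z \<in> K" for z
  proof (rule lipschitz_onI[OF _ M(1)])
    fix x y assume xy: "x \<in> X" "y \<in> X"
    have "norm (g (z, x) - g (z, y)) \<le> M * norm (x - y)"
    proof (rule differentiable_bound[OF X(2) _ _ xy])
      fix x' assume x': "x' \<in> X"
      have d: "(g has_derivative frechet_derivative g (at (z, x'))) (at (z, x'))"
        using C1_on_has_derivative[OF g] z x' K X by blast
      have "((\<lambda>x. (z, x)) has_derivative (\<lambda>h. (0, h))) (at x' within X)"
        by (intro has_derivative_Pair has_derivative_const has_derivative_ident)
      from has_derivative_compose[OF this d]
      show "((\<lambda>x. g (z, x)) has_derivative (\<lambda>h. frechet_derivative g (at (z, x')) (0, h))) (at x' within X)" .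
      show "onorm (\<lambda>h. frechet_derivative g (at (z, x')) (0, h)) \<le> M"
        using M(2)[OF z x', of "(0, _)"] by (intro onorm_le) (simp add: norm_Pair)
    qed
    then show "dist (g (z, x)) (g (z, y)) \<le> M * dist x y" by (simp add: dist_norm)
  qed
  then show ?thesis by blast
qed

lemma moderate_on_compact_range:
  assumes "\<forall>\<^sub>F \<epsilon> in at_right 0. f \<epsilon> ` K \<subseteq> L" "compact L"
  shows "moderate_on K f"
proof -
  obtain C where C: "\<forall>x\<in>L. norm x \<le> C" using compact_imp_bounded[OF assms(2)] unfolding bounded_iff by auto
  show ?thesis
    by (rule moderate_on_bounded[where C = C], rule eventually_mono[OF assms(1)]) (use C in auto)
qed

text \<open>If \<open>y\<close> is moderate up to order \<open>k\<close>, then so are the coefficients of its linearized equation, being compositions of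
  derivatives of \<open>g\<close> with \<open>(z, y z)\<close>, and \<open>linear_ode_moderate\<close> applies to the derivatives of \<open>y\<close>.\<close>

lemma ode_moderate:
  fixes y :: "('p::euclidean_space \<times> real, 'e::euclidean_space) net"
  assumes P: "open P" and e: "e > 0" and cd: "c < c'" "d' < d"
    and s: "\<And>\<epsilon>. \<epsilon> \<in> {0<..e} \<Longrightarrow> s \<epsilon> \<in> {c'..d'}"
    and U: "open U" and g: "\<And>k. moderate_upto k e ((P \<times> {c<..<d}) \<times> U) g"
    and X: "\<And>\<epsilon>. \<epsilon> \<in> {0<..e} \<Longrightarrow> compact (X \<epsilon>)" "\<And>\<epsilon>. \<epsilon> \<in> {0<..e} \<Longrightarrow> convex (X \<epsilon>)"
      "\<And>\<epsilon>. \<epsilon> \<in> {0<..e} \<Longrightarrow> X \<epsilon> \<subseteq> U"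
    and deriv: "\<And>\<epsilon> p r. \<epsilon> \<in> {0<..e} \<Longrightarrow> p \<in> P \<Longrightarrow> r \<in> {c<..<d} \<Longrightarrow>
      ((\<lambda>t. y \<epsilon> (p, t)) has_vector_derivative g \<epsilon> ((p, r), y \<epsilon> (p, r))) (at r)"
    and init: "\<And>\<epsilon> p. \<epsilon> \<in> {0<..e} \<Longrightarrow> p \<in> P \<Longrightarrow> y \<epsilon> (p, s \<epsilon>) = \<xi> \<epsilon>"
    and range: "\<And>\<epsilon> p r. \<epsilon> \<in> {0<..e} \<Longrightarrow> p \<in> P \<Longrightarrow> r \<in> {c<..<d} \<Longrightarrow> y \<epsilon> (p, r) \<in> X \<epsilon>"
    and cpt: "compactly_maps (P \<times> {c<..<d}) U y"
    and log: "\<And>K. K \<subset>\<subset> P \<times> {c<..<d} \<Longrightarrow> \<exists>C. \<forall>\<^sub>F \<epsilon> in at_right 0. \<forall>z\<in>K. \<forall>x.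
      norm (frechet_derivative (g \<epsilon>) (at (z, y \<epsilon> z)) (0, x)) \<le> C * \<bar>ln \<epsilon>\<bar> * norm x"
  shows "moderate_upto k e (P \<times> {c<..<d}) y"
proof (induction k)
  let ?J = "{c<..<d}"
  have op: "open (P \<times> ?J)" "open ((P \<times> ?J) \<times> U)" using P U by (auto intro!: open_Times)
  have sJ: "s \<epsilon> \<in> ?J" if "\<epsilon> \<in> {0<..e}" for \<epsilon> using s[OF that] cd by auto
  have C1: "C1_on ((P \<times> ?J) \<times> U) (g \<epsilon>)" if "\<epsilon> \<in> {0<..e}" for \<epsilon>
    by (rule moderate_upto_C1_on[OF g that])
  have lip: "\<exists>k. \<forall>z\<in>K. k-lipschitz_on (X \<epsilon>) (\<lambda>x. g \<epsilon> (z, x))"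
    if "\<epsilon> \<in> {0<..e}" "compact K" "K \<subseteq> P \<times> ?J" for \<epsilon> K
    by (rule C1_on_lipschitz_second[OF C1[OF that(1)] that(2,3) X[OF that(1)]])
  have mod: "locally_moderate (P \<times> ?J) y"
    unfolding locally_moderate_def
  proof (intro allI impI)
    fix K assume "K \<subset>\<subset> P \<times> ?J"
    then obtain L where "L \<subset>\<subset> U" "\<forall>\<^sub>F \<epsilon> in at_right 0. y \<epsilon> ` K \<subseteq> L"
      using cpt unfolding compactly_maps_def by blast
    then show "moderate_on K y" using moderate_on_compact_range cpt_insideD(1) by blast
  qed
  {
    case 0
    have "continuous_on (P \<times> ?J) (y \<epsilon>)" if \<epsilon>: "\<epsilon> \<in> {0<..e}" for \<epsilon>
    proof (rule ode_continuous_parameter[OF P sJ[OF \<epsilon>] deriv[OF \<epsilon>] init[OF \<epsilon>] range[OF \<epsilon>] _ lip[OF \<epsilon>]])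
      show "continuous_on ((P \<times> ?J) \<times> X \<epsilon>) (g \<epsilon>)"
        by (rule continuous_on_subset[OF moderate_upto_continuous[OF g \<epsilon>]]) (use X(3)[OF \<epsilon>] in auto)
    qed
    then show ?case using mod by simp
  next
    case (Suc k)
    define zy where "zy \<epsilon> z = (z, y \<epsilon> z)" for \<epsilon> z
    have zy: "moderate_upto k e (P \<times> ?J) zy"
      unfolding zy_def
      by (rule moderate_upto_Pair[OF op(1) e moderate_upto_id_linear[OF bounded_linear_ident op(1) e] Suc.IH])
    have zy_in: "zy \<epsilon> z \<in> (P \<times> ?J) \<times> U" if "\<epsilon> \<in> {0<..e}" "z \<in> P \<times> ?J" for \<epsilon> z
      using range[OF that(1), of "fst z" "snd z"] that X(3)[OF that(1)] by (auto simp: zy_def)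
    have zy_maps: "compactly_maps (P \<times> ?J) ((P \<times> ?J) \<times> U) zy"
      unfolding compactly_maps_def
    proof (intro allI impI)
      fix K assume K: "K \<subset>\<subset> P \<times> ?J"
      then obtain L where L: "L \<subset>\<subset> U" "\<forall>\<^sub>F \<epsilon> in at_right 0. y \<epsilon> ` K \<subseteq> L"
        using cpt unfolding compactly_maps_def by blast
      have "K \<times> L \<subset>\<subset> (P \<times> ?J) \<times> U"
        by (rule cpt_insideI[OF compact_Times Sigma_mono op(2)])
          (use cpt_insideD[OF K] cpt_insideD[OF L(1)] in auto)
      moreover from L(2) have "\<forall>\<^sub>F \<epsilon> in at_right 0. zy \<epsilon> ` K \<subseteq> K \<times> L"
        by eventually_elim (auto simp: zy_def)
      ultimately show "\<exists>L. L \<subset>\<subset> (P \<times> ?J) \<times> U \<and> (\<forall>\<^sub>F \<epsilon> in at_right 0. zy \<epsilon> ` K \<subseteq> L)" by blast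
    qed
    have comp: "moderate_upto k e (P \<times> ?J) (\<lambda>\<epsilon> z. f \<epsilon> (zy \<epsilon> z))"
      if "moderate_upto k e ((P \<times> ?J) \<times> U) f" for f :: "(('p \<times> real) \<times> 'e, 'e) net"
      by (rule moderate_upto_compose[OF op(1) e op(2) that zy zy_in zy_maps])
    define A where "A j \<epsilon> z = frechet_derivative (g \<epsilon>) (at (zy \<epsilon> z)) (0, j)" for j \<epsilon> z
    define B where "B i \<epsilon> z = frechet_derivative (g \<epsilon>) (at (zy \<epsilon> z)) ((i, 0), 0)" for i \<epsilon> z
    have A: "moderate_upto k e (P \<times> ?J) (A j)" if "j \<in> Basis" for j
      unfolding A_def
      by (rule comp[OF moderate_upto_derivative[OF g]]) (use that in \<open>simp add: Basis_prod_def\<close>)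
    have B: "moderate_upto k e (P \<times> ?J) (B i)" if "i \<in> Basis" for i
      unfolding B_def
      by (rule comp[OF moderate_upto_derivative[OF g]]) (use that in \<open>simp add: Basis_prod_def\<close>)
    have log': "\<exists>C. \<forall>\<^sub>F \<epsilon> in at_right 0. \<forall>z\<in>K. \<forall>x.
        norm (\<Sum>j\<in>Basis. (x \<bullet> j) *\<^sub>R A j \<epsilon> z) \<le> C * \<bar>ln \<epsilon>\<bar> * norm x" if K: "K \<subset>\<subset> P \<times> ?J" for K
    proof -
      obtain C where "\<forall>\<^sub>F \<epsilon> in at_right 0. \<forall>z\<in>K. \<forall>x.
          norm (frechet_derivative (g \<epsilon>) (at (z, y \<epsilon> z)) (0, x)) \<le> C * \<bar>ln \<epsilon>\<bar> * norm x"
        using log[OF K] by blast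
      with eventually_at_right_0_Ioc[OF e] have "\<forall>\<^sub>F \<epsilon> in at_right 0. \<forall>z\<in>K. \<forall>x.
          norm (\<Sum>j\<in>Basis. (x \<bullet> j) *\<^sub>R A j \<epsilon> z) \<le> C * \<bar>ln \<epsilon>\<bar> * norm x"
      proof eventually_elim
        case (elim \<epsilon>)
        show ?case
        proof (intro ballI allI)
          fix z x assume z: "z \<in> K"
          then have zJ: "z \<in> P \<times> ?J" using cpt_insideD(2)[OF K] by auto
          have "linear (frechet_derivative (g \<epsilon>) (at (zy \<epsilon> z)))"
            by (rule has_derivative_linear[OF C1_on_has_derivative[OF C1[OF elim(1)] zy_in[OF elim(1) zJ]]])
          then have "linear (\<lambda>v. frechet_derivative (g \<epsilon>) (at (zy \<epsilon> z)) (0, v))"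
            using linear_compose[of "\<lambda>v. (0, v)" "frechet_derivative (g \<epsilon>) (at (zy \<epsilon> z))"]
            by (simp add: o_def linear_iff)
          from linear_sum_Basis[OF this, of x]
          have eq: "(\<Sum>j\<in>Basis. (x \<bullet> j) *\<^sub>R A j \<epsilon> z) = frechet_derivative (g \<epsilon>) (at (z, y \<epsilon> z)) (0, x)"
            unfolding A_def zy_def by (rule sym)
          show "norm (\<Sum>j\<in>Basis. (x \<bullet> j) *\<^sub>R A j \<epsilon> z) \<le> C * \<bar>ln \<epsilon>\<bar> * norm x"
            unfolding eq using elim(2) z by blast
        qed
      qed
      then show ?thesis by blast
    qed
    show ?case
    proof (rule moderate_upto_Suc_ode[OF P e sJ deriv init range U X(3) C1 lip, where A = A and B = B])
      show "frechet_derivative (g \<epsilon>) (at (z, y \<epsilon> z)) (0, j) = A j \<epsilon> z" for \<epsilon> j z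
        by (simp add: A_def zy_def)
      show "frechet_derivative (g \<epsilon>) (at (z, y \<epsilon> z)) ((i, 0), 0) = B i \<epsilon> z" for \<epsilon> i z
        by (simp add: B_def zy_def)
      show "moderate_upto k e (P \<times> ?J) (\<lambda>\<epsilon> z. g \<epsilon> (z, y \<epsilon> z))"
        using comp[OF g[of k]] by (simp add: zy_def)
      show "moderate_upto k e (P \<times> ?J) w" if "i \<in> Basis"
        "\<And>\<epsilon>. \<epsilon> \<in> {0<..e} \<Longrightarrow> linear_ode_solution P ?J (s \<epsilon>) (\<lambda>j. A j \<epsilon>) (B i \<epsilon>) (w \<epsilon>)" for i w
        by (rule linear_ode_moderate[OF P e cd s A log' B[OF that(1)] that(2)])
    qed (use A B mod in auto)
  }
qed

section \<open>Negligibility from the values alone\<close>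

lemma cpt_inside_tube:
  fixes K :: "'a::euclidean_space set"
  assumes "K \<subset>\<subset> U" "open U"
  obtains r where "r > 0" "(\<Union>x\<in>K. cball x r) \<subset>\<subset> U"
proof -
  obtain r where "r > 0" "(\<Union>x\<in>K. cball x r) \<subseteq> U"
    using compact_subset_open_imp_cball_epsilon_subset[OF cpt_insideD(1)[OF assms(1)] assms(2) cpt_insideD(2)[OF assms(1)]]
    by blast
  then show ?thesis
    using that cpt_insideI[OF compact_Union_cball[OF cpt_insideD(1)[OF assms(1)]] _ assms(2)] by blast
qed

text \<open>By Taylor's formula \<open>h \<partial>\<^sub>b f (x)\<close> equals \<open>f (x + h b) - f x\<close> up to \<open>h\<^sup>2\<close> times the moderate second derivative.
  A step \<open>h\<close> that is a high power of \<open>\<epsilon>\<close> makes the remainder, divided by \<open>h\<close>, as small as desired, and the values of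
  \<open>f\<close> are smaller than any power times \<open>h\<close>.\<close>

lemma locally_negligible_derivative:
  fixes f :: "('a::euclidean_space, 'b::euclidean_space) net"
  assumes U: "open U" and e: "e > 0" and f: "moderate_upto (Suc (Suc 0)) e U f"
    and negl: "locally_negligible U f" and b: "b \<in> Basis"
  shows "locally_negligible U (\<lambda>\<epsilon> x. frechet_derivative (f \<epsilon>) (at x) b)"
  unfolding locally_negligible_def negligible_on_def
proof (intro allI impI)
  fix K and m :: nat assume K: "K \<subset>\<subset> U"
  define g where "g \<epsilon> x = frechet_derivative (f \<epsilon>) (at x) b" for \<epsilon> x
  define gg where "gg \<epsilon> x = frechet_derivative (g \<epsilon>) (at x) b" for \<epsilon> x
  have g1: "moderate_upto (Suc 0) e U g" unfolding g_def by (rule moderate_upto_derivative[OF f b])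
  then have gg: "locally_moderate U gg"
    unfolding gg_def by (rule moderate_upto_moderate[OF moderate_upto_derivative[OF _ b]])
  obtain r where r: "r > 0" "(\<Union>x\<in>K. cball x r) \<subset>\<subset> U" using cpt_inside_tube[OF K U] .
  define K1 where "K1 = (\<Union>x\<in>K. cball x r)"
  have K1: "K1 \<subset>\<subset> U" "K1 \<subseteq> U" using r cpt_insideD(2) by (auto simp: K1_def)
  obtain N where N: "\<forall>\<^sub>F \<epsilon> in at_right 0. \<forall>x\<in>K1. norm (gg \<epsilon> x) \<le> (1 / \<epsilon>) ^ N"
    using gg K1 unfolding locally_moderate_def moderate_on_def by blast
  (* The step is \<epsilon> ^ n; multiplied by the bound (1 / \<epsilon>) ^ N of the second derivative it leaves \<epsilon> ^ (m + 2). *)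
  define n where "n = Suc (N + Suc m)"
  have M: "\<forall>\<^sub>F \<epsilon> in at_right 0. \<forall>x\<in>K1. norm (f \<epsilon> x) \<le> \<epsilon> ^ (n + Suc m)"
    using negl K1 unfolding locally_negligible_def negligible_on_def by blast
  (* The factor 3 from the three terms below is absorbed by \<epsilon> \<le> 1/3. *)
  have "min r (1/3) > 0" using r by simp
  from N M eventually_at_right_0_Ioc[OF this] eventually_at_right_0_Ioc[OF e]
  show "\<forall>\<^sub>F \<epsilon> in at_right 0. \<forall>x\<in>K. norm (frechet_derivative (f \<epsilon>) (at x) b) \<le> \<epsilon> ^ m"
  proof eventually_elim
    case (elim \<epsilon>)
    have \<epsilon>: "0 < \<epsilon>" "\<epsilon> \<le> r" "\<epsilon> \<le> 1/3" using elim by auto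
    define h where "h = \<epsilon> ^ n"
    have h: "h > 0" "h \<le> r"
      using \<epsilon> power_decreasing[of 1 n \<epsilon>] by (auto simp: h_def n_def simp del: power_Suc)
    show ?case
    proof
      fix x assume x: "x \<in> K"
      have line: "x + s *\<^sub>R b \<in> K1" if "s \<in> {0..h}" for s
      proof -
        have "x + s *\<^sub>R b \<in> cball x r" using that h b by (simp add: dist_norm)
        then show ?thesis unfolding K1_def using x by blast
      qed
      have dline: "((\<lambda>s. F (x + s *\<^sub>R b)) has_vector_derivative F' (x + s *\<^sub>R b)) (at s within {0..h})"
        if F: "\<And>z. z \<in> K1 \<Longrightarrow> (F has_derivative D z) (at z)" "\<And>z. z \<in> K1 \<Longrightarrow> D z b = F' z" and s: "s \<in> {0..h}"
        for F F' :: "'a \<Rightarrow> 'b" and D s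
      proof -
        have "((\<lambda>s. x + s *\<^sub>R b) has_derivative (\<lambda>t. t *\<^sub>R b)) (at s within {0..h})"
          by (auto intro!: derivative_eq_intros)
        from has_derivative_compose[OF this F(1)[OF line[OF s]]]
        have "((\<lambda>s. F (x + s *\<^sub>R b)) has_derivative (\<lambda>t. D (x + s *\<^sub>R b) (t *\<^sub>R b))) (at s within {0..h})" .
        then show ?thesis
          using linear_cmul[OF has_derivative_linear[OF F(1)[OF line[OF s]]]] F(2)[OF line[OF s]]
          by (simp add: has_vector_derivative_def)
      qed
      have df: "((\<lambda>s. f \<epsilon> (x + s *\<^sub>R b)) has_vector_derivative g \<epsilon> (x + s *\<^sub>R b)) (at s within {0..h})"
        if "s \<in> {0..h}" for s
        by (rule dline[where D = "\<lambda>z. frechet_derivative (f \<epsilon>) (at z)"])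
          (use moderate_upto_has_derivative[OF f elim(4)] K1(2) that in \<open>auto simp: g_def\<close>)
      have dg: "((\<lambda>s. g \<epsilon> (x + s *\<^sub>R b)) has_vector_derivative gg \<epsilon> (x + s *\<^sub>R b)) (at s within {0..h})"
        if "s \<in> {0..h}" for s
        by (rule dline[where D = "\<lambda>z. frechet_derivative (g \<epsilon>) (at z)"])
          (use moderate_upto_has_derivative[OF g1 elim(4)] K1(2) that in \<open>auto simp: gg_def\<close>)
      let ?B = "(1 / \<epsilon>) ^ N"
      have g_diff: "norm (g \<epsilon> (x + s *\<^sub>R b) - g \<epsilon> (x + 0 *\<^sub>R b)) \<le> ?B * \<bar>s - 0\<bar> ^ Suc 0 / real (Suc 0)"
        if s: "s \<in> {0..h}" for s
        using h elim(1) line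
        by (intro power_bound_integrated[where c = 0 and d = h and n = 0 and f' = "\<lambda>s. gg \<epsilon> (x + s *\<^sub>R b)"] s dg) auto
      have "norm ((f \<epsilon> (x + h *\<^sub>R b) - h *\<^sub>R g \<epsilon> x) - (f \<epsilon> (x + 0 *\<^sub>R b) - 0 *\<^sub>R g \<epsilon> x))
          \<le> ?B * \<bar>h - 0\<bar> ^ Suc 1 / real (Suc 1)"
      proof (rule power_bound_integrated[where c = 0 and d = h and f' = "\<lambda>s. g \<epsilon> (x + s *\<^sub>R b) - g \<epsilon> x"])
        show "((\<lambda>s. f \<epsilon> (x + s *\<^sub>R b) - s *\<^sub>R g \<epsilon> x) has_vector_derivative g \<epsilon> (x + s *\<^sub>R b) - g \<epsilon> x) (at s within {0..h})"
          if "s \<in> {0..h}" for s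
          by (intro has_vector_derivative_diff df that) (auto intro!: derivative_eq_intros)
        show "norm (g \<epsilon> (x + s *\<^sub>R b) - g \<epsilon> x) \<le> ?B * \<bar>s - 0\<bar> ^ 1" if "s \<in> {0..h}" for s
          using g_diff[OF that] by simp
      qed (use h in auto)
      also have "\<dots> \<le> ?B * h\<^sup>2" using h \<epsilon> by (simp add: power2_eq_square)
      finally have T: "norm (f \<epsilon> (x + h *\<^sub>R b) - h *\<^sub>R g \<epsilon> x - f \<epsilon> x) \<le> ?B * h\<^sup>2" by simp
      have F: "norm (f \<epsilon> (x + h *\<^sub>R b)) \<le> \<epsilon> ^ (n + Suc m)" "norm (f \<epsilon> x) \<le> \<epsilon> ^ (n + Suc m)"
        using elim(2) line[of h] line[of 0] h by auto
      have "h * norm (g \<epsilon> x) = norm (f \<epsilon> (x + h *\<^sub>R b) - f \<epsilon> x - (f \<epsilon> (x + h *\<^sub>R b) - h *\<^sub>R g \<epsilon> x - f \<epsilon> x))"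
        using h by simp
      also have "\<dots> \<le> norm (f \<epsilon> (x + h *\<^sub>R b)) + norm (f \<epsilon> x) + norm (f \<epsilon> (x + h *\<^sub>R b) - h *\<^sub>R g \<epsilon> x - f \<epsilon> x)"
        by (intro order_trans[OF norm_triangle_ineq4] add_right_mono norm_triangle_ineq4)
      also have "\<dots> \<le> \<epsilon> ^ (n + Suc m) + \<epsilon> ^ (n + Suc m) + ?B * h\<^sup>2" using F T by (intro add_mono)
      also have "?B * h\<^sup>2 = h * ((1 / \<epsilon>) ^ N * (\<epsilon> ^ N * \<epsilon> ^ Suc (Suc m)))"
        by (simp add: h_def n_def power2_eq_square power_add)
      also have "(1 / \<epsilon>) ^ N * (\<epsilon> ^ N * \<epsilon> ^ Suc (Suc m)) = \<epsilon> ^ Suc (Suc m)"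
        using \<epsilon> by (simp add: power_one_over)
      also have "\<epsilon> ^ (n + Suc m) = h * \<epsilon> ^ Suc m" by (simp add: h_def power_add)
      finally have "h * norm (g \<epsilon> x) \<le> h * (2 * \<epsilon> ^ Suc m + \<epsilon> ^ Suc (Suc m))" by (simp add: algebra_simps)
      then have "norm (g \<epsilon> x) \<le> 2 * \<epsilon> ^ Suc m + \<epsilon> ^ Suc (Suc m)" using h by simp
      also have "\<dots> \<le> 3 * \<epsilon> ^ Suc m" using power_decreasing[of "Suc m" "Suc (Suc m)" \<epsilon>] \<epsilon> by simp
      also have "\<dots> \<le> \<epsilon> ^ m" using \<epsilon> mult_right_mono[of "3 * \<epsilon>" 1 "\<epsilon> ^ m"] by simp
      finally show "norm (frechet_derivative (f \<epsilon>) (at x) b) \<le> \<epsilon> ^ m" by (simp add: g_def)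
    qed
  qed
qed

lemma negligible_netsD: "u \<in> negligible_nets U \<Longrightarrow> locally_negligible U u"
proof -
  assume u: "u \<in> negligible_nets U"
  show ?thesis unfolding locally_negligible_def
  proof (intro allI impI)
    fix K assume "K \<subset>\<subset> U"
    then have "\<forall>m::nat. sup_bigo K (\<lambda>\<epsilon>. iter_pderiv [] (u \<epsilon>)) (\<lambda>\<epsilon>. \<epsilon> ^ m)"
      using u unfolding negligible_nets_def by blast
    then show "negligible_on K u" by (simp add: negligible_on_iff)
  qed
qed

lemma moderate_negligible_nets:
  assumes U: "open U" and u: "u \<in> moderate_nets U" and negl: "locally_negligible U u"
  shows "u \<in> negligible_nets U"
proof -
  have "locally_negligible U (\<lambda>\<epsilon>. iter_pderiv bs (u \<epsilon>))" if "bs \<in> lists Basis" for bs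
    using that
  proof (induction bs)
    case (Cons b bs)
    have "moderate_upto (Suc (Suc 0)) 1 U (\<lambda>\<epsilon>. iter_pderiv bs (u \<epsilon>))"
      by (rule moderate_upto_iter_pderiv) (use Cons u in \<open>auto simp: moderate_nets_iff\<close>)
    then have "locally_negligible U (\<lambda>\<epsilon> x. frechet_derivative (iter_pderiv bs (u \<epsilon>)) (at x) b)"
      by (rule locally_negligible_derivative[OF U zero_less_one]) (use Cons in auto)
    then show ?case by simp
  qed (simp add: negl)
  then have "sup_bigo K (\<lambda>\<epsilon>. iter_pderiv bs (u \<epsilon>)) (\<lambda>\<epsilon>. \<epsilon> ^ m)"
    if "K \<subset>\<subset> U" "bs \<in> lists Basis" for K bs and m :: nat
    using that negligible_on_iff[of K "\<lambda>\<epsilon>. iter_pderiv bs (u \<epsilon>)"] unfolding locally_negligible_def by blast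
  then show ?thesis using u by (simp add: negligible_nets_def moderate_nets_def)
qed

lemma negligible_on_add:
  assumes "negligible_on K f" "negligible_on K g"
  shows "negligible_on K (\<lambda>\<epsilon> x. f \<epsilon> x + g \<epsilon> x)"
proof (rule negligible_onI)
  fix m
  have "\<forall>\<^sub>F \<epsilon> in at_right 0. \<forall>x\<in>K. norm (f \<epsilon> x) \<le> \<epsilon> ^ m" "\<forall>\<^sub>F \<epsilon> in at_right 0. \<forall>x\<in>K. norm (g \<epsilon> x) \<le> \<epsilon> ^ m"
    using assms unfolding negligible_on_def by blast+
  then have "\<forall>\<^sub>F \<epsilon> in at_right 0. \<forall>x\<in>K. norm (f \<epsilon> x + g \<epsilon> x) \<le> 2 * \<epsilon> ^ m"
    unfolding mult_2 by eventually_elim (blast intro: norm_triangle_mono)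
  then show "\<exists>C. \<forall>\<^sub>F \<epsilon> in at_right 0. \<forall>x\<in>K. norm (f \<epsilon> x + g \<epsilon> x) \<le> C * \<epsilon> ^ m" by blast
qed

lemma locally_negligible_add:
  "locally_negligible U f \<Longrightarrow> locally_negligible U g \<Longrightarrow> locally_negligible U (\<lambda>\<epsilon> x. f \<epsilon> x + g \<epsilon> x)"
  unfolding locally_negligible_def using negligible_on_add by blast

lemma locally_negligible_cong:
  assumes "locally_negligible U f"
    and "\<And>K. K \<subset>\<subset> U \<Longrightarrow> \<forall>\<^sub>F \<epsilon> in at_right 0. \<forall>x\<in>K. norm (g \<epsilon> x) \<le> norm (f \<epsilon> x)"
  shows "locally_negligible U g"
  unfolding locally_negligible_def negligible_on_def
proof (intro allI impI)
  fix K and m :: nat assume K: "K \<subset>\<subset> U"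
  have "\<forall>\<^sub>F \<epsilon> in at_right 0. \<forall>x\<in>K. norm (f \<epsilon> x) \<le> \<epsilon> ^ m"
    using assms(1) K unfolding locally_negligible_def negligible_on_def by blast
  with assms(2)[OF K] show "\<forall>\<^sub>F \<epsilon> in at_right 0. \<forall>x\<in>K. norm (g \<epsilon> x) \<le> \<epsilon> ^ m"
    by eventually_elim force
qed

lemma locally_negligible_trans:
  assumes "locally_negligible U (\<lambda>\<epsilon> x. f \<epsilon> x - g \<epsilon> x)" "locally_negligible U (\<lambda>\<epsilon> x. g \<epsilon> x - h \<epsilon> x)"
  shows "locally_negligible U (\<lambda>\<epsilon> x. f \<epsilon> x - h \<epsilon> x)"
  using locally_negligible_add[OF assms] by simp

lemma locally_negligible_zero: 
  assumes "\<And>K. K \<subset>\<subset> U \<Longrightarrow> \<forall>\<^sub>F \<epsilon> in at_right 0. \<forall>x\<in>K. f \<epsilon> x = 0"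
  shows "locally_negligible U f"
proof -
  have "locally_negligible U (\<lambda>\<epsilon> x. 0 :: 'b)"
    unfolding locally_negligible_def by (intro allI impI negligible_onI exI[of _ 0]) simp
  then show ?thesis
    by (rule locally_negligible_cong) (use assms in \<open>auto elim: eventually_mono\<close>)
qed

lemma moderate_upto_operator_bound:
  assumes "moderate_upto (Suc k) e U f" "e > 0" "K \<subset>\<subset> U"
  shows "\<exists>N. \<forall>\<^sub>F \<epsilon> in at_right 0. \<forall>x\<in>K. \<forall>h. norm (frechet_derivative (f \<epsilon>) (at x) h) \<le> (1 / \<epsilon>) ^ N * norm h"
proof -
  have "moderate_on K (\<lambda>\<epsilon> x. \<Sum>b\<in>Basis. norm (frechet_derivative (f \<epsilon>) (at x) b))"
    (is "moderate_on K (\<lambda>\<epsilon> x. \<Sum>b\<in>Basis. ?d b \<epsilon> x)")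
  proof -
    have "moderate_on K (\<lambda>\<epsilon> x. \<Sum>b\<in>B. ?d b \<epsilon> x)" if "B \<subseteq> Basis" for B
      using finite_subset[OF that finite_Basis] that
    proof (induction B rule: finite_induct)
      case empty
      show ?case by (rule moderate_on_bounded[where C = 0]) simp
    next
      case (insert b B)
      have "moderate_on K (\<lambda>\<epsilon> x. frechet_derivative (f \<epsilon>) (at x) b)"
        using moderate_upto_moderate[OF moderate_upto_derivative[OF assms(1)]] insert.prems assms(3)
        by (auto simp: locally_moderate_def)
      then have "moderate_on K (?d b)" by (rule moderate_on_dominated) simp
      then have "moderate_on K (\<lambda>\<epsilon> x. ?d b \<epsilon> x + (\<Sum>b\<in>B. ?d b \<epsilon> x))"
        by (rule moderate_on_add) (use insert in auto)
      then show ?case using insert.hyps by simp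
    qed
    then show ?thesis by blast
  qed
  then obtain N where "\<forall>\<^sub>F \<epsilon> in at_right 0. \<forall>x\<in>K. norm (\<Sum>b\<in>Basis. ?d b \<epsilon> x) \<le> (1 / \<epsilon>) ^ N"
    unfolding moderate_on_def by blast
  with eventually_at_right_0_Ioc[OF assms(2)]
  have "\<forall>\<^sub>F \<epsilon> in at_right 0. \<forall>x\<in>K. \<forall>h. norm (frechet_derivative (f \<epsilon>) (at x) h) \<le> (1 / \<epsilon>) ^ N * norm h"
  proof eventually_elim
    case (elim \<epsilon>)
    show ?case
    proof (intro ballI allI)
      fix x h assume x: "x \<in> K"
      then have "x \<in> U" using cpt_insideD(2)[OF assms(3)] by auto
      then have lin: "linear (frechet_derivative (f \<epsilon>) (at x))"
        using moderate_upto_has_derivative[OF assms(1) elim(1)] has_derivative_linear by blast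
      have "norm (frechet_derivative (f \<epsilon>) (at x) h) = norm (\<Sum>b\<in>Basis. (h \<bullet> b) *\<^sub>R frechet_derivative (f \<epsilon>) (at x) b)"
        by (rule arg_cong[OF linear_sum_Basis[OF lin]])
      also have "\<dots> \<le> (\<Sum>b\<in>Basis. norm h * ?d b \<epsilon> x)"
      proof (rule sum_norm_le)
        fix b :: 'a assume "b \<in> Basis"
        then show "norm ((h \<bullet> b) *\<^sub>R frechet_derivative (f \<epsilon>) (at x) b) \<le> norm h * ?d b \<epsilon> x"
          using mult_right_mono[OF Basis_le_norm[of b h] norm_ge_zero] by simp
      qed
      also have "\<dots> = norm h * (\<Sum>b\<in>Basis. ?d b \<epsilon> x)" by (simp only: sum_distrib_left)
      also have "\<dots> \<le> norm h * (1 / \<epsilon>) ^ N"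
        using elim(2) x by (intro mult_left_mono) (auto simp: sum_nonneg)
      finally show "norm (frechet_derivative (f \<epsilon>) (at x) h) \<le> (1 / \<epsilon>) ^ N * norm h" by (simp add: mult.commute)
    qed
  qed
  then show ?thesis by blast
qed

lemma compactly_maps_common:
  assumes "compactly_maps U V f" "compactly_maps U V g" "open V" "K \<subset>\<subset> U"
  obtains L where "L \<subset>\<subset> V" "\<forall>\<^sub>F \<epsilon> in at_right 0. f \<epsilon> ` K \<subseteq> L \<and> g \<epsilon> ` K \<subseteq> L"
proof -
  obtain L1 L2 where L: "L1 \<subset>\<subset> V" "\<forall>\<^sub>F \<epsilon> in at_right 0. f \<epsilon> ` K \<subseteq> L1"
    "L2 \<subset>\<subset> V" "\<forall>\<^sub>F \<epsilon> in at_right 0. g \<epsilon> ` K \<subseteq> L2"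
    using assms unfolding compactly_maps_def by metis
  have "L1 \<union> L2 \<subset>\<subset> V"
    using L cpt_insideD by (intro cpt_insideI compact_Un assms(3)) blast+
  moreover have "\<forall>\<^sub>F \<epsilon> in at_right 0. f \<epsilon> ` K \<subseteq> L1 \<union> L2 \<and> g \<epsilon> ` K \<subseteq> L1 \<union> L2"
    using L(2,4) by eventually_elim auto
  ultimately show ?thesis by (rule that)
qed

text \<open>The values of \<open>f\<close> and \<open>g\<close> lie in a compact subset of \<open>V\<close> and become closer than its distance to the complement of \<open>V\<close>, so
  the segments between them stay in a larger compact subset, although \<open>V\<close> need not be convex.\<close>

lemma locally_negligible_compose:
  assumes V: "open V" and v: "moderate_upto (Suc k) e V v" and e: "e > 0"
    and vv: "locally_negligible V (\<lambda>\<epsilon> y. v' \<epsilon> y - v \<epsilon> y)"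
    and maps: "compactly_maps U V f" "compactly_maps U V g"
    and fg: "locally_negligible U (\<lambda>\<epsilon> x. f \<epsilon> x - g \<epsilon> x)"
  shows "locally_negligible U (\<lambda>\<epsilon> x. v' \<epsilon> (f \<epsilon> x) - v \<epsilon> (g \<epsilon> x))"
proof (rule locally_negligible_trans)
  show "locally_negligible U (\<lambda>\<epsilon> x. v' \<epsilon> (f \<epsilon> x) - v \<epsilon> (f \<epsilon> x))"
    unfolding locally_negligible_def negligible_on_def
  proof (intro allI impI)
    fix K and m :: nat assume "K \<subset>\<subset> U"
    then obtain L where L: "L \<subset>\<subset> V" "\<forall>\<^sub>F \<epsilon> in at_right 0. f \<epsilon> ` K \<subseteq> L"
      using maps(1) unfolding compactly_maps_def by blast
    have "\<forall>\<^sub>F \<epsilon> in at_right 0. \<forall>y\<in>L. norm (v' \<epsilon> y - v \<epsilon> y) \<le> \<epsilon> ^ m"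
      using vv L(1) unfolding locally_negligible_def negligible_on_def by blast
    with L(2) show "\<forall>\<^sub>F \<epsilon> in at_right 0. \<forall>x\<in>K. norm (v' \<epsilon> (f \<epsilon> x) - v \<epsilon> (f \<epsilon> x)) \<le> \<epsilon> ^ m"
      by eventually_elim auto
  qed
  show "locally_negligible U (\<lambda>\<epsilon> x. v \<epsilon> (f \<epsilon> x) - v \<epsilon> (g \<epsilon> x))"
    unfolding locally_negligible_def negligible_on_def
  proof (intro allI impI)
    fix K and m :: nat assume K: "K \<subset>\<subset> U"
    obtain L where L: "L \<subset>\<subset> V" "\<forall>\<^sub>F \<epsilon> in at_right 0. f \<epsilon> ` K \<subseteq> L \<and> g \<epsilon> ` K \<subseteq> L"
      by (rule compactly_maps_common[OF maps V K])
    obtain r where r: "r > 0" "(\<Union>x\<in>L. cball x r) \<subset>\<subset> V" by (rule cpt_inside_tube[OF L(1) V])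
    obtain N where N: "\<forall>\<^sub>F \<epsilon> in at_right 0. \<forall>x\<in>(\<Union>x\<in>L. cball x r). \<forall>h.
        norm (frechet_derivative (v \<epsilon>) (at x) h) \<le> (1 / \<epsilon>) ^ N * norm h"
      using moderate_upto_operator_bound[OF v e r(2)] by blast
    have D: "\<forall>\<^sub>F \<epsilon> in at_right 0. \<forall>x\<in>K. norm (f \<epsilon> x - g \<epsilon> x) \<le> \<epsilon> ^ (N + Suc m)"
      using fg K unfolding locally_negligible_def negligible_on_def by blast
    have "min r 1 > 0" using r by simp
    from L(2) N D eventually_at_right_0_Ioc[OF e] eventually_at_right_0_Ioc[OF this]
    show "\<forall>\<^sub>F \<epsilon> in at_right 0. \<forall>x\<in>K. norm (v \<epsilon> (f \<epsilon> x) - v \<epsilon> (g \<epsilon> x)) \<le> \<epsilon> ^ m"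
    proof eventually_elim
      case (elim \<epsilon>)
      have \<epsilon>: "0 < \<epsilon>" "\<epsilon> \<le> r" "\<epsilon> \<le> 1" using elim(5) by auto
      show ?case
      proof
        fix x assume x: "x \<in> K"
        have gL: "g \<epsilon> x \<in> L" using elim(1) x by auto
        then have ball: "cball (g \<epsilon> x) r \<subseteq> (\<Union>x\<in>L. cball x r)" by auto
        have d: "norm (f \<epsilon> x - g \<epsilon> x) \<le> \<epsilon> ^ (N + Suc m)" using elim(3) x by auto
        also have "\<dots> \<le> \<epsilon> ^ 1" using \<epsilon> by (intro power_decreasing) auto
        finally have "norm (f \<epsilon> x - g \<epsilon> x) \<le> r" using \<epsilon> by simp
        then have fb: "f \<epsilon> x \<in> cball (g \<epsilon> x) r" by (simp add: dist_norm norm_minus_commute)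
        have gb: "g \<epsilon> x \<in> cball (g \<epsilon> x) r" using r by simp
        have "norm (v \<epsilon> (f \<epsilon> x) - v \<epsilon> (g \<epsilon> x)) \<le> (1 / \<epsilon>) ^ N * norm (f \<epsilon> x - g \<epsilon> x)"
        proof (rule differentiable_bound[OF convex_cball _ _ fb gb])
          fix y assume y: "y \<in> cball (g \<epsilon> x) r"
          then have yV: "y \<in> V" using ball cpt_insideD(2)[OF r(2)] by blast
          show "(v \<epsilon> has_derivative frechet_derivative (v \<epsilon>) (at y)) (at y within cball (g \<epsilon> x) r)"
            by (rule has_derivative_at_withinI[OF moderate_upto_has_derivative[OF v elim(4) yV]])
          show "onorm (frechet_derivative (v \<epsilon>) (at y)) \<le> (1 / \<epsilon>) ^ N"
            using elim(2) ball y by (intro onorm_le) blast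
        qed
        also have "\<dots> \<le> (1 / \<epsilon>) ^ N * \<epsilon> ^ (N + Suc m)"
          using d \<epsilon> by (intro mult_left_mono) auto
        also have "\<dots> = \<epsilon> ^ Suc m" using \<epsilon> by (simp add: power_one_over power_add)
        also have "\<dots> \<le> \<epsilon> ^ m" using \<epsilon> by (intro power_decreasing) auto
        finally show "norm (v \<epsilon> (f \<epsilon> x) - v \<epsilon> (g \<epsilon> x)) \<le> \<epsilon> ^ m" .
      qed
    qed
  qed
qed

section \<open>Classes of generalized functions\<close>

text \<open>Nets to which the operations on classes are applied are smooth for small \<open>\<epsilon>\<close> only; \<open>colombeau_class\<close> disregards the other values of \<open>\<epsilon>\<close>.\<close>

definition eventually_moderate :: "'a::euclidean_space set \<Rightarrow> ('a, 'b::euclidean_space) net \<Rightarrow> bool" where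
  "eventually_moderate U w \<longleftrightarrow> (\<exists>e\<in>{0<..1}. \<forall>k. moderate_upto k e U w)"

lemma moderate_nets_eventually_moderate: "w \<in> moderate_nets U \<Longrightarrow> eventually_moderate U w"
  unfolding eventually_moderate_def moderate_nets_iff by (rule bexI[of _ 1]) auto

lemma moderate_upto_truncate:
  assumes U: "open U" and e: "0 < e" "e \<le> 1" and w: "moderate_upto k e U w"
  shows "moderate_upto k 1 U (\<lambda>\<epsilon> x. if \<epsilon> \<le> e then w \<epsilon> x else 0)"
  using w
proof (induction k arbitrary: w)
  have mod: "locally_moderate U (\<lambda>\<epsilon> x. if \<epsilon> \<le> e then w \<epsilon> x else 0)" if "locally_moderate U w"
    for w :: "('a, 'b) net"
    by (rule locally_moderate_cong[OF that e(1)]) simp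
  {
    case 0
    have "continuous_on U (\<lambda>x. if \<epsilon> \<le> e then w \<epsilon> x else 0)" if "\<epsilon> \<in> {0<..1}" for \<epsilon>
      using 0 that by (cases "\<epsilon> \<le> e") auto
    then show ?case using mod[of w] 0 by simp
  next
    case (Suc k)
    show ?case
    proof (rule moderate_upto_SucI[OF U zero_less_one mod[OF moderate_upto_moderate[OF Suc.prems]],
          where D = "\<lambda>\<epsilon> x h. if \<epsilon> \<le> e then frechet_derivative (w \<epsilon>) (at x) h else 0"])
      show "((\<lambda>x. if \<epsilon> \<le> e then w \<epsilon> x else 0) has_derivative
          (\<lambda>h. if \<epsilon> \<le> e then frechet_derivative (w \<epsilon>) (at x) h else 0)) (at x)"
        if "\<epsilon> \<in> {0<..1}" "x \<in> U" for \<epsilon> x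
        using moderate_upto_has_derivative[OF Suc.prems _ that(2), of \<epsilon>] that(1) by (cases "\<epsilon> \<le> e") auto
      show "moderate_upto k 1 U (\<lambda>\<epsilon> x. if \<epsilon> \<le> e then frechet_derivative (w \<epsilon>) (at x) b else 0)"
        if "b \<in> Basis" for b
        by (rule Suc.IH[OF moderate_upto_derivative[OF Suc.prems that]])
    qed
  }
qed

lemma eventually_moderate_representative:
  assumes "open U" "eventually_moderate U w"
  obtains w0 where "w0 \<in> moderate_nets U" "\<forall>\<^sub>F \<epsilon> in at_right 0. \<forall>x\<in>U. w0 \<epsilon> x = w \<epsilon> x"
proof -
  obtain e where e: "0 < e" "e \<le> 1" "\<And>k. moderate_upto k e U w"
    using assms(2) unfolding eventually_moderate_def by auto
  have "(\<lambda>\<epsilon> x. if \<epsilon> \<le> e then w \<epsilon> x else 0) \<in> moderate_nets U"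
    unfolding moderate_nets_iff using moderate_upto_truncate[OF assms(1) e(1,2) e(3)] by blast
  moreover have "\<forall>\<^sub>F \<epsilon> in at_right 0. \<forall>x\<in>U. (if \<epsilon> \<le> e then w \<epsilon> x else 0) = w \<epsilon> x"
    using eventually_at_right_0_Ioc[OF e(1)] by eventually_elim simp
  ultimately show ?thesis by (rule that)
qed

lemma colombeau_class_eventually_eq:
  assumes "\<forall>\<^sub>F \<epsilon> in at_right 0. \<forall>x\<in>U. w \<epsilon> x = w' \<epsilon> x"
  shows "colombeau_class U w = colombeau_class U w'"
proof -
  have "(\<forall>\<^sub>F \<epsilon> in at_right 0. \<forall>x\<in>U. v \<epsilon> x = w \<epsilon> x + z \<epsilon> x) \<longleftrightarrow>
      (\<forall>\<^sub>F \<epsilon> in at_right 0. \<forall>x\<in>U. v \<epsilon> x = w' \<epsilon> x + z \<epsilon> x)" for v z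
    by (rule eventually_subst, rule eventually_mono[OF assms]) simp
  then show ?thesis by (simp add: colombeau_class_def)
qed

lemma moderate_nets_diff_negligible_iff:
  assumes U: "open U" and u: "u \<in> moderate_nets U" and v: "v \<in> moderate_nets U"
  shows "(u, v) \<in> colombeau_rel U \<longleftrightarrow> locally_negligible U (\<lambda>\<epsilon> x. u \<epsilon> x - v \<epsilon> x)"
proof -
  have "(\<lambda>\<epsilon> x. u \<epsilon> x - v \<epsilon> x) \<in> moderate_nets U"
    unfolding moderate_nets_iff
  proof
    fix k
    have "moderate_upto k 1 U (\<lambda>\<epsilon> x. u \<epsilon> x + (- v \<epsilon> x))"
      by (rule moderate_upto_add[OF U zero_less_one _
            moderate_upto_linear[OF bounded_linear_minus[OF bounded_linear_ident] U zero_less_one]])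
        (use u v in \<open>auto simp: moderate_nets_iff\<close>)
    then show "moderate_upto k 1 U (\<lambda>\<epsilon> x. u \<epsilon> x - v \<epsilon> x)" by simp
  qed
  then show ?thesis
    using negligible_netsD moderate_negligible_nets[OF U] u v by (auto simp: colombeau_rel_def)
qed

text \<open>All questions about equality of classes are reduced to estimates of values, since the difference of moderate nets is moderate.\<close>

lemma colombeau_class_eq_iff:
  assumes U: "open U" and w: "eventually_moderate U w" and w': "eventually_moderate U w'"
  shows "colombeau_class U w = colombeau_class U w' \<longleftrightarrow> locally_negligible U (\<lambda>\<epsilon> x. w \<epsilon> x - w' \<epsilon> x)"
proof -
  obtain w0 where w0: "w0 \<in> moderate_nets U" "\<forall>\<^sub>F \<epsilon> in at_right 0. \<forall>x\<in>U. w0 \<epsilon> x = w \<epsilon> x"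
    using eventually_moderate_representative[OF U w] .
  obtain w1 where w1: "w1 \<in> moderate_nets U" "\<forall>\<^sub>F \<epsilon> in at_right 0. \<forall>x\<in>U. w1 \<epsilon> x = w' \<epsilon> x"
    using eventually_moderate_representative[OF U w'] .
  have "colombeau_class U w = colombeau_class U w' \<longleftrightarrow> colombeau_class U w0 = colombeau_class U w1"
    using colombeau_class_eventually_eq[OF w0(2)] colombeau_class_eventually_eq[OF w1(2)] by simp
  also have "\<dots> \<longleftrightarrow> (w0, w1) \<in> colombeau_rel U"
    unfolding colombeau_class_eq[OF U w0(1)] colombeau_class_eq[OF U w1(1)]
    by (rule eq_equiv_class_iff[OF equiv_colombeau_rel[OF U] w0(1) w1(1)])
  also have "\<dots> \<longleftrightarrow> locally_negligible U (\<lambda>\<epsilon> x. w0 \<epsilon> x - w1 \<epsilon> x)"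
    by (rule moderate_nets_diff_negligible_iff[OF U w0(1) w1(1)])
  also have "\<dots> \<longleftrightarrow> locally_negligible U (\<lambda>\<epsilon> x. w \<epsilon> x - w' \<epsilon> x)"
  proof -
    have "\<forall>\<^sub>F \<epsilon> in at_right 0. \<forall>x\<in>K. w0 \<epsilon> x - w1 \<epsilon> x = w \<epsilon> x - w' \<epsilon> x" if "K \<subset>\<subset> U" for K
      using w0(2) w1(2) by eventually_elim (use cpt_insideD(2)[OF that] in auto)
    note eq = this
    have le: "\<forall>\<^sub>F \<epsilon> in at_right 0. \<forall>x\<in>K. norm (w \<epsilon> x - w' \<epsilon> x) \<le> norm (w0 \<epsilon> x - w1 \<epsilon> x)"
      "\<forall>\<^sub>F \<epsilon> in at_right 0. \<forall>x\<in>K. norm (w0 \<epsilon> x - w1 \<epsilon> x) \<le> norm (w \<epsilon> x - w' \<epsilon> x)"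
      if "K \<subset>\<subset> U" for K
      using eq[OF that] by (eventually_elim, simp)+
    show ?thesis
      using locally_negligible_cong[OF _ le(1)] locally_negligible_cong[OF _ le(2)] by (rule iffI)
  qed
  finally show ?thesis .
qed

lemma colombeau_class_memI:
  assumes U: "open U" and u: "u \<in> moderate_nets U"
  shows "u \<in> colombeau_class U u" "colombeau_class U u \<in> colombeau U"
  using u equiv_class_self[OF equiv_colombeau_rel[OF U] u]
  by (simp_all add: colombeau_class_eq[OF U u] colombeau_def quotientI)

lemma colombeau_class_memD:
  assumes U: "open U" and w: "eventually_moderate U w" and u: "u \<in> colombeau_class U w"
  shows "u \<in> moderate_nets U" "locally_negligible U (\<lambda>\<epsilon> x. u \<epsilon> x - w \<epsilon> x)"
    "colombeau_class U u = colombeau_class U w"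
proof -
  obtain z where z: "z \<in> negligible_nets U" "\<forall>\<^sub>F \<epsilon> in at_right 0. \<forall>x\<in>U. u \<epsilon> x = w \<epsilon> x + z \<epsilon> x"
    and u': "u \<in> moderate_nets U" using u unfolding colombeau_class_def by blast
  show "u \<in> moderate_nets U" by (rule u')
  show negl: "locally_negligible U (\<lambda>\<epsilon> x. u \<epsilon> x - w \<epsilon> x)"
  proof (rule locally_negligible_cong[OF negligible_netsD[OF z(1)]])
    show "\<forall>\<^sub>F \<epsilon> in at_right 0. \<forall>x\<in>K. norm (u \<epsilon> x - w \<epsilon> x) \<le> norm (z \<epsilon> x)" if "K \<subset>\<subset> U" for K
      using z(2) by eventually_elim (use cpt_insideD(2)[OF that] in auto)
  qed
  show "colombeau_class U u = colombeau_class U w"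
    using colombeau_class_eq_iff[OF U moderate_nets_eventually_moderate[OF u'] w] negl by simp
qed

lemma colombeau_eq_class:
  assumes U: "open U" and c: "c \<in> colombeau U" and u: "u \<in> c"
  shows "u \<in> moderate_nets U" "c = colombeau_class U u"
proof -
  show u': "u \<in> moderate_nets U"
    using c u in_quotient_imp_subset[OF equiv_colombeau_rel[OF U]] unfolding colombeau_def by blast
  show "c = colombeau_class U u"
    using c u Image_singleton_iff equiv_class_eq_iff[OF equiv_colombeau_rel[OF U]]
    unfolding colombeau_class_eq[OF U u'] colombeau_def
    by (auto elim!: quotientE)
qed

definition eventually_c_bounded ::
  "'a::euclidean_space set \<Rightarrow> 'b::euclidean_space set \<Rightarrow> ('a, 'b) net \<Rightarrow> bool" where
  "eventually_c_bounded U V f \<longleftrightarrow> compactly_maps U V f \<and>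
     (\<exists>e\<in>{0<..1}. (\<forall>k. moderate_upto k e U f) \<and> (\<forall>\<epsilon>\<in>{0<..e}. f \<epsilon> ` U \<subseteq> V))"

lemma eventually_Ioc_iff:
  "(\<exists>\<epsilon>\<^sub>0\<in>{0<..1::real}. \<forall>\<epsilon>\<in>{0<..\<epsilon>\<^sub>0}. Q \<epsilon>) \<longleftrightarrow> (\<forall>\<^sub>F \<epsilon> in at_right 0. Q \<epsilon>)"
proof
  assume "\<exists>\<epsilon>\<^sub>0\<in>{0<..1::real}. \<forall>\<epsilon>\<in>{0<..\<epsilon>\<^sub>0}. Q \<epsilon>"
  then obtain e where "0 < e" "\<And>\<epsilon>. \<epsilon> \<in> {0<..e} \<Longrightarrow> Q \<epsilon>" by auto
  then show "\<forall>\<^sub>F \<epsilon> in at_right 0. Q \<epsilon>"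
    using eventually_at_right_0_Ioc[of e] by (auto elim: eventually_mono)
next
  assume "\<forall>\<^sub>F \<epsilon> in at_right 0. Q \<epsilon>"
  then obtain b where b: "b > 0" "\<And>\<epsilon>. 0 < \<epsilon> \<Longrightarrow> \<epsilon> < b \<Longrightarrow> Q \<epsilon>"
    unfolding eventually_at_right_field by auto
  then show "\<exists>\<epsilon>\<^sub>0\<in>{0<..1::real}. \<forall>\<epsilon>\<in>{0<..\<epsilon>\<^sub>0}. Q \<epsilon>"
    by (intro bexI[of _ "min 1 (b / 2)"]) auto
qed

lemma c_bounded_iff:
  "c_bounded U V u \<longleftrightarrow> u \<in> moderate_nets U \<and> (\<forall>\<^sub>F \<epsilon> in at_right 0. u \<epsilon> ` U \<subseteq> V) \<and> compactly_maps U V u"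
  unfolding c_bounded_def compactly_maps_def eventually_Ioc_iff ..

lemma c_bounded_eventually: "c_bounded U V u \<Longrightarrow> eventually_c_bounded U V u"
proof -
  assume u: "c_bounded U V u"
  then obtain e where e: "e \<in> {0<..1}" "\<forall>\<epsilon>\<in>{0<..e}. u \<epsilon> ` U \<subseteq> V" by (auto simp: c_bounded_def)
  have "\<forall>k. moderate_upto k 1 U u" using u by (simp add: c_bounded_iff moderate_nets_iff)
  then have "\<forall>k. moderate_upto k e U u" using e(1) moderate_upto_e_mono[of _ 1 U u e] by auto
  then show ?thesis using u e unfolding eventually_c_bounded_def c_bounded_iff by blast
qed

lemma compose_eventually_moderate:
  assumes U: "open U" and V: "open V" and v: "eventually_moderate V v" and f: "eventually_c_bounded U V f"
  shows "eventually_moderate U (\<lambda>\<epsilon> x. v \<epsilon> (f \<epsilon> x))"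
proof -
  obtain e where e: "e \<in> {0<..1}" "\<And>k. moderate_upto k e V v" using v by (auto simp: eventually_moderate_def)
  obtain e' where e': "e' \<in> {0<..1}" "\<And>k. moderate_upto k e' U f" "\<forall>\<epsilon>\<in>{0<..e'}. f \<epsilon> ` U \<subseteq> V"
    "compactly_maps U V f"
    using f by (auto simp: eventually_c_bounded_def)
  let ?e = "min e e'"
  have pos: "?e > 0" using e e' by auto
  have "moderate_upto k ?e U (\<lambda>\<epsilon> x. v \<epsilon> (f \<epsilon> x))" for k
    by (rule moderate_upto_compose[OF U pos V moderate_upto_e_mono[OF e(2)] moderate_upto_e_mono[OF e'(2)] _ e'(4)])
      (use e'(3) in \<open>auto simp: image_subset_iff\<close>)
  then show ?thesis unfolding eventually_moderate_def using e e' by (intro bexI[of _ ?e]) auto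
qed

lemma colombeau_class_compose_eq:
  assumes U: "open U" and V: "open V" and v: "eventually_moderate V v" and v': "eventually_moderate V v'"
    and vv: "locally_negligible V (\<lambda>\<epsilon> y. v' \<epsilon> y - v \<epsilon> y)"
    and f: "eventually_c_bounded U V f" and g: "eventually_c_bounded U V g"
    and fg: "locally_negligible U (\<lambda>\<epsilon> x. f \<epsilon> x - g \<epsilon> x)"
  shows "colombeau_class U (\<lambda>\<epsilon> x. v' \<epsilon> (f \<epsilon> x)) = colombeau_class U (\<lambda>\<epsilon> x. v \<epsilon> (g \<epsilon> x))"
proof -
  obtain e where e: "e \<in> {0<..1}" "\<And>k. moderate_upto k e V v" using v by (auto simp: eventually_moderate_def)
  have "locally_negligible U (\<lambda>\<epsilon> x. v' \<epsilon> (f \<epsilon> x) - v \<epsilon> (g \<epsilon> x))"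
    by (rule locally_negligible_compose[OF V e(2) _ vv _ _ fg])
      (use e f g in \<open>auto simp: eventually_c_bounded_def\<close>)
  then show ?thesis
    using colombeau_class_eq_iff[OF U compose_eventually_moderate[OF U V v' f] compose_eventually_moderate[OF U V v g]]
    by simp
qed

text \<open>The operations on classes are unions over all representatives; this rule reads off their value once
  well-definedness is known.\<close>

lemma UN_constant_eq: "i \<in> A \<Longrightarrow> (\<And>i. i \<in> A \<Longrightarrow> f i = c) \<Longrightarrow> (\<Union>i\<in>A. f i) = c"
  by auto

lemma colombeau_comp_class:
  assumes U: "open U" and V: "open V" and v: "eventually_moderate V v" and g: "c_bounded U V g"
  shows "colombeau_comp U V (colombeau_class V v) (colombeau_class U g) = colombeau_class U (\<lambda>\<epsilon> x. v \<epsilon> (g \<epsilon> x))"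
proof -
  have g': "g \<in> moderate_nets U" "eventually_moderate U g" "eventually_c_bounded U V g"
    using g c_bounded_eventually by (auto simp: c_bounded_iff intro: moderate_nets_eventually_moderate)
  have eq: "colombeau_class U (\<lambda>\<epsilon>. v' \<epsilon> \<circ> u' \<epsilon>) = colombeau_class U (\<lambda>\<epsilon> x. v \<epsilon> (g \<epsilon> x))"
    if "v' \<in> colombeau_class V v" "u' \<in> colombeau_class U g" "c_bounded U V u'" for v' u'
    unfolding o_def
    using colombeau_class_memD[OF V v that(1)] colombeau_class_memD[OF U g'(2) that(2)] c_bounded_eventually[OF that(3)]
    by (intro colombeau_class_compose_eq[OF U V v _ _ _ g'(3)] moderate_nets_eventually_moderate)
  obtain v0 where v0': "v0 \<in> moderate_nets V" "\<forall>\<^sub>F \<epsilon> in at_right 0. \<forall>x\<in>V. v0 \<epsilon> x = v \<epsilon> x"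
    using eventually_moderate_representative[OF V v] .
  have v0: "v0 \<in> colombeau_class V v"
    using colombeau_class_memI(1)[OF V v0'(1)] unfolding colombeau_class_eventually_eq[OF v0'(2)] .
  show ?thesis
    unfolding colombeau_comp_def
  proof (rule UN_constant_eq[OF v0], rule UN_constant_eq)
    show "g \<in> {u' \<in> colombeau_class U g. c_bounded U V u'}" using colombeau_class_memI(1)[OF U g'(1)] g by simp
  qed (use eq in auto)
qed

lemma vector_derivative_frechet:
  fixes f :: "real \<Rightarrow> 'b::euclidean_space"
  assumes "f differentiable (at t)"
  shows "vector_derivative f (at t) = frechet_derivative f (at t) 1"
proof -
  have "(f has_vector_derivative vector_derivative f (at t)) (at t)"
    using assms by (simp add: vector_derivative_works)
  then have "frechet_derivative f (at t) = (\<lambda>x. x *\<^sub>R vector_derivative f (at t))"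
    unfolding has_vector_derivative_def by (rule frechet_derivative_at[symmetric])
  then show ?thesis by simp
qed

lemma moderate_nets_vector_derivative:
  fixes w :: "(real, 'b::euclidean_space) net"
  assumes J: "open J" and w: "w \<in> moderate_nets J"
  shows "(\<lambda>\<epsilon> t. vector_derivative (w \<epsilon>) (at t)) \<in> moderate_nets J"
    and "\<And>\<epsilon> t. \<epsilon> \<in> {0<..1} \<Longrightarrow> t \<in> J \<Longrightarrow> (w \<epsilon> has_vector_derivative vector_derivative (w \<epsilon>) (at t)) (at t)"
proof -
  have w': "\<And>k. moderate_upto k 1 J w" using w by (simp add: moderate_nets_iff)
  have diff: "w \<epsilon> differentiable (at t)" if "\<epsilon> \<in> {0<..1}" "t \<in> J" for \<epsilon> t
    by (rule differentiableI[OF moderate_upto_has_derivative[OF w' that]])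
  show "(\<lambda>\<epsilon> t. vector_derivative (w \<epsilon>) (at t)) \<in> moderate_nets J"
    unfolding moderate_nets_iff
  proof
    fix k
    show "moderate_upto k 1 J (\<lambda>\<epsilon> t. vector_derivative (w \<epsilon>) (at t))"
      by (rule moderate_upto_cong[OF J zero_less_one moderate_upto_derivative[OF w', of 1]])
        (use vector_derivative_frechet[OF diff] in auto)
  qed
  show "(w \<epsilon> has_vector_derivative vector_derivative (w \<epsilon>) (at t)) (at t)" if "\<epsilon> \<in> {0<..1}" "t \<in> J" for \<epsilon> t
    using diff[OF that] by (simp add: vector_derivative_works)
qed

lemma colombeau_dot_class:
  fixes w :: "(real, 'b::euclidean_space) net"
  assumes J: "open J" and w: "w \<in> moderate_nets J"
  shows "colombeau_dot J (colombeau_class J w) = colombeau_class J (\<lambda>\<epsilon> t. vector_derivative (w \<epsilon>) (at t))"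
  unfolding colombeau_dot_def
proof (rule UN_constant_eq[OF colombeau_class_memI(1)[OF J w]])
  fix u assume "u \<in> colombeau_class J w"
  note u = colombeau_class_memD[OF J moderate_nets_eventually_moderate[OF w] this]
  have u': "\<And>k. moderate_upto k 1 J u" and w': "\<And>k. moderate_upto k 1 J w"
    using u(1) w by (simp_all add: moderate_nets_iff)
  have "moderate_upto (Suc (Suc 0)) 1 J (\<lambda>\<epsilon> t. u \<epsilon> t + - w \<epsilon> t)"
    by (rule moderate_upto_add[OF J zero_less_one u'
          moderate_upto_linear[OF bounded_linear_minus[OF bounded_linear_ident] J zero_less_one w']])
  then have m: "moderate_upto (Suc (Suc 0)) 1 J (\<lambda>\<epsilon> t. u \<epsilon> t - w \<epsilon> t)" by simp
  have "locally_negligible J (\<lambda>\<epsilon> t. frechet_derivative (\<lambda>t. u \<epsilon> t - w \<epsilon> t) (at t) 1)"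
    by (rule locally_negligible_derivative[OF J zero_less_one m u(2)]) simp
  then have "locally_negligible J (\<lambda>\<epsilon> t. vector_derivative (u \<epsilon>) (at t) - vector_derivative (w \<epsilon>) (at t))"
  proof (rule locally_negligible_cong)
    fix K assume K: "K \<subset>\<subset> J"
    show "\<forall>\<^sub>F \<epsilon> in at_right 0. \<forall>t\<in>K. norm (vector_derivative (u \<epsilon>) (at t) - vector_derivative (w \<epsilon>) (at t))
        \<le> norm (frechet_derivative (\<lambda>t. u \<epsilon> t - w \<epsilon> t) (at t) 1)"
      using eventually_at_right_0_Ioc1
    proof eventually_elim
      case (elim \<epsilon>)
      show ?case
      proof
        fix t assume "t \<in> K"
        then have t: "t \<in> J" using cpt_insideD(2)[OF K] by auto
        have "((\<lambda>t. u \<epsilon> t - w \<epsilon> t) has_vector_derivative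
            vector_derivative (u \<epsilon>) (at t) - vector_derivative (w \<epsilon>) (at t)) (at t)"
          using moderate_nets_vector_derivative(2)[OF J u(1) elim t] moderate_nets_vector_derivative(2)[OF J w elim t]
          by (rule has_vector_derivative_diff)
        from frechet_derivative_at[OF this[unfolded has_vector_derivative_def], symmetric]
        show "norm (vector_derivative (u \<epsilon>) (at t) - vector_derivative (w \<epsilon>) (at t))
          \<le> norm (frechet_derivative (\<lambda>t. u \<epsilon> t - w \<epsilon> t) (at t) 1)" by simp
      qed
    qed
  qed
  then show "colombeau_class J (\<lambda>\<epsilon> t. vector_derivative (u \<epsilon>) (at t)) =
      colombeau_class J (\<lambda>\<epsilon> t. vector_derivative (w \<epsilon>) (at t))"
    using colombeau_class_eq_iff[OF J] moderate_nets_vector_derivative(1)[OF J] moderate_nets_eventually_moderate u(1) w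
    by blast
qed

lemma moderate_nets_Pair_id:
  assumes J: "open J" and w: "w \<in> moderate_nets J"
  shows "(\<lambda>\<epsilon> t. (t, w \<epsilon> t)) \<in> moderate_nets J"
  unfolding moderate_nets_iff
proof
  fix k
  show "moderate_upto k 1 J (\<lambda>\<epsilon> t. (t, w \<epsilon> t))"
    by (rule moderate_upto_Pair[OF J zero_less_one moderate_upto_id_linear[OF bounded_linear_ident J zero_less_one]])
      (use w in \<open>simp add: moderate_nets_iff\<close>)
qed

lemma colombeau_id_pair_class:
  fixes w :: "(real, 'b::euclidean_space) net"
  assumes J: "open J" and w: "w \<in> moderate_nets J"
  shows "colombeau_id_pair J (colombeau_class J w) = colombeau_class J (\<lambda>\<epsilon> t. (t, w \<epsilon> t))"
  unfolding colombeau_id_pair_def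
proof (rule UN_constant_eq[OF colombeau_class_memI(1)[OF J w]])
  fix u assume "u \<in> colombeau_class J w"
  note u = colombeau_class_memD[OF J moderate_nets_eventually_moderate[OF w] this]
  have "locally_negligible J (\<lambda>\<epsilon> t. (t, u \<epsilon> t) - (t, w \<epsilon> t))"
    by (rule locally_negligible_cong[OF u(2)]) (simp add: norm_Pair)
  then show "colombeau_class J (\<lambda>\<epsilon> t. (t, u \<epsilon> t)) = colombeau_class J (\<lambda>\<epsilon> t. (t, w \<epsilon> t))"
    using colombeau_class_eq_iff[OF J] moderate_nets_Pair_id[OF J] moderate_nets_eventually_moderate u(1) w
    by blast
qed

lemma c_bounded_Pair_id:
  assumes J: "open J" and I: "open I" "J \<subseteq> I" and U: "open U" and w: "c_bounded J U w"
  shows "c_bounded J (I \<times> U) (\<lambda>\<epsilon> t. (t, w \<epsilon> t))"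
  unfolding c_bounded_iff
proof (intro conjI)
  show "(\<lambda>\<epsilon> t. (t, w \<epsilon> t)) \<in> moderate_nets J"
    using w by (intro moderate_nets_Pair_id[OF J]) (simp add: c_bounded_iff)
  have "\<forall>\<^sub>F \<epsilon> in at_right 0. w \<epsilon> ` J \<subseteq> U" using w by (simp add: c_bounded_iff)
  then show "\<forall>\<^sub>F \<epsilon> in at_right 0. (\<lambda>t. (t, w \<epsilon> t)) ` J \<subseteq> I \<times> U"
    by eventually_elim (use I in auto)
  show "compactly_maps J (I \<times> U) (\<lambda>\<epsilon> t. (t, w \<epsilon> t))"
    unfolding compactly_maps_def
  proof (intro allI impI)
    fix K assume K: "K \<subset>\<subset> J"
    then obtain L where L: "L \<subset>\<subset> U" "\<forall>\<^sub>F \<epsilon> in at_right 0. w \<epsilon> ` K \<subseteq> L"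
      using w unfolding c_bounded_iff compactly_maps_def by blast
    have "K \<times> L \<subset>\<subset> I \<times> U"
      by (rule cpt_insideI[OF compact_Times Sigma_mono open_Times[OF I(1) U]])
        (use cpt_insideD[OF K] cpt_insideD[OF L(1)] I(2) in auto)
    moreover from L(2) have "\<forall>\<^sub>F \<epsilon> in at_right 0. (\<lambda>t. (t, w \<epsilon> t)) ` K \<subseteq> K \<times> L"
      by eventually_elim auto
    ultimately show "\<exists>L. L \<subset>\<subset> I \<times> U \<and> (\<forall>\<^sub>F \<epsilon> in at_right 0. (\<lambda>t. (t, w \<epsilon> t)) ` K \<subseteq> L)" by blast
  qed
qed

section \<open>Generalized points and solutions\<close>

lemma points_equiv_iff: "points_equiv x y \<longleftrightarrow> (\<forall>m::nat. \<forall>\<^sub>F \<epsilon> in at_right 0. norm (x \<epsilon> - y \<epsilon>) \<le> \<epsilon> ^ m)"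
proof -
  have "(\<lambda>\<epsilon>. norm (x \<epsilon> - y \<epsilon>)) \<in> O[at_right 0](\<lambda>\<epsilon>. \<epsilon> ^ m)
      \<longleftrightarrow> sup_bigo {()} (\<lambda>\<epsilon> _. x \<epsilon> - y \<epsilon>) (\<lambda>\<epsilon>. \<epsilon> ^ m)" for m
  proof
    assume "sup_bigo {()} (\<lambda>\<epsilon> _. x \<epsilon> - y \<epsilon>) (\<lambda>\<epsilon>. \<epsilon> ^ m)"
    then obtain C where "\<forall>\<^sub>F \<epsilon> in at_right 0. norm (x \<epsilon> - y \<epsilon>) \<le> C * \<bar>\<epsilon> ^ m\<bar>"
      unfolding sup_bigo_def by auto
    then show "(\<lambda>\<epsilon>. norm (x \<epsilon> - y \<epsilon>)) \<in> O[at_right 0](\<lambda>\<epsilon>. \<epsilon> ^ m)"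
      by (intro bigoI[of _ C]) simp
  qed (auto simp: sup_bigo_def elim!: landau_o.bigE)
  then have "points_equiv x y \<longleftrightarrow> negligible_on {()} (\<lambda>\<epsilon> _. x \<epsilon> - y \<epsilon>)"
    unfolding points_equiv_def by (simp only: negligible_on_iff[symmetric])
  then show ?thesis by (simp add: negligible_on_def)
qed

lemma points_equiv_sym: "points_equiv x y \<Longrightarrow> points_equiv y x"
  by (simp add: points_equiv_iff norm_minus_commute)

lemma points_equiv_trans:
  assumes "points_equiv x y" "points_equiv y z"
  shows "points_equiv x z"
proof -
  have "negligible_on {()} (\<lambda>\<epsilon> _. (x \<epsilon> - y \<epsilon>) + (y \<epsilon> - z \<epsilon>))"
    by (rule negligible_on_add) (use assms in \<open>auto simp: negligible_on_def points_equiv_iff\<close>)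
  then show ?thesis by (simp add: negligible_on_def points_equiv_iff)
qed

lemma gen_points_memD:
  assumes "X \<in> gen_points U" "x \<in> X"
  shows "x \<in> moderate_points U" "X = point_class U x"
proof -
  obtain z where z: "z \<in> moderate_points U" "X = {(x, y). x \<in> moderate_points U \<and> y \<in> moderate_points U \<and> points_equiv x y} `` {z}"
    using assms(1) by (auto simp: gen_points_def elim: quotientE)
  then have x: "x \<in> moderate_points U" "points_equiv z x" using assms(2) by auto
  show "x \<in> moderate_points U" by (rule x)
  show "X = point_class U x"
    using z x by (auto simp: point_class_def intro: points_equiv_trans points_equiv_sym)
qed

lemma point_class_eq_iff:
  assumes "X \<in> gen_points U" "x \<in> X"
  shows "point_class U y = X \<longleftrightarrow> points_equiv y x"
  using gen_points_memD[OF assms] assms(2)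
  by (auto simp: point_class_def intro: points_equiv_trans points_equiv_sym)

lemma point_class_cong: "points_equiv x y \<Longrightarrow> point_class U x = point_class U y"
  by (auto simp: point_class_def intro: points_equiv_trans points_equiv_sym)

text \<open>The compact set in the definition belongs to one representative.  Any other one is eventually close to it and
  hence in a slightly larger compact set.\<close>

lemma cpt_points_memD:
  fixes P :: "'p::euclidean_space set"
  assumes P: "open P" and p: "p \<in> cpt_points P" and p': "p' \<in> p"
  shows "\<And>\<epsilon>. \<epsilon> \<in> {0<..1} \<Longrightarrow> p' \<epsilon> \<in> P" and "\<exists>K. K \<subset>\<subset> P \<and> (\<forall>\<^sub>F \<epsilon> in at_right 0. p' \<epsilon> \<in> K)"
proof -
  have gen: "p \<in> gen_points P" using p by (simp add: cpt_points_def)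
  show "p' \<epsilon> \<in> P" if "\<epsilon> \<in> {0<..1}" for \<epsilon>
    using gen_points_memD(1)[OF gen p'] that by (auto simp: moderate_points_def)
  obtain x K where x: "x \<in> p" "K \<subset>\<subset> P" "\<forall>\<^sub>F \<epsilon> in at_right 0. x \<epsilon> \<in> K"
    using p unfolding cpt_points_def eventually_Ioc_iff by blast
  obtain r where r: "r > 0" "(\<Union>x\<in>K. cball x r) \<subset>\<subset> P" by (rule cpt_inside_tube[OF x(2) P])
  have "points_equiv x p'"
    using p' gen_points_memD(2)[OF gen x(1)] by (simp add: point_class_def)
  then have "\<forall>\<^sub>F \<epsilon> in at_right 0. norm (x \<epsilon> - p' \<epsilon>) \<le> \<epsilon> ^ 1" unfolding points_equiv_iff by blast
  with x(3) eventually_at_right_0_Ioc[OF r(1)]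
  have "\<forall>\<^sub>F \<epsilon> in at_right 0. p' \<epsilon> \<in> (\<Union>x\<in>K. cball x r)"
    by eventually_elim (force simp: dist_norm)
  then show "\<exists>K. K \<subset>\<subset> P \<and> (\<forall>\<^sub>F \<epsilon> in at_right 0. p' \<epsilon> \<in> K)" using r(2) by blast
qed

lemma moderate_upto_parameter:
  assumes "\<forall>\<^sub>F \<epsilon> in at_right 0. c \<epsilon> \<in> K" "compact K"
  shows "moderate_upto k e U (\<lambda>\<epsilon> _. c \<epsilon>)"
proof -
  have mod: "locally_moderate U (\<lambda>\<epsilon> _. c \<epsilon>)"
    unfolding locally_moderate_def
  proof (intro allI impI)
    fix K' show "moderate_on K' (\<lambda>\<epsilon> _. c \<epsilon>)"
      by (rule moderate_on_compact_range[OF _ assms(2)], rule eventually_mono[OF assms(1)]) auto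
  qed
  show ?thesis using mod by (cases k) (auto simp: moderate_upto_const)
qed

lemma slice_moderate:
  assumes J: "open J" and p: "\<And>\<epsilon>. \<epsilon> \<in> {0<..1} \<Longrightarrow> p' \<epsilon> \<in> P" "\<exists>K. K \<subset>\<subset> P \<and> (\<forall>\<^sub>F \<epsilon> in at_right 0. p' \<epsilon> \<in> K)"
    and P: "open P"
  shows "eventually_c_bounded J (P \<times> J) (\<lambda>\<epsilon> t. (p' \<epsilon>, t))" "moderate_upto k 1 J (\<lambda>\<epsilon> t. (p' \<epsilon>, t))"
proof -
  obtain K where K: "K \<subset>\<subset> P" "\<forall>\<^sub>F \<epsilon> in at_right 0. p' \<epsilon> \<in> K" using p(2) by blast
  show m: "moderate_upto k 1 J (\<lambda>\<epsilon> t. (p' \<epsilon>, t))" for k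
    by (rule moderate_upto_Pair[OF J zero_less_one moderate_upto_parameter[OF K(2) cpt_insideD(1)[OF K(1)]]
          moderate_upto_id_linear[OF bounded_linear_ident J zero_less_one]])
  have "compactly_maps J (P \<times> J) (\<lambda>\<epsilon> t. (p' \<epsilon>, t))"
    unfolding compactly_maps_def
  proof (intro allI impI)
    fix L assume L: "L \<subset>\<subset> J"
    have "K \<times> L \<subset>\<subset> P \<times> J"
      by (rule cpt_insideI[OF compact_Times Sigma_mono open_Times[OF P J]])
        (use cpt_insideD[OF K(1)] cpt_insideD[OF L] in auto)
    moreover from K(2) have "\<forall>\<^sub>F \<epsilon> in at_right 0. (\<lambda>t. (p' \<epsilon>, t)) ` L \<subseteq> K \<times> L"
      by eventually_elim auto
    ultimately show "\<exists>M. M \<subset>\<subset> P \<times> J \<and> (\<forall>\<^sub>F \<epsilon> in at_right 0. (\<lambda>t. (p' \<epsilon>, t)) ` L \<subseteq> M)" by blast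
  qed
  then show "eventually_c_bounded J (P \<times> J) (\<lambda>\<epsilon> t. (p' \<epsilon>, t))"
    unfolding eventually_c_bounded_def using m p(1) by (intro conjI bexI[of _ 1]) auto
qed

lemma slice_c_bounded:
  assumes "open P" "open J" "p \<in> cpt_points P" "p' \<in> p"
  shows "eventually_c_bounded J (P \<times> J) (\<lambda>\<epsilon> t. (p' \<epsilon>, t))"
  by (rule slice_moderate(1)[OF assms(2) _ cpt_points_memD(2)[OF assms(1,3,4)] assms(1)])
    (rule cpt_points_memD(1)[OF assms(1,3,4)])

lemma compactly_maps_compose:
  assumes "compactly_maps U V f" "compactly_maps V W g"
  shows "compactly_maps U W (\<lambda>\<epsilon> x. g \<epsilon> (f \<epsilon> x))"
  unfolding compactly_maps_def
proof (intro allI impI)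
  fix K assume "K \<subset>\<subset> U"
  then obtain L where L: "L \<subset>\<subset> V" "\<forall>\<^sub>F \<epsilon> in at_right 0. f \<epsilon> ` K \<subseteq> L"
    using assms(1) unfolding compactly_maps_def by blast
  then obtain M where M: "M \<subset>\<subset> W" "\<forall>\<^sub>F \<epsilon> in at_right 0. g \<epsilon> ` L \<subseteq> M"
    using assms(2) unfolding compactly_maps_def by blast
  from L(2) M(2) have "\<forall>\<^sub>F \<epsilon> in at_right 0. (\<lambda>x. g \<epsilon> (f \<epsilon> x)) ` K \<subseteq> M"
    by eventually_elim auto
  then show "\<exists>L. L \<subset>\<subset> W \<and> (\<forall>\<^sub>F \<epsilon> in at_right 0. (\<lambda>x. g \<epsilon> (f \<epsilon> x)) ` K \<subseteq> L)" using M(1) by blast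
qed

lemma slice_moderate_nets:
  fixes w :: "('p::euclidean_space \<times> real, 'b::euclidean_space) net"
  assumes P: "open P" and J: "open J" and p: "p \<in> cpt_points P" "p' \<in> p"
  shows "w \<in> moderate_nets (P \<times> J) \<Longrightarrow> (\<lambda>\<epsilon> t. w \<epsilon> (p' \<epsilon>, t)) \<in> moderate_nets J"
    and "c_bounded (P \<times> J) V w \<Longrightarrow> c_bounded J V (\<lambda>\<epsilon> t. w \<epsilon> (p' \<epsilon>, t))"
proof -
  note p' = cpt_points_memD[OF P p]
  note sl = slice_moderate[OF J p'(1,2) P]
  have cm: "compactly_maps J (P \<times> J) (\<lambda>\<epsilon> t. (p' \<epsilon>, t))" using sl(1) by (simp add: eventually_c_bounded_def)
  show *: "(\<lambda>\<epsilon> t. w \<epsilon> (p' \<epsilon>, t)) \<in> moderate_nets J" if w: "w \<in> moderate_nets (P \<times> J)"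
    unfolding moderate_nets_iff
  proof
    fix k show "moderate_upto k 1 J (\<lambda>\<epsilon> t. w \<epsilon> (p' \<epsilon>, t))"
      by (rule moderate_upto_compose[OF J zero_less_one open_Times[OF P J] _ sl(2) _ cm])
        (use w p'(1) in \<open>auto simp: moderate_nets_iff\<close>)
  qed
  show "c_bounded J V (\<lambda>\<epsilon> t. w \<epsilon> (p' \<epsilon>, t))" if w: "c_bounded (P \<times> J) V w"
    unfolding c_bounded_iff
  proof (intro conjI)
    show "(\<lambda>\<epsilon> t. w \<epsilon> (p' \<epsilon>, t)) \<in> moderate_nets J" using w * by (simp add: c_bounded_iff)
    have "\<forall>\<^sub>F \<epsilon> in at_right 0. w \<epsilon> ` (P \<times> J) \<subseteq> V" using w by (simp add: c_bounded_iff)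
    with eventually_at_right_0_Ioc1 show "\<forall>\<^sub>F \<epsilon> in at_right 0. (\<lambda>t. w \<epsilon> (p' \<epsilon>, t)) ` J \<subseteq> V"
      by eventually_elim (use p'(1) in \<open>auto simp: image_subset_iff\<close>)
    show "compactly_maps J V (\<lambda>\<epsilon> t. w \<epsilon> (p' \<epsilon>, t))"
      by (rule compactly_maps_compose[OF cm]) (use w in \<open>simp add: c_bounded_iff\<close>)
  qed
qed

lemma points_equiv_locally_negligible:
  assumes "points_equiv p' p''"
  shows "locally_negligible U (\<lambda>\<epsilon> x. p' \<epsilon> - p'' \<epsilon>)"
  unfolding locally_negligible_def negligible_on_def
  using assms unfolding points_equiv_iff by (auto elim: eventually_mono)

lemma points_class_equiv:
  assumes "p \<in> cpt_points P" "p' \<in> p" "p'' \<in> p"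
  shows "points_equiv p' p''"
proof -
  have gen: "p \<in> gen_points P" using assms by (simp add: cpt_points_def)
  show ?thesis using gen_points_memD(2)[OF gen assms(2)] assms(3) by (simp add: point_class_def)
qed

lemma insert_first_class:
  fixes w :: "('p::euclidean_space \<times> real, 'b::euclidean_space) net"
  assumes P: "open P" and J: "open J" and p: "p \<in> cpt_points P" "p' \<in> p" and w: "w \<in> moderate_nets (P \<times> J)"
  shows "insert_first J (colombeau_class (P \<times> J) w) p = colombeau_class J (\<lambda>\<epsilon> t. w \<epsilon> (p' \<epsilon>, t))"
  unfolding insert_first_def
proof (rule UN_constant_eq[OF colombeau_class_memI(1)[OF open_Times[OF P J] w]], rule UN_constant_eq[OF p(2)])
  fix u q assume u: "u \<in> colombeau_class (P \<times> J) w" and q: "q \<in> p"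
  note u' = colombeau_class_memD[OF open_Times[OF P J] moderate_nets_eventually_moderate[OF w] u]
  note q' = slice_c_bounded[OF P J p(1) q] and p' = slice_c_bounded[OF P J p]
  have "locally_negligible J (\<lambda>\<epsilon> t. (q \<epsilon>, t) - (p' \<epsilon>, t))"
    by (rule locally_negligible_cong[OF points_equiv_locally_negligible[OF points_class_equiv[OF p(1) q p(2)]]])
      (simp add: norm_Pair)
  then show "colombeau_class J (\<lambda>\<epsilon> t. u \<epsilon> (q \<epsilon>, t)) = colombeau_class J (\<lambda>\<epsilon> t. w \<epsilon> (p' \<epsilon>, t))"
    by (rule colombeau_class_compose_eq[where v = w and v' = u and f = "\<lambda>\<epsilon> t. (q \<epsilon>, t)" and g = "\<lambda>\<epsilon> t. (p' \<epsilon>, t)",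
          OF J open_Times[OF P J] moderate_nets_eventually_moderate[OF w]
          moderate_nets_eventually_moderate[OF u'(1)] u'(2) q' p'])
qed

lemma insert_third_map:
  fixes P :: "'p::euclidean_space set"
  assumes I: "open I" and U: "open U" and P: "open P" and p: "p \<in> cpt_points P" "p' \<in> p"
  shows "eventually_c_bounded (I \<times> U) (I \<times> U \<times> P) (\<lambda>\<epsilon> z. (fst z, snd z, p' \<epsilon>))"
proof -
  note p' = cpt_points_memD[OF P p]
  obtain K where K: "K \<subset>\<subset> P" "\<forall>\<^sub>F \<epsilon> in at_right 0. p' \<epsilon> \<in> K" using p'(2) by blast
  have IU: "open (I \<times> U)" by (rule open_Times[OF I U])
  have m: "moderate_upto k 1 (I \<times> U) (\<lambda>\<epsilon> z. (fst z, snd z, p' \<epsilon>))" for k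
    by (rule moderate_upto_Pair[OF IU zero_less_one moderate_upto_id_linear[OF bounded_linear_fst IU zero_less_one]
          moderate_upto_Pair[OF IU zero_less_one moderate_upto_id_linear[OF bounded_linear_snd IU zero_less_one]
          moderate_upto_parameter[OF K(2) cpt_insideD(1)[OF K(1)]]]])
  have "compactly_maps (I \<times> U) (I \<times> U \<times> P) (\<lambda>\<epsilon> z. (fst z, snd z, p' \<epsilon>))"
    unfolding compactly_maps_def
  proof (intro allI impI)
    fix L assume L: "L \<subset>\<subset> I \<times> U"
    define M where "M = fst ` L \<times> snd ` L \<times> K"
    have "M \<subset>\<subset> I \<times> U \<times> P"
    proof (rule cpt_insideI[OF _ _ open_Times[OF I open_Times[OF U P]]])
      show "compact M" unfolding M_def
        by (intro compact_Times compact_continuous_image continuous_on_fst continuous_on_snd continuous_on_id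
            cpt_insideD(1)[OF L] cpt_insideD(1)[OF K(1)])
      show "M \<subseteq> I \<times> U \<times> P" using cpt_insideD(2)[OF L] cpt_insideD(2)[OF K(1)] by (force simp: M_def)
    qed
    moreover from K(2) have "\<forall>\<^sub>F \<epsilon> in at_right 0. (\<lambda>z. (fst z, snd z, p' \<epsilon>)) ` L \<subseteq> M"
      by eventually_elim (auto simp: M_def intro: rev_image_eqI)
    ultimately show "\<exists>M. M \<subset>\<subset> I \<times> U \<times> P \<and> (\<forall>\<^sub>F \<epsilon> in at_right 0. (\<lambda>z. (fst z, snd z, p' \<epsilon>)) ` L \<subseteq> M)"
      by blast
  qed
  then show ?thesis
    unfolding eventually_c_bounded_def using m p'(1) by (intro conjI bexI[of _ 1]) auto
qed

lemma insert_third_class: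
  fixes F :: "('a::euclidean_space \<times> 'b::euclidean_space \<times> 'p::euclidean_space, 'c::euclidean_space) net"
  assumes I: "open I" and U: "open U" and P: "open P" and p: "p \<in> cpt_points P" "p' \<in> p"
    and F: "F \<in> moderate_nets (I \<times> U \<times> P)"
  shows "insert_third (I \<times> U) (colombeau_class (I \<times> U \<times> P) F) p
      = colombeau_class (I \<times> U) (\<lambda>\<epsilon> z. F \<epsilon> (fst z, snd z, p' \<epsilon>))"
  unfolding insert_third_def split_def
proof (rule UN_constant_eq[OF colombeau_class_memI(1)[OF _ F]], goal_cases)
  have op: "open (I \<times> U \<times> P)" by (intro open_Times I U P)
  {
    case 1
    show ?case by (rule op)
  next
    case (2 G)
    note G = colombeau_class_memD[OF op moderate_nets_eventually_moderate[OF F] 2]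
    show ?case
    proof (rule UN_constant_eq[OF p(2)])
      fix q assume q: "q \<in> p"
      have "locally_negligible (I \<times> U) (\<lambda>\<epsilon> z. (fst z, snd z, q \<epsilon>) - (fst z, snd z, p' \<epsilon>))"
        by (rule locally_negligible_cong[OF points_equiv_locally_negligible[OF points_class_equiv[OF p(1) q p(2)]]])
          (simp add: norm_Pair)
      then show "colombeau_class (I \<times> U) (\<lambda>\<epsilon> z. G \<epsilon> (fst z, snd z, q \<epsilon>)) =
          colombeau_class (I \<times> U) (\<lambda>\<epsilon> z. F \<epsilon> (fst z, snd z, p' \<epsilon>))"
        by (rule colombeau_class_compose_eq[OF open_Times[OF I U] op moderate_nets_eventually_moderate[OF F]
              moderate_nets_eventually_moderate[OF G(1)] G(2)
              insert_third_map[OF I U P p(1) q] insert_third_map[OF I U P p]])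
    qed
  }
qed

lemma near_standard_eventually:
  assumes T: "near_standard_at I T t0" and t: "t \<in> T" and r: "r > 0"
  shows "\<forall>\<^sub>F \<epsilon> in at_right 0. t \<epsilon> \<in> cball t0 r"
proof -
  obtain x where x: "x \<in> T" "(x \<longlongrightarrow> t0) (at_right 0)" and T': "T \<in> cpt_points I"
    using T unfolding near_standard_at_def by blast
  have "points_equiv t x" by (rule points_class_equiv[OF T' t x(1)])
  then have "\<forall>\<^sub>F \<epsilon> in at_right 0. norm (t \<epsilon> - x \<epsilon>) \<le> \<epsilon> ^ 1" unfolding points_equiv_iff by blast
  moreover have "\<forall>\<^sub>F \<epsilon> in at_right 0. dist (x \<epsilon>) t0 < r / 2" using tendstoD[OF x(2), of "r / 2"] r by simp
  moreover have "\<forall>\<^sub>F \<epsilon>::real in at_right 0. \<epsilon> \<in> {0<..r / 2}" using r by (intro eventually_at_right_0_Ioc) simp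
  ultimately show ?thesis
  proof eventually_elim
    case (elim \<epsilon>)
    then show ?case using dist_triangle[of t0 "t \<epsilon>" "x \<epsilon>"] by (simp add: dist_norm norm_minus_commute)
  qed
qed

text \<open>A point net is treated as a net of constant functions on the real line, which makes the statement
  a case of the compatibility of composition with negligible perturbations.\<close>

lemma point_value_class:
  fixes w :: "(real, 'b::euclidean_space) net"
  assumes J: "open J" and w: "w \<in> moderate_nets J" and T: "near_standard_at I T t0" and t0: "t0 \<in> J"
    and t: "t \<in> T"
  shows "point_value V (colombeau_class J w) T = point_class V (\<lambda>\<epsilon>. w \<epsilon> (t \<epsilon>))"
  unfolding point_value_def
proof (rule UN_constant_eq[OF colombeau_class_memI(1)[OF J w]], rule UN_constant_eq[OF t])
  fix u s assume u: "u \<in> colombeau_class J w" and s: "s \<in> T"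
  note u' = colombeau_class_memD[OF J moderate_nets_eventually_moderate[OF w] u]
  have T': "T \<in> cpt_points I" using T by (simp add: near_standard_at_def)
  obtain r where r: "r > 0" "cball t0 r \<subseteq> J" using J t0 open_contains_cball by blast
  have maps: "compactly_maps (UNIV :: real set) J (\<lambda>\<epsilon> _. s \<epsilon>)" if s: "s \<in> T" for s
    unfolding compactly_maps_def
  proof (intro allI impI exI conjI)
    show "cball t0 r \<subset>\<subset> J" by (rule cpt_insideI[OF compact_cball r(2) J])
    show "\<forall>\<^sub>F \<epsilon> in at_right 0. (\<lambda>_. s \<epsilon>) ` K \<subseteq> cball t0 r" for K :: "real set"
      by (rule eventually_mono[OF near_standard_eventually[OF T s r(1)]]) auto
  qed
  have w1: "moderate_upto (Suc 0) 1 J w" using w unfolding moderate_nets_iff by blast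
  have "locally_negligible (UNIV :: real set) (\<lambda>\<epsilon> _. u \<epsilon> (s \<epsilon>) - w \<epsilon> (t \<epsilon>))"
    by (rule locally_negligible_compose[OF J w1 zero_less_one u'(2) maps[OF s] maps[OF t]
          points_equiv_locally_negligible[OF points_class_equiv[OF T' s t]]])
  moreover have "{0} \<subset>\<subset> (UNIV :: real set)" by (rule cpt_insideI) auto
  ultimately have "negligible_on {0 :: real} (\<lambda>\<epsilon> _. u \<epsilon> (s \<epsilon>) - w \<epsilon> (t \<epsilon>))"
    unfolding locally_negligible_def by blast
  then have "points_equiv (\<lambda>\<epsilon>. u \<epsilon> (s \<epsilon>)) (\<lambda>\<epsilon>. w \<epsilon> (t \<epsilon>))"
    by (simp add: negligible_on_def points_equiv_iff)
  then show "point_class V (\<lambda>\<epsilon>. u \<epsilon> (s \<epsilon>)) = point_class V (\<lambda>\<epsilon>. w \<epsilon> (t \<epsilon>))"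
    by (rule point_class_cong)
qed

lemma colombeau_intoI: "open U \<Longrightarrow> c_bounded U V w \<Longrightarrow> colombeau_class U w \<in> colombeau_into U V"
  using colombeau_class_memI[of U w] unfolding colombeau_into_def c_bounded_iff by blast

text \<open>Every operation in the definition of a solution is independent of representatives, so it may be computed with
  the given ones.  Equality of the two classes then means that the values of the difference are negligible.\<close>

lemma ivp_solution_insert_first_iff:
  fixes w :: "('p::euclidean_space \<times> real, 'x::euclidean_space) net"
  assumes I: "open I" and U: "open U" and P: "open P" and J: "open J" "J \<subseteq> I"
    and T: "near_standard_at I T t0" "t \<in> T" "t0 \<in> J"
    and X: "X \<in> gen_points U" "x \<in> X"
    and F: "F \<in> colombeau (I \<times> U \<times> P)" "F' \<in> F"
    and p: "p \<in> cpt_points P" "p' \<in> p"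
    and w: "c_bounded (P \<times> J) U w"
  shows "ivp_solution I U (insert_third (I \<times> U) F p) T X J (insert_first J (colombeau_class (P \<times> J) w) p) \<longleftrightarrow>
    locally_negligible J (\<lambda>\<epsilon> t. vector_derivative (\<lambda>t. w \<epsilon> (p' \<epsilon>, t)) (at t) - F' \<epsilon> (t, w \<epsilon> (p' \<epsilon>, t), p' \<epsilon>)) \<and>
    points_equiv (\<lambda>\<epsilon>. w \<epsilon> (p' \<epsilon>, t \<epsilon>)) x"
proof -
  define y where "y \<epsilon> t = w \<epsilon> (p' \<epsilon>, t)" for \<epsilon> t
  have wm: "w \<in> moderate_nets (P \<times> J)" using w by (simp add: c_bounded_iff)
  have y: "c_bounded J U y" "y \<in> moderate_nets J"
    unfolding y_def[abs_def] by (rule slice_moderate_nets(2)[OF P J(1) p w], rule slice_moderate_nets(1)[OF P J(1) p wm])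
  have ins: "insert_first J (colombeau_class (P \<times> J) w) p = colombeau_class J y"
    unfolding y_def[abs_def] by (rule insert_first_class[OF P J(1) p wm])
  have op: "open (I \<times> U \<times> P)" "open (I \<times> U)" by (intro open_Times I U P)+
  note F' = colombeau_eq_class[OF op(1) F]
  define G where "G \<epsilon> z = F' \<epsilon> (fst z, snd z, p' \<epsilon>)" for \<epsilon> z
  have G: "eventually_moderate (I \<times> U) G" unfolding G_def[abs_def]
    by (rule compose_eventually_moderate[OF op(2,1) moderate_nets_eventually_moderate[OF F'(1)] insert_third_map[OF I U P p]])
  have third: "insert_third (I \<times> U) F p = colombeau_class (I \<times> U) G"
    unfolding G_def[abs_def] using insert_third_class[OF I U P p F'(1)] F'(2) by simp
  have pair: "c_bounded J (I \<times> U) (\<lambda>\<epsilon> t. (t, y \<epsilon> t))" by (rule c_bounded_Pair_id[OF J(1) I J(2) U y(1)])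
  have comp: "colombeau_comp J (I \<times> U) (colombeau_class (I \<times> U) G) (colombeau_id_pair J (colombeau_class J y))
      = colombeau_class J (\<lambda>\<epsilon> t. G \<epsilon> (t, y \<epsilon> t))"
    unfolding colombeau_id_pair_class[OF J(1) y(2)] by (rule colombeau_comp_class[OF J(1) op(2) G pair])
  have "colombeau_class J y \<in> colombeau_into J U" by (rule colombeau_intoI[OF J(1) y(1)])
  then have "ivp_solution I U (colombeau_class (I \<times> U) G) T X J (colombeau_class J y) \<longleftrightarrow>
      colombeau_class J (\<lambda>\<epsilon> t. vector_derivative (y \<epsilon>) (at t)) = colombeau_class J (\<lambda>\<epsilon> t. G \<epsilon> (t, y \<epsilon> t)) \<and>
      point_class U (\<lambda>\<epsilon>. y \<epsilon> (t \<epsilon>)) = X"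
    unfolding ivp_solution_def comp colombeau_dot_class[OF J(1) y(2)] point_value_class[OF J(1) y(2) T(1,3,2)]
    by simp
  also have "\<dots> \<longleftrightarrow> locally_negligible J (\<lambda>\<epsilon> t. vector_derivative (y \<epsilon>) (at t) - G \<epsilon> (t, y \<epsilon> t)) \<and>
      points_equiv (\<lambda>\<epsilon>. y \<epsilon> (t \<epsilon>)) x"
    unfolding point_class_eq_iff[OF X]
      colombeau_class_eq_iff[OF J(1) moderate_nets_eventually_moderate[OF moderate_nets_vector_derivative(1)[OF J(1) y(2)]]
        compose_eventually_moderate[OF J(1) op(2) G c_bounded_eventually[OF pair]]] ..
  finally show ?thesis unfolding ins third by (simp add: y_def[abs_def] G_def)
qed

section \<open>Smooth cutoffs in time\<close>

lemma compactly_maps_static: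
  assumes "continuous_on U f" "f ` U \<subseteq> V" "open V"
  shows "compactly_maps U V (\<lambda>_. f)"
  unfolding compactly_maps_def
proof (intro allI impI)
  fix K assume K: "K \<subset>\<subset> U"
  have "compact (f ` K)"
    by (rule compact_continuous_image[OF continuous_on_subset[OF assms(1) cpt_insideD(2)[OF K]] cpt_insideD(1)[OF K]])
  moreover have "f ` K \<subseteq> V" using cpt_insideD(2)[OF K] assms(2) by auto
  ultimately have "f ` K \<subset>\<subset> V" by (rule cpt_insideI[OF _ _ assms(3)])
  then show "\<exists>L. L \<subset>\<subset> V \<and> (\<forall>\<^sub>F \<epsilon> in at_right (0::real). f ` K \<subseteq> L)" by auto
qed

text \<open>The factors \<open>(1 / x) ^ m\<close> make the family closed under differentiation up to linear combinations, so
  that smoothness of all members is a single induction.\<close>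

definition flat_exp :: "nat \<Rightarrow> real \<Rightarrow> real" where
  "flat_exp m x = (if x > 0 then (1 / x) ^ m * exp (- (1 / x)) else 0)"

lemma flat_exp_has_derivative:
  "(flat_exp m has_real_derivative flat_exp (m + 2) x - real m * flat_exp (m + 1) x) (at x)"
proof -
  consider "x > 0" | "x < 0" | "x = 0" by linarith
  then show ?thesis
  proof cases
    case 1
    have "((\<lambda>x. (1 / x) ^ m * exp (- (1 / x))) has_real_derivative
        flat_exp (m + 2) x - real m * flat_exp (m + 1) x) (at x)"
    proof -
      have d1: "((\<lambda>x::real. (1 / x) ^ m) has_real_derivative real m * (1 / x) ^ (m - 1) * - (1 / x\<^sup>2)) (at x)"
        using 1 by (auto intro!: derivative_eq_intros simp: power2_eq_square)
      have eq: "real m * (1 / x) ^ (m - 1) * - (1 / x\<^sup>2) = - real m * (1 / x) ^ (m + 1)"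
        using 1 by (cases m) (simp_all add: power2_eq_square field_simps)
      have d2: "((\<lambda>x::real. exp (- (1 / x))) has_real_derivative exp (- (1 / x)) * (1 / x)\<^sup>2) (at x)"
        using 1 by (auto intro!: derivative_eq_intros simp: power2_eq_square)
      have "((\<lambda>x. (1 / x) ^ m * exp (- (1 / x))) has_real_derivative
          (- real m * (1 / x) ^ (m + 1)) * exp (- (1 / x)) + (exp (- (1 / x)) * (1 / x)\<^sup>2) * (1 / x) ^ m) (at x)"
        by (rule DERIV_mult[OF d1[unfolded eq] d2])
      moreover have "(- real m * (1 / x) ^ (m + 1)) * exp (- (1 / x)) + (exp (- (1 / x)) * (1 / x)\<^sup>2) * (1 / x) ^ m
          = flat_exp (m + 2) x - real m * flat_exp (m + 1) x"
        using 1 unfolding flat_exp_def by (simp add: power_add power2_eq_square mult_ac)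
      ultimately show ?thesis by simp
    qed
    then show ?thesis
      by (rule has_field_derivative_transform_within_open[where S = "{0<..}"]) (use 1 in \<open>auto simp: flat_exp_def\<close>)
  next
    case 2
    have "((\<lambda>x::real. 0::real) has_real_derivative flat_exp (m + 2) x - real m * flat_exp (m + 1) x) (at x)"
      using 2 by (simp add: flat_exp_def)
    then show ?thesis
      by (rule has_field_derivative_transform_within_open[where S = "{..<0}"]) (use 2 in \<open>auto simp: flat_exp_def\<close>)
  next
    case 3
    have "((\<lambda>h. flat_exp m h / h) \<longlongrightarrow> 0) (at 0)"
    proof (rule filterlim_split_at)
      show "((\<lambda>h. flat_exp m h / h) \<longlongrightarrow> 0) (at_left 0)"
        by (rule tendsto_eventually) (auto simp: eventually_at_filter flat_exp_def intro!: always_eventually)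
      have "((\<lambda>x::real. inverse x ^ Suc m / exp (inverse x)) \<longlongrightarrow> 0) (at_right 0)"
        by (rule filterlim_compose[OF tendsto_power_div_exp_0 filterlim_inverse_at_top_right])
      then show "((\<lambda>h. flat_exp m h / h) \<longlongrightarrow> 0) (at_right 0)"
        by (rule Lim_transform_eventually)
          (auto simp: eventually_at_filter flat_exp_def exp_minus field_simps intro!: always_eventually)
    qed
    then show ?thesis using 3 by (simp add: DERIV_def flat_exp_def)
  qed
qed

lemma flat_exp_smooth: "moderate_upto k 1 UNIV (\<lambda>_. flat_exp m)"
proof (induction k arbitrary: m)
  have cont: "continuous_on UNIV (flat_exp m)" for m
    using DERIV_isCont[OF flat_exp_has_derivative] by (intro continuous_at_imp_continuous_on) auto
  {
    case 0
    then show ?case using cont[of m] locally_moderate_static[OF cont[of m]] by simp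
  next
    case (Suc k)
    show ?case
    proof (rule moderate_upto_SucI[OF open_UNIV zero_less_one locally_moderate_static[OF cont]])
      show "(flat_exp m has_derivative (*) (flat_exp (m + 2) x - real m * flat_exp (m + 1) x)) (at x)" for x
        using flat_exp_has_derivative by (simp add: has_field_derivative_def)
      have "moderate_upto k 1 UNIV (\<lambda>_ x. flat_exp (m + 2) x + - real m * flat_exp (m + 1) x)"
        by (rule moderate_upto_add[OF open_UNIV zero_less_one Suc.IH
              moderate_upto_linear[OF bounded_linear_mult_right open_UNIV zero_less_one Suc.IH]])
      then show "moderate_upto k 1 UNIV (\<lambda>_ x. (flat_exp (m + 2) x - real m * flat_exp (m + 1) x) * b)"
        if "b \<in> Basis" for b :: real using that by simp
    qed
  }
qed

lemma moderate_upto_static_inverse: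
  fixes f :: "'a::euclidean_space \<Rightarrow> real"
  assumes U: "open U" and f: "\<And>k. moderate_upto k 1 U (\<lambda>_. f)" and nz: "\<And>x. x \<in> U \<Longrightarrow> f x \<noteq> 0"
  shows "moderate_upto k 1 U (\<lambda>_ x. inverse (f x))"
proof (induction k)
  have cont: "continuous_on U (\<lambda>x. inverse (f x))"
    using moderate_upto_continuous[OF f, of 1] nz by (intro continuous_on_inverse) auto
  {
    case 0
    then show ?case using cont locally_moderate_static[OF cont] by simp
  next
    case (Suc k)
    show ?case
    proof (rule moderate_upto_SucI[OF U zero_less_one locally_moderate_static[OF cont]])
      show "((\<lambda>x. inverse (f x)) has_derivative
          (\<lambda>h. - (inverse (f x) * frechet_derivative f (at x) h * inverse (f x)))) (at x)"
        if "\<epsilon> \<in> {0<..1::real}" "x \<in> U" for \<epsilon> x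
        using moderate_upto_has_derivative[OF f that] nz[OF that(2)] by (intro Deriv.has_derivative_inverse) auto
      show "moderate_upto k 1 U (\<lambda>_ x. - (inverse (f x) * frechet_derivative f (at x) b * inverse (f x)))"
        if "b \<in> Basis" for b
        by (rule moderate_upto_linear[OF bounded_linear_minus[OF bounded_linear_ident] U zero_less_one
              moderate_upto_bilinear[OF bounded_bilinear_mult U zero_less_one
                moderate_upto_bilinear[OF bounded_bilinear_mult U zero_less_one Suc.IH
                  moderate_upto_derivative[OF f that]] Suc.IH]])
    qed
  }
qed

lemma moderate_upto_static_affine:
  fixes f :: "real \<Rightarrow> real"
  assumes f: "\<And>k. moderate_upto k 1 UNIV (\<lambda>_. f)"
  shows "moderate_upto k 1 UNIV (\<lambda>_ t. f (c * t + d))"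
proof (rule moderate_upto_compose[OF open_UNIV zero_less_one open_UNIV f])
  show "moderate_upto k 1 UNIV (\<lambda>_ t. c * t + d)"
    by (rule moderate_upto_add[OF open_UNIV zero_less_one
          moderate_upto_id_linear[OF bounded_linear_mult_right open_UNIV zero_less_one] moderate_upto_const])
  show "compactly_maps UNIV UNIV (\<lambda>_ t. c * t + d)"
    by (rule compactly_maps_static) (auto intro!: continuous_intros)
qed auto

text \<open>The quotient \<open>e(x) / (e(x) + e(1 - x))\<close> with \<open>e(x) = exp (- 1 / x)\<close> for \<open>x > 0\<close> and \<open>e(x) = 0\<close> otherwise.\<close>

lemma smooth_step_exists:
  obtains S :: "real \<Rightarrow> real" where "\<And>k. moderate_upto k 1 UNIV (\<lambda>_. S)"
    "\<And>x. 0 \<le> S x" "\<And>x. S x \<le> 1" "\<And>x. x \<le> 0 \<Longrightarrow> S x = 0" "\<And>x. x \<ge> 1 \<Longrightarrow> S x = 1"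
proof -
  let ?g = "flat_exp 0"
  define d where "d x = ?g x + ?g (- 1 * x + 1)" for x
  have g: "?g x \<ge> 0" "x > 0 \<Longrightarrow> ?g x > 0" "x \<le> 0 \<Longrightarrow> ?g x = 0" for x by (auto simp: flat_exp_def)
  have d0: "d x > 0" for x
  proof (cases "x > 0")
    case True
    then show ?thesis using g(2)[OF True] g(1)[of "- 1 * x + 1"] by (simp add: d_def)
  next
    case False
    then show ?thesis using g(2)[of "- 1 * x + 1"] g(1)[of x] by (simp add: d_def)
  qed
  have d: "moderate_upto k 1 UNIV (\<lambda>_. d)" for k
    unfolding d_def[abs_def]
    by (rule moderate_upto_add[OF open_UNIV zero_less_one flat_exp_smooth moderate_upto_static_affine[OF flat_exp_smooth]])
  define S where "S x = ?g x * inverse (d x)" for x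
  show ?thesis
  proof (rule that[of S])
    have nz: "d x \<noteq> 0" for x using d0[of x] by simp
    show "moderate_upto k 1 UNIV (\<lambda>_. S)" for k
      unfolding S_def[abs_def]
      by (rule moderate_upto_bilinear[OF bounded_bilinear_mult open_UNIV zero_less_one flat_exp_smooth
            moderate_upto_static_inverse[OF open_UNIV d nz]])
    show "0 \<le> S x" for x using d0[of x] g(1)[of x] by (simp add: S_def)
    show "S x \<le> 1" for x
      using d0[of x] g(1)[of "- 1 * x + 1"] by (simp add: S_def divide_inverse[symmetric] d_def)
    show "S x = 0" if "x \<le> 0" for x using g(3)[OF that] by (simp add: S_def)
    show "S x = 1" if "x \<ge> 1" for x
      using d0[of x] g(3)[of "- 1 * x + 1"] that by (simp add: S_def d_def)
  qed
qed

lemma smooth_cutoff_exists: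
  fixes t0 r \<eta> :: real
  assumes "\<eta> > 0"
  shows "\<exists>\<kappa>. (\<forall>k. moderate_upto k 1 UNIV (\<lambda>_. \<kappa>)) \<and> (\<forall>t. 0 \<le> \<kappa> t \<and> \<kappa> t \<le> (1::real)) \<and>
    (\<forall>t. \<bar>t - t0\<bar> \<le> r - \<eta> \<longrightarrow> \<kappa> t = 1) \<and> (\<forall>t. \<bar>t - t0\<bar> \<ge> r \<longrightarrow> \<kappa> t = 0)"
proof -
  obtain S :: "real \<Rightarrow> real" where S: "\<And>k. moderate_upto k 1 UNIV (\<lambda>_. S)"
    "\<And>x. 0 \<le> S x" "\<And>x. S x \<le> 1" "\<And>x. x \<le> 0 \<Longrightarrow> S x = 0" "\<And>x. x \<ge> 1 \<Longrightarrow> S x = 1"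
    by (rule smooth_step_exists) blast
  define l where "l t = (1 / \<eta>) * t + (r - t0) / \<eta>" for t
  define u where "u t = (- 1 / \<eta>) * t + (r + t0) / \<eta>" for t
  have lu: "l t = (r + (t - t0)) / \<eta>" "u t = (r - (t - t0)) / \<eta>" for t
    by (simp_all add: l_def u_def diff_divide_distrib add_divide_distrib)
  show ?thesis
  proof (intro exI[of _ "\<lambda>t. S (l t) * S (u t)"] conjI allI impI)
    show "moderate_upto k 1 UNIV (\<lambda>_ t. S (l t) * S (u t))" for k
      unfolding l_def u_def
      by (rule moderate_upto_bilinear[OF bounded_bilinear_mult open_UNIV zero_less_one
            moderate_upto_static_affine[OF S(1)] moderate_upto_static_affine[OF S(1)]])
    show "0 \<le> S (l t) * S (u t)" "S (l t) * S (u t) \<le> 1" for t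
      using S(2,3) by (auto intro: mult_le_one)
    show "S (l t) * S (u t) = 1" if "\<bar>t - t0\<bar> \<le> r - \<eta>" for t
      using that assms by (simp add: S(5) lu abs_le_iff)
    show "S (l t) * S (u t) = 0" if "\<bar>t - t0\<bar> \<ge> r" for t
    proof (cases "t - t0 \<ge> r")
      case True
      then have "u t \<le> 0" using assms by (simp add: lu divide_le_0_iff)
      then show ?thesis by (simp add: S(4))
    next
      case False
      then have "l t \<le> 0" using assms that by (simp add: lu divide_le_0_iff)
      then show ?thesis by (simp add: S(4))
    qed
  qed
qed

text \<open>On a compact set the derivatives, however large elsewhere, vanish for small \<open>\<epsilon>\<close>, because the net is constant on a
  neighbourhood.\<close>

lemma moderate_upto_eventually_constant:
  fixes f :: "('a::euclidean_space, 'b::euclidean_space) net"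
  assumes U: "open U" and e: "e > 0" and smooth: "\<And>\<epsilon> j. \<epsilon> \<in> {0<..e} \<Longrightarrow> moderate_upto j 1 U (\<lambda>_. f \<epsilon>)"
    and const: "\<And>K. K \<subset>\<subset> U \<Longrightarrow> \<forall>\<^sub>F \<epsilon> in at_right 0. \<forall>x\<in>K. f \<epsilon> x = c"
  shows "moderate_upto k e U f"
  using smooth const
proof (induction k arbitrary: f c)
  have mod: "locally_moderate U f" if "\<And>K. K \<subset>\<subset> U \<Longrightarrow> \<forall>\<^sub>F \<epsilon> in at_right 0. \<forall>x\<in>K. f \<epsilon> x = c"
    for f :: "('a, 'b) net" and c
    unfolding locally_moderate_def
  proof (intro allI impI)
    fix K assume "K \<subset>\<subset> U"
    from that[OF this] show "moderate_on K f"
      by (intro moderate_on_bounded[where C = "norm c"]) (auto elim: eventually_mono)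
  qed
  {
    case 0
    have "continuous_on U (f \<epsilon>)" if "\<epsilon> \<in> {0<..e}" for \<epsilon>
      using moderate_upto_continuous[OF 0(1)[OF that, of 0], of 1] by simp
    then show ?case using mod[OF 0(2)] by simp
  next
    case (Suc k)
    have d: "(f \<epsilon> has_derivative frechet_derivative (f \<epsilon>) (at x)) (at x)" if "\<epsilon> \<in> {0<..e}" "x \<in> U" for \<epsilon> x
      using moderate_upto_has_derivative[OF Suc.prems(1)[OF that(1), of "Suc 0"], of 1 x] that by simp
    show ?case
    proof (rule moderate_upto_SucI[OF U e mod[OF Suc.prems(2)] d])
      fix b :: 'a assume b: "b \<in> Basis"
      show "moderate_upto k e U (\<lambda>\<epsilon> x. frechet_derivative (f \<epsilon>) (at x) b)"
      proof (rule Suc.IH)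
        show "moderate_upto j 1 U (\<lambda>_ x. frechet_derivative (f \<epsilon>) (at x) b)" if "\<epsilon> \<in> {0<..e}" for \<epsilon> j
          by (rule moderate_upto_derivative[OF Suc.prems(1)[OF that] b])
        fix K assume K: "K \<subset>\<subset> U"
        obtain r where r: "r > 0" "(\<Union>x\<in>K. cball x r) \<subset>\<subset> U" by (rule cpt_inside_tube[OF K U])
        from Suc.prems(2)[OF r(2)]
        show "\<forall>\<^sub>F \<epsilon> in at_right 0. \<forall>x\<in>K. frechet_derivative (f \<epsilon>) (at x) b = 0"
        proof eventually_elim
          case (elim \<epsilon>)
          show ?case
          proof
            fix x assume x: "x \<in> K"
            have "((\<lambda>_. c) has_derivative (\<lambda>_. 0)) (at x)" by (rule has_derivative_const)
            then have "(f \<epsilon> has_derivative (\<lambda>_. 0)) (at x)"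
            proof (rule has_derivative_transform_within_open[OF _ open_ball])
              show "x \<in> ball x r" using r by simp
              show "c = f \<epsilon> y" if "y \<in> ball x r" for y
              proof -
                have "y \<in> (\<Union>x\<in>K. cball x r)" using x that ball_subset_cball by blast
                then show ?thesis using elim by fastforce
              qed
            qed
            from frechet_derivative_at[OF this] show "frechet_derivative (f \<epsilon>) (at x) b = 0" by metis
          qed
        qed
      qed
    qed
  }
qed

section \<open>The solution net\<close>

lemma compact_in_ball_real:
  fixes K :: "real set"
  assumes "compact K" "K \<subseteq> {t0 - h<..<t0 + h}" "h > 0"
  obtains \<rho> where "0 \<le> \<rho>" "\<rho> < h" "\<And>t. t \<in> K \<Longrightarrow> \<bar>t - t0\<bar> \<le> \<rho>"
proof -
  have "t0 - h < t0" "t0 \<le> t0" "t0 < t0 + h" using assms(3) by auto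
  then obtain c1 d1 where c1: "t0 - h < c1" "d1 < t0 + h" "K \<subseteq> {c1..d1}" "c1 \<le> t0" "t0 \<le> d1"
    by (rule compact_in_open_interval[OF assms(1,2)])
  then show ?thesis by (intro that[of "max (t0 - c1) (d1 - t0)"]) (auto simp: abs_le_iff max_def)
qed

lemma ode_displacement:
  fixes y :: "real \<Rightarrow> 'x::euclidean_space"
  assumes J: "convex J" "s \<in> J" "t \<in> J"
    and deriv: "\<And>r. r \<in> J \<Longrightarrow> (y has_vector_derivative y' r) (at r)"
    and bound: "\<And>r. r \<in> J \<Longrightarrow> r \<in> {min s t..max s t} \<Longrightarrow> norm (y' r) \<le> B"
  shows "norm (y t - y s) \<le> B * \<bar>t - s\<bar>"
proof -
  have "closed_segment s t \<subseteq> J" using J by (simp add: closed_segment_subset)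
  then have sub: "{min s t..max s t} \<subseteq> J" by (auto simp: closed_segment_eq_real_ivl split: if_splits)
  have "norm (y t - y s) \<le> B * \<bar>t - s\<bar> ^ Suc 0 / real (Suc 0)"
    by (rule power_bound_integrated[where c = "min s t" and d = "max s t" and f' = y'])
      (use sub bound in \<open>auto intro!: has_vector_derivative_at_within[OF deriv]\<close>)
  then show ?thesis by simp
qed

text \<open>Composing \<open>g\<close> with the nearest-point projection onto the ball, which is Lipschitz with constant \<open>1\<close>, gives a field that is globally
  Lipschitz in the state and still bounded by \<open>a\<close>, so its solution exists on all of \<open>J\<close>.  The field moves the state only
  while \<open>\<bar>t - t0\<bar> < r\<close>, that is for a time of at most \<open>r + \<bar>s - t0\<bar>\<close> in either direction; hence the solution never leaves the ball
  and does not notice the projection.\<close>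

lemma flow_exists_fixed:
  fixes g :: "('p::euclidean_space \<times> real) \<times> 'x::euclidean_space \<Rightarrow> 'x" and h t0 :: real
  defines "J \<equiv> {t0 - h<..<t0 + h}"
  assumes g: "C1_on ((P \<times> J) \<times> U) g" and X: "cball \<xi> \<beta> \<subseteq> U" and \<beta>: "\<beta> > 0" and p: "p \<in> P"
    and a: "a > 0" "a * (r + \<bar>s - t0\<bar>) < \<beta>" and s: "\<bar>s - t0\<bar> < r" and r: "r < h"
    and bound: "\<And>t x. t \<in> J \<Longrightarrow> x \<in> cball \<xi> \<beta> \<Longrightarrow> norm (g ((p, t), x)) \<le> a"
    and zero: "\<And>t x. t \<in> J \<Longrightarrow> \<bar>t - t0\<bar> \<ge> r \<Longrightarrow> g ((p, t), x) = 0"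
  shows "\<exists>y. y s = \<xi> \<and> (\<forall>t\<in>J. (y has_vector_derivative g ((p, t), y t)) (at t) \<and>
    norm (y t - \<xi>) \<le> a * \<bar>t - s\<bar> \<and> y t \<in> ball \<xi> \<beta>)"
proof -
  define \<pi> where "\<pi> = closest_point (cball \<xi> \<beta>)"
  have ne: "convex (cball \<xi> \<beta>)" "closed (cball \<xi> \<beta>)" "cball \<xi> \<beta> \<noteq> {}" using \<beta> by auto
  have \<pi>: "\<pi> x \<in> cball \<xi> \<beta>" for x unfolding \<pi>_def by (rule closest_point_in_set[OF ne(2,3)])
  have \<pi>U: "\<pi> x \<in> U" for x using \<pi>[of x] X by auto
  have sJ: "s \<in> J" using s r by (auto simp: J_def)
  have gc: "continuous_on ((P \<times> J) \<times> U) g"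
    by (rule C1_on_continuous[OF g])
  have "\<exists>y. y s = \<xi> \<and> (\<forall>t\<in>J. (y has_vector_derivative g ((p, t), \<pi> (y t))) (at t))"
    unfolding J_def
  proof (rule picard_lindelof_open)
    show "s \<in> {t0 - h<..<t0 + h}" using sJ by (simp add: J_def)
    show "continuous_on ({t0 - h<..<t0 + h} \<times> UNIV) (\<lambda>(t, x). g ((p, t), \<pi> x))"
      unfolding split_def
    proof (rule continuous_on_compose2[OF gc])
      have c\<pi>: "continuous_on UNIV \<pi>" unfolding \<pi>_def by (rule continuous_on_closest_point[OF ne])
      show "continuous_on ({t0 - h<..<t0 + h} \<times> UNIV) (\<lambda>z. ((p, fst z), \<pi> (snd z)))"
        by (rule continuous_on_Pair[OF continuous_on_Pair[OF continuous_on_const continuous_on_fst[OF continuous_on_id]]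
              continuous_on_compose2[OF c\<pi> continuous_on_snd[OF continuous_on_id] subset_UNIV]])
      show "(\<lambda>z. ((p, fst z), \<pi> (snd z))) ` ({t0 - h<..<t0 + h} \<times> UNIV) \<subseteq> (P \<times> J) \<times> U"
        using p \<pi>U by (auto simp: J_def)
    qed
    fix c' d' assume cd: "t0 - h < c'" "d' < t0 + h"
    have K: "compact ({p} \<times> {c'..d'})" "{p} \<times> {c'..d'} \<subseteq> P \<times> J"
      using cd p by (auto simp: J_def intro!: compact_Times)
    obtain k where k: "\<forall>z\<in>{p} \<times> {c'..d'}. k-lipschitz_on (cball \<xi> \<beta>) (\<lambda>x. g (z, x))"
      using C1_on_lipschitz_second[OF g K compact_cball convex_cball X] by blast
    have "k-lipschitz_on UNIV (\<lambda>x. g ((p, t), \<pi> x))" if t: "t \<in> {c'..d'}" for t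
    proof (rule lipschitz_onI)
      have l: "k-lipschitz_on (cball \<xi> \<beta>) (\<lambda>x. g ((p, t), x))" using k t by auto
      show "k \<ge> 0" by (rule lipschitz_on_nonneg[OF l])
      fix x x'
      have "dist (g ((p, t), \<pi> x)) (g ((p, t), \<pi> x')) \<le> k * dist (\<pi> x) (\<pi> x')"
        by (rule lipschitz_onD[OF l \<pi> \<pi>])
      also have "\<dots> \<le> k * dist x x'"
        unfolding \<pi>_def by (rule mult_left_mono[OF closest_point_lipschitz[OF ne] lipschitz_on_nonneg[OF l]])
      finally show "dist (g ((p, t), \<pi> x)) (g ((p, t), \<pi> x')) \<le> k * dist x x'" .
    qed
    then show "\<exists>k. \<forall>t\<in>{c'..d'}. k-lipschitz_on UNIV (\<lambda>x. g ((p, t), \<pi> x))" by blast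
  qed
  then obtain y where y: "y s = \<xi>" "\<And>t. t \<in> J \<Longrightarrow> (y has_vector_derivative g ((p, t), \<pi> (y t))) (at t)"
    by blast
  have cJ: "convex J" by (simp add: J_def)
  have disp: "norm (y t - \<xi>) \<le> a * \<bar>t - s\<bar>" if "t \<in> J" for t
    using ode_displacement[OF cJ sJ that y(2), where B = a] bound \<pi> y(1) by simp
  have near: "norm (y t - \<xi>) < \<beta>" if "t \<in> J" "\<bar>t - t0\<bar> \<le> r" for t
  proof -
    have "norm (y t - \<xi>) \<le> a * \<bar>t - s\<bar>" by (rule disp[OF that(1)])
    also have "\<dots> \<le> a * (r + \<bar>s - t0\<bar>)" using that(2) a by (intro mult_left_mono) auto
    finally show ?thesis using a by simp
  qed
  have inball: "norm (y t - \<xi>) < \<beta>" if t: "t \<in> J" for t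
  proof (cases "\<bar>t - t0\<bar> \<le> r")
    case True
    then show ?thesis by (rule near[OF t])
  next
    case False
    (* Beyond the time t1 the field vanishes and the solution rests. *)
    define t1 where "t1 = (if t > t0 then t0 + r else t0 - r)"
    have t1: "t1 \<in> J" "\<bar>t1 - t0\<bar> \<le> r" using r s by (auto simp: t1_def J_def)
    have "norm (y t - y t1) \<le> 0 * \<bar>t - t1\<bar>"
    proof (rule ode_displacement[OF cJ t1(1) t y(2)])
      fix q assume q: "q \<in> J" "q \<in> {min t1 t..max t1 t}"
      have "\<bar>q - t0\<bar> \<ge> r" using q(2) False by (auto simp: t1_def split: if_splits)
      then show "norm (g ((p, q), \<pi> (y q))) \<le> 0" by (simp add: zero[OF q(1)])
    qed
    then show ?thesis using near[OF t1] by simp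
  qed
  have "\<pi> (y t) = y t" if "t \<in> J" for t
    unfolding \<pi>_def using inball[OF that] by (intro closest_point_self) (simp add: dist_norm norm_minus_commute)
  then show ?thesis
    using y disp inball by (intro exI[of _ y]) (auto simp: dist_norm norm_minus_commute)
qed

lemma eventually_delay_small:
  assumes "(\<tau> \<longlongrightarrow> t0) (at_right (0::real))" "r > (0::real)"
  shows "\<forall>\<^sub>F \<epsilon> in at_right 0. \<bar>\<tau> \<epsilon> - t0\<bar> < r"
  using tendstoD[OF assms] by (simp add: dist_real_def)

text \<open>The radius of the support is chosen such that the time from \<open>\<tau> \<epsilon>\<close> to its far end is \<open>h - \<epsilon> h / 4 < h\<close>, while the
  region where the cutoff is \<open>1\<close> still exhausts the interval.\<close>

lemma cutoff_net_exists:
  fixes t0 h e :: real and \<tau> :: "real \<Rightarrow> real"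
  assumes h: "h > 0" and e: "e > 0" and lim: "(\<tau> \<longlongrightarrow> t0) (at_right 0)"
  obtains \<kappa> :: "(real, real) net"
  where "\<And>k. moderate_upto k e {t0 - h<..<t0 + h} \<kappa>" "\<And>\<epsilon> t. \<epsilon> > 0 \<Longrightarrow> 0 \<le> \<kappa> \<epsilon> t \<and> \<kappa> \<epsilon> t \<le> 1"
    "\<And>\<epsilon> t. \<epsilon> > 0 \<Longrightarrow> \<bar>t - t0\<bar> \<ge> h - \<bar>\<tau> \<epsilon> - t0\<bar> - \<epsilon> * (h / 4) \<Longrightarrow> \<kappa> \<epsilon> t = 0"
    "\<And>K. K \<subset>\<subset> {t0 - h<..<t0 + h} \<Longrightarrow> \<forall>\<^sub>F \<epsilon> in at_right 0. \<forall>t\<in>K. \<kappa> \<epsilon> t = 1"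
proof -
  define r where "r \<epsilon> = h - \<bar>\<tau> \<epsilon> - t0\<bar> - \<epsilon> * (h / 4)" for \<epsilon>
  have "\<exists>\<kappa>. (\<forall>k. moderate_upto k 1 UNIV (\<lambda>_. \<kappa>)) \<and> (\<forall>t. 0 \<le> \<kappa> t \<and> \<kappa> t \<le> (1::real)) \<and>
      (\<forall>t. \<bar>t - t0\<bar> \<le> r \<epsilon> - \<epsilon> * (h / 4) \<longrightarrow> \<kappa> t = 1) \<and> (\<forall>t. \<bar>t - t0\<bar> \<ge> r \<epsilon> \<longrightarrow> \<kappa> t = 0)" if "\<epsilon> > 0" for \<epsilon>
    using h that by (intro smooth_cutoff_exists) simp
  then obtain \<kappa> where \<kappa>: "\<And>\<epsilon> k. \<epsilon> > 0 \<Longrightarrow> moderate_upto k 1 UNIV (\<lambda>_. \<kappa> \<epsilon>)"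
    "\<And>\<epsilon> t. \<epsilon> > 0 \<Longrightarrow> 0 \<le> \<kappa> \<epsilon> t \<and> \<kappa> \<epsilon> t \<le> (1::real)"
    "\<And>\<epsilon> t. \<epsilon> > 0 \<Longrightarrow> \<bar>t - t0\<bar> \<le> r \<epsilon> - \<epsilon> * (h / 4) \<Longrightarrow> \<kappa> \<epsilon> t = 1"
    "\<And>\<epsilon> t. \<epsilon> > 0 \<Longrightarrow> \<bar>t - t0\<bar> \<ge> r \<epsilon> \<Longrightarrow> \<kappa> \<epsilon> t = 0"
    by metis
  have one: "\<forall>\<^sub>F \<epsilon> in at_right 0. \<forall>t\<in>K. \<kappa> \<epsilon> t = 1" if K: "K \<subset>\<subset> {t0 - h<..<t0 + h}" for K
  proof -
    obtain \<rho> where \<rho>: "0 \<le> \<rho>" "\<rho> < h" "\<And>t. t \<in> K \<Longrightarrow> \<bar>t - t0\<bar> \<le> \<rho>"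
      by (rule compact_in_ball_real[OF cpt_insideD(1)[OF K] cpt_insideD(2)[OF K] h]) blast
    have "\<forall>\<^sub>F \<epsilon> in at_right 0. \<bar>\<tau> \<epsilon> - t0\<bar> < (h - \<rho>) / 2" using \<rho> by (intro eventually_delay_small[OF lim]) simp
    moreover have "\<forall>\<^sub>F \<epsilon> in at_right 0. \<epsilon> \<in> {0<..(h - \<rho>) / h}" using \<rho> h by (intro eventually_at_right_0_Ioc) simp
    ultimately show ?thesis
    proof eventually_elim
      case (elim \<epsilon>)
      have "\<epsilon> * h \<le> h - \<rho>" using elim(2) h by (simp add: field_simps)
      then have "\<rho> \<le> r \<epsilon> - \<epsilon> * (h / 4)" using elim(1) by (simp add: r_def)
      then show ?case using \<rho>(3) elim(2) by (intro ballI \<kappa>(3)) force+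
    qed
  qed
  show ?thesis
  proof (rule that[of \<kappa>])
    show "moderate_upto k e {t0 - h<..<t0 + h} \<kappa>" for k
    proof (rule moderate_upto_eventually_constant[OF open_greaterThanLessThan e _ one])
      show "moderate_upto j 1 {t0 - h<..<t0 + h} (\<lambda>_. \<kappa> \<epsilon>)" if "\<epsilon> \<in> {0<..e}" for \<epsilon> j
        by (rule moderate_upto_subset[OF \<kappa>(1)]) (use that in auto)
    qed
  qed (use \<kappa> one in \<open>auto simp: r_def\<close>)
qed

lemma compactly_maps_mono:
  assumes "compactly_maps U V f" "V \<subseteq> V'" "open V'"
  shows "compactly_maps U V' f"
  unfolding compactly_maps_def
proof (intro allI impI)
  fix K assume "K \<subset>\<subset> U"
  then obtain L where L: "L \<subset>\<subset> V" "\<forall>\<^sub>F \<epsilon> in at_right 0. f \<epsilon> ` K \<subseteq> L"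
    using assms(1) unfolding compactly_maps_def by blast
  have "L \<subset>\<subset> V'" by (rule cpt_insideI[OF cpt_insideD(1)[OF L(1)] order_trans[OF cpt_insideD(2)[OF L(1)] assms(2)] assms(3)])
  then show "\<exists>L. L \<subset>\<subset> V' \<and> (\<forall>\<^sub>F \<epsilon> in at_right 0. f \<epsilon> ` K \<subseteq> L)" using L(2) by blast
qed

lemma c_bounded_mono:
  assumes "c_bounded U V u" "V \<subseteq> V'" "open V'"
  shows "c_bounded U V' u"
proof -
  have u: "u \<in> moderate_nets U" "\<forall>\<^sub>F \<epsilon> in at_right 0. u \<epsilon> ` U \<subseteq> V" "compactly_maps U V u"
    using assms(1) by (auto simp: c_bounded_iff)
  have "\<forall>\<^sub>F \<epsilon> in at_right 0. u \<epsilon> ` U \<subseteq> V'" using u(2) by eventually_elim (use assms(2) in blast)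
  then show ?thesis unfolding c_bounded_iff using u(1) compactly_maps_mono[OF u(3) assms(2,3)] by blast
qed

lemma partial_has_derivative:
  assumes F: "F \<in> moderate_nets (I \<times> U \<times> P)" and "\<epsilon> \<in> {0<..1}" "t \<in> I" "x \<in> U" "p \<in> P"
  shows "((\<lambda>x. F \<epsilon> (t, x, p)) has_derivative frechet_derivative (\<lambda>x. F \<epsilon> (t, x, p)) (at x)) (at x)"
proof -
  have "moderate_upto (Suc 0) 1 (I \<times> U \<times> P) F" using F unfolding moderate_nets_iff by blast
  then have dF: "(F \<epsilon> has_derivative frechet_derivative (F \<epsilon>) (at (t, x, p))) (at (t, x, p))"
    by (rule moderate_upto_has_derivative) (use assms in auto)
  have "((\<lambda>x. (t, x, p)) has_derivative (\<lambda>h. (0, h, 0))) (at x)"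
    by (intro has_derivative_Pair has_derivative_const has_derivative_ident)
  from has_derivative_compose[OF this dF]
  have "(\<lambda>x. F \<epsilon> (t, x, p)) differentiable (at x)" by (rule differentiableI)
  then show ?thesis by (simp add: frechet_derivative_works)
qed

text \<open>The solutions for the truncated fields \<open>\<kappa> \<epsilon> t *\<^sub>R F \<epsilon> (t, x, p)\<close>.  The truncated fields form a moderate net with the same
  logarithmic bound because \<open>0 \<le> \<kappa> \<le> 1\<close>.  On a compact subset of \<open>J\<close> the distance to the initial value is at most \<open>a\<close> times the
  elapsed time, which stays below \<open>\<beta>\<close> uniformly; this is c-boundedness into the open neighbourhood of \<open>L\<close>.\<close>

lemma flow_net_exists:
  fixes I :: "real set" and U :: "'x::euclidean_space set" and P :: "'p::euclidean_space set"
    and F :: "(real \<times> 'x \<times> 'p, 'x) net" and h t0 :: real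
  defines "J \<equiv> {t0 - h<..<t0 + h}"
  assumes I: "open I" and U: "open U" and P: "open P" and F: "F \<in> moderate_nets (I \<times> U \<times> P)"
    and h: "h > 0" and JI: "J \<subseteq> I" and L: "compact L" and L\<beta>: "(\<Union>x\<in>L. cball x \<beta>) \<subseteq> U"
    and a: "a > 0" and \<beta>: "\<beta> > 0" "a * h \<le> \<beta>" and e0: "e0 \<in> {0<..1}"
    and bound: "\<And>\<epsilon> t x p. \<epsilon> \<in> {0<..e0} \<Longrightarrow> t \<in> J \<Longrightarrow> x \<in> (\<Union>x\<in>L. cball x \<beta>) \<Longrightarrow> p \<in> P \<Longrightarrow> norm (F \<epsilon> (t, x, p)) \<le> a"
    and log: "\<And>K. compact K \<Longrightarrow> K \<subseteq> P \<Longrightarrow> \<exists>C. \<forall>\<^sub>F \<epsilon> in at_right 0. \<forall>t\<in>J. \<forall>x\<in>(\<Union>x\<in>L. cball x \<beta>). \<forall>p\<in>K. \<forall>v.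
      norm (frechet_derivative (\<lambda>y. F \<epsilon> (t, y, p)) (at x) v) \<le> C * \<bar>ln \<epsilon>\<bar> * norm v"
    and lim: "(\<tau> \<longlongrightarrow> t0) (at_right 0)" and \<xi>: "\<And>\<epsilon>. \<epsilon> \<in> {0<..e0} \<Longrightarrow> \<xi> \<epsilon> \<in> L"
  obtains u where "c_bounded (P \<times> J) (\<Union>x\<in>L. ball x \<beta>) u"
    "\<forall>\<^sub>F \<epsilon> in at_right 0. \<forall>p\<in>P. u \<epsilon> (p, \<tau> \<epsilon>) = \<xi> \<epsilon> \<and> (\<forall>t\<in>J. norm (u \<epsilon> (p, t) - \<xi> \<epsilon>) \<le> a * \<bar>t - \<tau> \<epsilon>\<bar>)"
    "\<And>K. K \<subset>\<subset> J \<Longrightarrow> \<forall>\<^sub>F \<epsilon> in at_right 0. \<forall>p\<in>P. \<forall>t\<in>K.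
      ((\<lambda>t. u \<epsilon> (p, t)) has_vector_derivative F \<epsilon> (t, u \<epsilon> (p, t), p)) (at t)"
proof -
  have op: "open J" "open (P \<times> J)" "open ((P \<times> J) \<times> U)" "open (I \<times> U \<times> P)"
    using I U P by (auto simp: J_def intro!: open_Times)
  obtain e where e: "0 < e" "e \<le> e0" "\<And>\<epsilon>. \<epsilon> \<in> {0<..e} \<Longrightarrow> \<bar>\<tau> \<epsilon> - t0\<bar> < h / 8"
  proof -
    have "\<forall>\<^sub>F \<epsilon> in at_right 0. \<bar>\<tau> \<epsilon> - t0\<bar> < h / 8" using h by (intro eventually_delay_small[OF lim]) simp
    then obtain e1 where "e1 \<in> {0<..1}" "\<forall>\<epsilon>\<in>{0<..e1}. \<bar>\<tau> \<epsilon> - t0\<bar> < h / 8"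
      unfolding eventually_Ioc_iff[symmetric] by blast
    then show ?thesis using e0 by (intro that[of "min e0 e1"]) auto
  qed
  have e1: "e \<le> 1" using e e0 by simp
  obtain \<kappa> :: "(real, real) net" where \<kappa>: "\<And>k. moderate_upto k e J \<kappa>" "\<And>\<epsilon> t. \<epsilon> > 0 \<Longrightarrow> 0 \<le> \<kappa> \<epsilon> t \<and> \<kappa> \<epsilon> t \<le> 1"
    "\<And>\<epsilon> t. \<epsilon> > 0 \<Longrightarrow> \<bar>t - t0\<bar> \<ge> h - \<bar>\<tau> \<epsilon> - t0\<bar> - \<epsilon> * (h / 4) \<Longrightarrow> \<kappa> \<epsilon> t = 0"
    "\<And>K. K \<subset>\<subset> J \<Longrightarrow> \<forall>\<^sub>F \<epsilon> in at_right 0. \<forall>t\<in>K. \<kappa> \<epsilon> t = 1"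
    unfolding J_def by (rule cutoff_net_exists[OF h e(1) lim]) blast
  define G where "G \<epsilon> w = \<kappa> \<epsilon> (snd (fst w)) *\<^sub>R F \<epsilon> (snd (fst w), snd w, fst (fst w))" for \<epsilon> and w :: "('p \<times> real) \<times> 'x"
  have G: "moderate_upto k e ((P \<times> J) \<times> U) G" for k
    unfolding G_def[abs_def]
  proof (rule moderate_upto_scaleR[OF op(3) e(1)])
    have bl: "bounded_linear (\<lambda>w::('p \<times> real) \<times> 'x. snd (fst w))" "bounded_linear (\<lambda>w::('p \<times> real) \<times> 'x. fst (fst w))"
      by (intro bounded_linear_compose[OF bounded_linear_snd bounded_linear_fst]
          bounded_linear_compose[OF bounded_linear_fst bounded_linear_fst])+
    show "moderate_upto k e ((P \<times> J) \<times> U) (\<lambda>\<epsilon> w. \<kappa> \<epsilon> (snd (fst w)))"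
      by (rule moderate_upto_compose[where f = \<kappa> and g = "\<lambda>_ w. snd (fst w)",
            OF op(3) e(1) op(1) \<kappa>(1) moderate_upto_id_linear[OF bl(1) op(3) e(1)] _
              compactly_maps_static[OF linear_continuous_on[OF bl(1)] _ op(1)]]) auto
    have bl3: "bounded_linear (\<lambda>w::('p \<times> real) \<times> 'x. (snd (fst w), snd w, fst (fst w)))"
      by (intro bounded_linear_Pair bl bounded_linear_snd)
    have F': "moderate_upto k e (I \<times> U \<times> P) F"
      using F e1 moderate_upto_e_mono[of k 1 _ F e] by (simp add: moderate_nets_iff)
    show "moderate_upto k e ((P \<times> J) \<times> U) (\<lambda>\<epsilon> w. F \<epsilon> (snd (fst w), snd w, fst (fst w)))"
      by (rule moderate_upto_compose[where f = F and g = "\<lambda>_ w. (snd (fst w), snd w, fst (fst w))",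
            OF op(3) e(1) op(4) F' moderate_upto_id_linear[OF bl3 op(3) e(1)] _
              compactly_maps_static[OF linear_continuous_on[OF bl3] _ op(4)]]) (use JI in auto)
  qed
  have C1: "C1_on ((P \<times> J) \<times> U) (G \<epsilon>)" if "\<epsilon> \<in> {0<..e}" for \<epsilon> by (rule moderate_upto_C1_on[OF G that])
  have ball: "cball (\<xi> \<epsilon>) \<beta> \<subseteq> (\<Union>x\<in>L. cball x \<beta>)" if "\<epsilon> \<in> {0<..e}" for \<epsilon>
    using \<xi>[of \<epsilon>] that e(2) by auto
  have "\<exists>y. y (\<tau> \<epsilon>) = \<xi> \<epsilon> \<and> (\<forall>t\<in>J. (y has_vector_derivative G \<epsilon> ((p, t), y t)) (at t) \<and>
      norm (y t - \<xi> \<epsilon>) \<le> a * \<bar>t - \<tau> \<epsilon>\<bar> \<and> y t \<in> ball (\<xi> \<epsilon>) \<beta>)" if \<epsilon>: "\<epsilon> \<in> {0<..e}" and p: "p \<in> P" for \<epsilon> p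
    unfolding J_def
  proof (rule flow_exists_fixed[OF C1[OF \<epsilon>, unfolded J_def] _ \<beta>(1) p a])
    define r where "r = h - \<bar>\<tau> \<epsilon> - t0\<bar> - \<epsilon> * (h / 4)"
    have small: "\<epsilon> * (h / 4) \<le> h / 4" "\<epsilon> * (h / 4) > 0" using \<epsilon> e1 h by auto
    show "cball (\<xi> \<epsilon>) \<beta> \<subseteq> U" using ball[OF \<epsilon>] L\<beta> by blast
    have "a * (r + \<bar>\<tau> \<epsilon> - t0\<bar>) < a * h" using a small(2) by (simp add: r_def)
    then show "a * (r + \<bar>\<tau> \<epsilon> - t0\<bar>) < \<beta>" using \<beta> by simp
    show "\<bar>\<tau> \<epsilon> - t0\<bar> < r" unfolding r_def using e(3)[OF \<epsilon>] small(1) h by linarith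
    show "r < h" unfolding r_def using small(2) by linarith
    show "norm (G \<epsilon> ((p, t), x)) \<le> a" if "t \<in> {t0 - h<..<t0 + h}" "x \<in> cball (\<xi> \<epsilon>) \<beta>" for t x
    proof -
      have "norm (F \<epsilon> (t, x, p)) \<le> a"
      proof (rule bound[OF _ _ _ p])
        show "\<epsilon> \<in> {0<..e0}" using \<epsilon> e(2) by auto
        show "t \<in> J" using that(1) by (simp add: J_def)
        show "x \<in> (\<Union>x\<in>L. cball x \<beta>)" using ball[OF \<epsilon>] that(2) by blast
      qed
      then have "\<bar>\<kappa> \<epsilon> t\<bar> * norm (F \<epsilon> (t, x, p)) \<le> 1 * a" using \<kappa>(2)[of \<epsilon> t] \<epsilon> by (intro mult_mono) auto
      then show ?thesis by (simp add: G_def)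
    qed
    show "G \<epsilon> ((p, t), x) = 0" if "r \<le> \<bar>t - t0\<bar>" for t x
      using \<kappa>(3)[of \<epsilon> t] that \<epsilon> by (simp add: G_def r_def)
  qed
  then obtain Y where Y: "\<And>\<epsilon> p. \<epsilon> \<in> {0<..e} \<Longrightarrow> p \<in> P \<Longrightarrow> Y \<epsilon> p (\<tau> \<epsilon>) = \<xi> \<epsilon>"
    "\<And>\<epsilon> p t. \<epsilon> \<in> {0<..e} \<Longrightarrow> p \<in> P \<Longrightarrow> t \<in> J \<Longrightarrow> (Y \<epsilon> p has_vector_derivative G \<epsilon> ((p, t), Y \<epsilon> p t)) (at t) \<and>
      norm (Y \<epsilon> p t - \<xi> \<epsilon>) \<le> a * \<bar>t - \<tau> \<epsilon>\<bar> \<and> Y \<epsilon> p t \<in> ball (\<xi> \<epsilon>) \<beta>"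
    by metis
  define y where "y \<epsilon> = (\<lambda>(p, t). Y \<epsilon> p t)" for \<epsilon>
  define W where "W = (\<Union>x\<in>L. ball x \<beta>)"
  have "W \<subseteq> (\<Union>x\<in>L. cball x \<beta>)" unfolding W_def by (intro UN_mono order_refl ball_subset_cball)
  then have W: "open W" "W \<subseteq> U" using L\<beta> by (auto simp: W_def)
  have yW: "y \<epsilon> z \<in> W" if "\<epsilon> \<in> {0<..e}" "z \<in> P \<times> J" for \<epsilon> z
    using Y(2)[OF that(1), of "fst z" "snd z"] that \<xi>[of \<epsilon>] e(2) by (auto simp: y_def W_def split_def)
  have yX: "y \<epsilon> (p, t) \<in> cball (\<xi> \<epsilon>) \<beta>" if "\<epsilon> \<in> {0<..e}" "p \<in> P" "t \<in> J" for \<epsilon> p t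
    using Y(2)[OF that] by (simp add: y_def less_imp_le)
  have yd: "((\<lambda>t. y \<epsilon> (p, t)) has_vector_derivative G \<epsilon> ((p, t), y \<epsilon> (p, t))) (at t)"
    if "\<epsilon> \<in> {0<..e}" "p \<in> P" "t \<in> J" for \<epsilon> p t
    using Y(2)[OF that] by (simp add: y_def)
  have maps: "compactly_maps (P \<times> J) W y"
    unfolding compactly_maps_def
  proof (intro allI impI)
    fix K assume K: "K \<subset>\<subset> P \<times> J"
    have "compact (snd ` K)" by (rule compact_continuous_image[OF continuous_on_snd[OF continuous_on_id] cpt_insideD(1)[OF K]])
    moreover have "snd ` K \<subseteq> J" using cpt_insideD(2)[OF K] by auto
    ultimately obtain \<rho> where \<rho>: "0 \<le> \<rho>" "\<rho> < h" "\<And>t. t \<in> snd ` K \<Longrightarrow> \<bar>t - t0\<bar> \<le> \<rho>"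
      unfolding J_def by (rule compact_in_ball_real[OF _ _ h]) blast
    (* On K the time elapsed since \<tau> \<epsilon> is eventually at most the mean of \<rho> and h. *)
    define \<beta>' where "\<beta>' = a * ((\<rho> + h) / 2)"
    have "\<beta>' < a * h" unfolding \<beta>'_def using a \<rho> by (intro mult_strict_left_mono) auto
    then have \<beta>': "\<beta>' < \<beta>" using \<beta> by simp
    have "(\<Union>x\<in>L. cball x \<beta>') \<subset>\<subset> W"
    proof (rule cpt_insideI[OF compact_Union_cball[OF L] _ W(1)])
      show "(\<Union>x\<in>L. cball x \<beta>') \<subseteq> W" unfolding W_def using \<beta>' by (intro UN_mono order_refl) auto
    qed
    moreover have "\<forall>\<^sub>F \<epsilon> in at_right 0. y \<epsilon> ` K \<subseteq> (\<Union>x\<in>L. cball x \<beta>')"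
    proof -
      have "\<forall>\<^sub>F \<epsilon> in at_right 0. \<bar>\<tau> \<epsilon> - t0\<bar> < (h - \<rho>) / 2" using \<rho> by (intro eventually_delay_small[OF lim]) simp
      with eventually_at_right_0_Ioc[OF e(1)] show ?thesis
      proof eventually_elim
        case (elim \<epsilon>)
        show ?case
        proof
          fix x assume "x \<in> y \<epsilon> ` K"
          then obtain p t where pt: "(p, t) \<in> K" "x = Y \<epsilon> p t" by (auto simp: y_def)
          have ptJ: "p \<in> P" "t \<in> J" using pt(1) cpt_insideD(2)[OF K] by auto
          have "\<bar>t - t0\<bar> \<le> \<rho>" using \<rho>(3) pt(1) by force
          moreover have "\<bar>t - \<tau> \<epsilon>\<bar> \<le> \<bar>t - t0\<bar> + \<bar>\<tau> \<epsilon> - t0\<bar>" by linarith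
          ultimately have "\<bar>t - \<tau> \<epsilon>\<bar> \<le> (\<rho> + h) / 2" using elim(2) unfolding add_divide_distrib diff_divide_distrib by linarith
          then have "a * \<bar>t - \<tau> \<epsilon>\<bar> \<le> \<beta>'" unfolding \<beta>'_def using a by (intro mult_left_mono) auto
          then have "norm (x - \<xi> \<epsilon>) \<le> \<beta>'" using Y(2)[OF elim(1) ptJ] pt(2) by auto
          then have "x \<in> cball (\<xi> \<epsilon>) \<beta>'" by (simp add: dist_norm norm_minus_commute)
          then show "x \<in> (\<Union>x\<in>L. cball x \<beta>')" using \<xi>[of \<epsilon>] elim(1) e(2) by auto
        qed
      qed
    qed
    ultimately show "\<exists>M. M \<subset>\<subset> W \<and> (\<forall>\<^sub>F \<epsilon> in at_right 0. y \<epsilon> ` K \<subseteq> M)" by blast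
  qed
  have mapsU: "compactly_maps (P \<times> J) U y" by (rule compactly_maps_mono[OF maps W(2) U])
  have ym: "moderate_upto k e (P \<times> J) y" for k
  proof (rule ode_moderate[where c = "t0 - h" and d = "t0 + h" and g = G and X = "\<lambda>\<epsilon>. cball (\<xi> \<epsilon>) \<beta>" and \<xi> = \<xi> and s = \<tau>
        and c' = "t0 - h / 8" and d' = "t0 + h / 8", folded J_def, OF P e(1) _ _ _ U G _ _ _ yd _ yX mapsU])
    show "t0 - h < t0 - h / 8" "t0 + h / 8 < t0 + h" using h by auto
    show "\<tau> \<epsilon> \<in> {t0 - h / 8..t0 + h / 8}" if "\<epsilon> \<in> {0<..e}" for \<epsilon> 
      using e(3)[OF that] unfolding atLeastAtMost_iff by linarith
    show "cball (\<xi> \<epsilon>) \<beta> \<subseteq> U" if "\<epsilon> \<in> {0<..e}" for \<epsilon> using ball[OF that] L\<beta> by blast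
    show "y \<epsilon> (p, \<tau> \<epsilon>) = \<xi> \<epsilon>" if "\<epsilon> \<in> {0<..e}" "p \<in> P" for \<epsilon> p using Y(1)[OF that] by (simp add: y_def)
    fix K assume K: "K \<subset>\<subset> P \<times> J"
    have KP: "compact (fst ` K)" "fst ` K \<subseteq> P"
      using cpt_insideD(2)[OF K] by (auto intro!: compact_continuous_image[OF continuous_on_fst[OF continuous_on_id] cpt_insideD(1)[OF K]])
    obtain C where C: "\<forall>\<^sub>F \<epsilon> in at_right 0. \<forall>t\<in>J. \<forall>x\<in>(\<Union>x\<in>L. cball x \<beta>). \<forall>p\<in>fst ` K. \<forall>v.
        norm (frechet_derivative (\<lambda>y. F \<epsilon> (t, y, p)) (at x) v) \<le> C * \<bar>ln \<epsilon>\<bar> * norm v"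
      using log[OF KP] by blast
    from C eventually_at_right_0_Ioc[OF e(1)]
    have "\<forall>\<^sub>F \<epsilon> in at_right 0. \<forall>z\<in>K. \<forall>v. norm (frechet_derivative (G \<epsilon>) (at (z, y \<epsilon> z)) (0, v)) \<le> C * \<bar>ln \<epsilon>\<bar> * norm v"
    proof eventually_elim
      case (elim \<epsilon>)
      show ?case
      proof (intro ballI allI)
        fix z v assume z: "z \<in> K"
        obtain p t where pt: "z = (p, t)" by fastforce
        have ptJ: "p \<in> P" "t \<in> J" "p \<in> fst ` K" using z cpt_insideD(2)[OF K] by (force simp: pt)+
        define x where "x = y \<epsilon> z"
        have xU: "x \<in> U" using yW[OF elim(2)] ptJ W(2) by (auto simp: x_def pt)
        have xL: "x \<in> (\<Union>x\<in>L. cball x \<beta>)" unfolding x_def pt using yX[OF elim(2) ptJ(1,2)] ball[OF elim(2)] by blast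
        have d1: "((\<lambda>x. G \<epsilon> (z, x)) has_derivative (\<lambda>v. frechet_derivative (G \<epsilon>) (at (z, x)) (0, v))) (at x)"
        proof (rule has_derivative_compose[where f = "\<lambda>x. (z, x)" and g = "G \<epsilon>"])
          show "(Pair z has_derivative Pair 0) (at x)"
            by (intro has_derivative_Pair has_derivative_const has_derivative_ident)
          show "(G \<epsilon> has_derivative frechet_derivative (G \<epsilon>) (at (z, x))) (at (z, x))"
            by (rule C1_on_has_derivative[OF C1[OF elim(2)]]) (use xU ptJ in \<open>auto simp: pt\<close>)
        qed
        have "\<epsilon> \<in> {0<..1}" using elim(2) e1 by auto
        then have "((\<lambda>x. F \<epsilon> (t, x, p)) has_derivative frechet_derivative (\<lambda>x. F \<epsilon> (t, x, p)) (at x)) (at x)"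
          using ptJ JI by (intro partial_has_derivative[OF F _ _ xU]) auto
        then have d2: "((\<lambda>x. G \<epsilon> (z, x)) has_derivative
            (\<lambda>v. \<kappa> \<epsilon> t *\<^sub>R frechet_derivative (\<lambda>x. F \<epsilon> (t, x, p)) (at x) v)) (at x)"
          unfolding G_def pt fst_conv snd_conv by (rule has_derivative_scaleR_right)
        have "norm (frechet_derivative (G \<epsilon>) (at (z, x)) (0, v))
            = \<bar>\<kappa> \<epsilon> t\<bar> * norm (frechet_derivative (\<lambda>x. F \<epsilon> (t, x, p)) (at x) v)"
          using fun_cong[OF has_derivative_unique[OF d1 d2], of v] by simp
        also have "\<dots> \<le> 1 * norm (frechet_derivative (\<lambda>x. F \<epsilon> (t, x, p)) (at x) v)"
          using \<kappa>(2)[of \<epsilon> t] elim(2) by (intro mult_right_mono) auto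
        also have "\<dots> \<le> C * \<bar>ln \<epsilon>\<bar> * norm v" using elim(1) ptJ(2,3) xL unfolding mult_1_left by blast
        finally show "norm (frechet_derivative (G \<epsilon>) (at (z, y \<epsilon> z)) (0, v)) \<le> C * \<bar>ln \<epsilon>\<bar> * norm v"
          by (simp add: x_def)
      qed
    qed
    then show "\<exists>C. \<forall>\<^sub>F \<epsilon> in at_right 0. \<forall>z\<in>K. \<forall>v.
        norm (frechet_derivative (G \<epsilon>) (at (z, y \<epsilon> z)) (0, v)) \<le> C * \<bar>ln \<epsilon>\<bar> * norm v" by blast
  qed auto
  define u where "u \<epsilon> z = (if \<epsilon> \<le> e then y \<epsilon> z else 0)" for \<epsilon> z
  have uy: "u \<epsilon> = y \<epsilon>" if "\<epsilon> \<in> {0<..e}" for \<epsilon> using that by (auto simp: u_def)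
  show ?thesis
  proof (rule that[of u])
    show "c_bounded (P \<times> J) (\<Union>x\<in>L. ball x \<beta>) u"
      unfolding c_bounded_iff W_def[symmetric]
    proof (intro conjI)
      show "u \<in> moderate_nets (P \<times> J)"
        unfolding moderate_nets_iff u_def[abs_def] using moderate_upto_truncate[OF op(2) e(1) e1 ym] by blast
      show "\<forall>\<^sub>F \<epsilon> in at_right 0. u \<epsilon> ` (P \<times> J) \<subseteq> W"
        using eventually_at_right_0_Ioc[OF e(1)] by eventually_elim (use yW uy in \<open>auto simp: image_subset_iff\<close>)
      show "compactly_maps (P \<times> J) W u"
        unfolding compactly_maps_def
      proof (intro allI impI)
        fix K assume "K \<subset>\<subset> P \<times> J"
        then obtain M where M: "M \<subset>\<subset> W" "\<forall>\<^sub>F \<epsilon> in at_right 0. y \<epsilon> ` K \<subseteq> M"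
          using maps unfolding compactly_maps_def by blast
        from M(2) eventually_at_right_0_Ioc[OF e(1)]
        have "\<forall>\<^sub>F \<epsilon> in at_right 0. u \<epsilon> ` K \<subseteq> M" by eventually_elim (simp add: uy)
        then show "\<exists>M. M \<subset>\<subset> W \<and> (\<forall>\<^sub>F \<epsilon> in at_right 0. u \<epsilon> ` K \<subseteq> M)" using M(1) by blast
      qed
    qed
    show "\<forall>\<^sub>F \<epsilon> in at_right 0. \<forall>p\<in>P. u \<epsilon> (p, \<tau> \<epsilon>) = \<xi> \<epsilon> \<and> (\<forall>t\<in>J. norm (u \<epsilon> (p, t) - \<xi> \<epsilon>) \<le> a * \<bar>t - \<tau> \<epsilon>\<bar>)"
      using eventually_at_right_0_Ioc[OF e(1)] by eventually_elim (use Y in \<open>simp add: uy y_def\<close>)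
    fix K assume K: "K \<subset>\<subset> J"
    from \<kappa>(4)[OF K] eventually_at_right_0_Ioc[OF e(1)]
    show "\<forall>\<^sub>F \<epsilon> in at_right 0. \<forall>p\<in>P. \<forall>t\<in>K. ((\<lambda>t. u \<epsilon> (p, t)) has_vector_derivative F \<epsilon> (t, u \<epsilon> (p, t), p)) (at t)"
    proof eventually_elim
      case (elim \<epsilon>)
      show ?case
      proof (intro ballI)
        fix p t assume p: "p \<in> P" and t: "t \<in> K"
        have tJ: "t \<in> J" using t cpt_insideD(2)[OF K] by auto
        have "G \<epsilon> ((p, t), y \<epsilon> (p, t)) = F \<epsilon> (t, y \<epsilon> (p, t), p)" using elim(1) t by (simp add: G_def)
        then show "((\<lambda>t. u \<epsilon> (p, t)) has_vector_derivative F \<epsilon> (t, u \<epsilon> (p, t), p)) (at t)"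
          using yd[OF elim(2) p tJ] by (simp add: uy[OF elim(2)])
      qed
    qed
  qed
qed

section \<open>Uniqueness\<close>

text \<open>On a compact time interval \<open>y\<close> keeps a distance \<open>\<rho>\<close> from the boundary of the ball \<open>cball (\<xi> \<epsilon>) \<beta>\<close>.  As long
  as \<open>v\<close> is within \<open>\<rho>\<close> of \<open>y\<close>, both are in this ball, where \<open>F\<close> has the Lipschitz constant \<open>C \<bar>ln \<epsilon>\<bar>\<close>;
  the local Gronwall inequality shows that \<open>v\<close> never gets that far, although all that is known of \<open>v\<close> is
  that it solves the equation up to a negligible error.\<close>

lemma ivp_net_unique:
  fixes I :: "real set" and U :: "'x::euclidean_space set" and P :: "'p::euclidean_space set"
    and F :: "(real \<times> 'x \<times> 'p, 'x) net" and y v :: "(real, 'x) net" and h t0 :: real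
  defines "J \<equiv> {t0 - h<..<t0 + h}"
  assumes F: "F \<in> moderate_nets (I \<times> U \<times> P)"
    and h: "h > 0" and JI: "J \<subseteq> I" and L\<beta>: "(\<Union>x\<in>L. cball x \<beta>) \<subseteq> U"
    and a: "a > 0" and \<beta>: "a * h \<le> \<beta>"
    and log: "\<forall>\<^sub>F \<epsilon> in at_right 0. \<forall>t\<in>J. \<forall>x\<in>(\<Union>x\<in>L. cball x \<beta>). \<forall>p\<in>KP. \<forall>v.
      norm (frechet_derivative (\<lambda>y. F \<epsilon> (t, y, p)) (at x) v) \<le> C * \<bar>ln \<epsilon>\<bar> * norm v"
    and KP: "KP \<subseteq> P" and q: "\<forall>\<^sub>F \<epsilon> in at_right 0. q \<epsilon> \<in> KP"
    and lim: "(\<tau> \<longlongrightarrow> t0) (at_right 0)" and \<xi>: "\<forall>\<^sub>F \<epsilon> in at_right 0. \<xi> \<epsilon> \<in> L"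
    and y: "\<forall>\<^sub>F \<epsilon> in at_right 0. \<forall>t\<in>J. norm (y \<epsilon> t - \<xi> \<epsilon>) \<le> a * \<bar>t - \<tau> \<epsilon>\<bar>"
    and yd: "\<And>K. K \<subset>\<subset> J \<Longrightarrow> \<forall>\<^sub>F \<epsilon> in at_right 0. \<forall>t\<in>K. (y \<epsilon> has_vector_derivative F \<epsilon> (t, y \<epsilon> t, q \<epsilon>)) (at t)"
    and vd: "\<forall>\<^sub>F \<epsilon> in at_right 0. \<forall>t\<in>J. (v \<epsilon> has_vector_derivative v' \<epsilon> t) (at t)"
    and res: "locally_negligible J (\<lambda>\<epsilon> t. v' \<epsilon> t - F \<epsilon> (t, v \<epsilon> t, q \<epsilon>))"
    and init: "points_equiv (\<lambda>\<epsilon>. v \<epsilon> (\<tau> \<epsilon>)) \<xi>"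
  shows "locally_negligible J (\<lambda>\<epsilon> t. v \<epsilon> t - y \<epsilon> t)"
  unfolding locally_negligible_def negligible_on_def
proof (intro allI impI)
  fix K and n :: nat assume K: "K \<subset>\<subset> J"
  have h8: "t0 - h < t0 - h / 8" "t0 - h / 8 \<le> t0 + h / 8" "t0 + h / 8 < t0 + h" using h by auto
  obtain c1 d1 where c1: "t0 - h < c1" "d1 < t0 + h" "K \<subseteq> {c1..d1}" "c1 \<le> t0 - h / 8" "t0 + h / 8 \<le> d1"
    by (rule compact_in_open_interval[OF cpt_insideD(1)[OF K] cpt_insideD(2)[OF K, unfolded J_def] h8])
  define T where "T = {c1..d1}"
  have T: "T \<subset>\<subset> J" unfolding T_def J_def by (rule cpt_insideI) (use c1 in auto)
  have TJ: "T \<subseteq> J" by (rule cpt_insideD(2)[OF T])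
  have cT: "convex T" by (simp add: T_def)
  obtain \<rho>0 where \<rho>0: "0 \<le> \<rho>0" "\<rho>0 < h" "\<And>t. t \<in> T \<Longrightarrow> \<bar>t - t0\<bar> \<le> \<rho>0"
    by (rule compact_in_ball_real[OF cpt_insideD(1)[OF T] TJ[unfolded J_def] h]) blast
  define \<beta>' where "\<beta>' = a * ((\<rho>0 + h) / 2)"
  define \<rho> where "\<rho> = \<beta> - \<beta>'"
  have "\<beta>' < a * h" unfolding \<beta>'_def using a \<rho>0 by (intro mult_strict_left_mono) auto
  then have \<rho>: "\<rho> > 0" using \<beta> by (simp add: \<rho>_def)
  define S where "S = 1 + (d1 - c1)"
  have S: "S \<ge> 1" using c1 h by (simp add: S_def)
  obtain N where N: "\<forall>\<^sub>F \<epsilon> in at_right 0. sqrt (S * exp ((2 * (\<bar>C\<bar> * \<bar>ln \<epsilon>\<bar>) + 1) * S)) \<le> (1 / \<epsilon>) ^ N"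
    using gronwall_log_factor[of "\<bar>C\<bar>" S] S by auto
  (* Errors of size \<epsilon> ^ M are amplified by (1 / \<epsilon>) ^ N; one further power of \<epsilon> absorbs the constants. *)
  define M where "M = N + Suc n"
  have E1: "\<forall>\<^sub>F \<epsilon> in at_right 0. \<forall>t\<in>T. norm (v' \<epsilon> t - F \<epsilon> (t, v \<epsilon> t, q \<epsilon>)) \<le> \<epsilon> ^ M"
    using res T unfolding locally_negligible_def negligible_on_def by blast
  have E2: "\<forall>\<^sub>F \<epsilon> in at_right 0. norm (v \<epsilon> (\<tau> \<epsilon>) - \<xi> \<epsilon>) \<le> \<epsilon> ^ M"
    using init unfolding points_equiv_iff by blast
  have E3: "\<forall>\<^sub>F \<epsilon> in at_right 0. \<bar>\<tau> \<epsilon> - t0\<bar> < min (h / 8) ((h - \<rho>0) / 2)"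
    using h \<rho>0 by (intro eventually_delay_small[OF lim]) simp
  have "min 1 (min (1 / (1 + S)) (\<rho>\<^sup>2 / 2)) > 0" using S \<rho> by simp
  note E4 = eventually_at_right_0_Ioc[OF this]
  from N E1 E2 E3 E4 log q \<xi> y yd[OF T] vd
  have "\<forall>\<^sub>F \<epsilon> in at_right 0. \<forall>t\<in>T. norm (v \<epsilon> t - y \<epsilon> t) \<le> \<epsilon> ^ n"
  proof eventually_elim
    case (elim \<epsilon>)
    note N = elim(1) and E1 = elim(2) and E2 = elim(3) and E3 = elim(4) and E4 = elim(5) and log = elim(6)
      and q = elim(7) and \<xi> = elim(8) and y = elim(9) and yd = elim(10) and vd = elim(11)
    have \<epsilon>: "0 < \<epsilon>" "\<epsilon> \<le> 1" "\<epsilon> * (1 + S) \<le> 1" "\<epsilon> < \<rho>\<^sup>2"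
    proof -
      have e: "0 < \<epsilon>" "\<epsilon> \<le> 1" "\<epsilon> \<le> 1 / (1 + S)" "\<epsilon> \<le> \<rho>\<^sup>2 / 2" using E4 by auto
      then show "0 < \<epsilon>" "\<epsilon> \<le> 1" by auto
      show "\<epsilon> * (1 + S) \<le> 1" using e(3) S by (simp add: field_simps)
      show "\<epsilon> < \<rho>\<^sup>2" using e(4) \<rho> zero_less_power[OF \<rho>, of 2] by linarith
    qed
    have \<tau>8: "\<bar>\<tau> \<epsilon> - t0\<bar> < h / 8" "\<bar>\<tau> \<epsilon> - t0\<bar> < (h - \<rho>0) / 2" using E3 by auto
    have \<tau>T: "\<tau> \<epsilon> \<in> T" unfolding T_def atLeastAtMost_iff using \<tau>8(1) c1(4,5) by linarith
    have ball: "cball (\<xi> \<epsilon>) \<beta> \<subseteq> (\<Union>x\<in>L. cball x \<beta>)" using \<xi> by blast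
    have qP: "q \<epsilon> \<in> P" using q KP by blast
    have ynear: "norm (y \<epsilon> t - \<xi> \<epsilon>) \<le> \<beta>'" if t: "t \<in> T" for t
    proof -
      have "\<bar>t - \<tau> \<epsilon>\<bar> \<le> \<bar>t - t0\<bar> + \<bar>\<tau> \<epsilon> - t0\<bar>" by linarith
      then have "\<bar>t - \<tau> \<epsilon>\<bar> \<le> (\<rho>0 + h) / 2"
        using \<rho>0(3)[OF t] \<tau>8(2) unfolding add_divide_distrib diff_divide_distrib by linarith
      then have "a * \<bar>t - \<tau> \<epsilon>\<bar> \<le> \<beta>'" unfolding \<beta>'_def using a by (intro mult_left_mono) auto
      then show ?thesis using y t TJ by force
    qed
    define k where "k = \<bar>C\<bar> * \<bar>ln \<epsilon>\<bar>"
    have k0: "k \<ge> 0" by (simp add: k_def)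
    have Flip: "norm (F \<epsilon> (t, x, q \<epsilon>) - F \<epsilon> (t, x', q \<epsilon>)) \<le> k * norm (x - x')"
      if t: "t \<in> T" and x: "x \<in> cball (\<xi> \<epsilon>) \<beta>" "x' \<in> cball (\<xi> \<epsilon>) \<beta>" for t x x'
    proof (rule differentiable_bound[OF convex_cball _ _ x])
      fix z assume z: "z \<in> cball (\<xi> \<epsilon>) \<beta>"
      have zU: "z \<in> U" "z \<in> (\<Union>x\<in>L. cball x \<beta>)" using z ball L\<beta> by blast+
      have tJ: "t \<in> J" "t \<in> I" using t TJ JI by auto
      show "((\<lambda>x. F \<epsilon> (t, x, q \<epsilon>)) has_derivative frechet_derivative (\<lambda>x. F \<epsilon> (t, x, q \<epsilon>)) (at z)) (at z within cball (\<xi> \<epsilon>) \<beta>)"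
        by (rule has_derivative_at_withinI[OF partial_has_derivative[OF F _ tJ(2) zU(1) qP]]) (use \<epsilon> in auto)
      show "onorm (frechet_derivative (\<lambda>x. F \<epsilon> (t, x, q \<epsilon>)) (at z)) \<le> k"
      proof (rule onorm_le)
        fix w
        have "norm (frechet_derivative (\<lambda>x. F \<epsilon> (t, x, q \<epsilon>)) (at z) w) \<le> C * \<bar>ln \<epsilon>\<bar> * norm w"
          using log tJ(1) zU(2) q by blast
        also have "\<dots> \<le> k * norm w" unfolding k_def by (intro mult_right_mono) auto
        finally show "norm (frechet_derivative (\<lambda>x. F \<epsilon> (t, x, q \<epsilon>)) (at z) w) \<le> k * norm w" .
      qed
    qed
    show ?case
    proof
      fix t assume t: "t \<in> T"
      define s where "s = \<tau> \<epsilon>"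
      define w where "w r = v \<epsilon> r - y \<epsilon> r" for r
      have "norm (y \<epsilon> s - \<xi> \<epsilon>) \<le> a * \<bar>s - \<tau> \<epsilon>\<bar>" using y \<tau>T TJ unfolding s_def by blast
      then have "y \<epsilon> s = \<xi> \<epsilon>" by (simp add: s_def)
      then have ws: "norm (w s) \<le> \<epsilon> ^ M" using E2 by (simp add: w_def s_def)
      let ?R = "((norm (w s))\<^sup>2 + (\<epsilon> ^ M)\<^sup>2 * \<bar>t - s\<bar>) * exp ((2 * k + 1) * \<bar>t - s\<bar>)"
      have R: "?R \<le> \<epsilon> ^ Suc (2 * n)"
      proof -
        have ts: "\<bar>t - s\<bar> \<le> S" using t \<tau>T by (auto simp: T_def S_def s_def)
        have "exp ((2 * k + 1) * \<bar>t - s\<bar>) \<le> exp ((2 * k + 1) * S)"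
          using ts k0 by (simp add: mult_left_mono)
        also have "\<dots> \<le> S * exp ((2 * k + 1) * S)" using S by simp
        also have "\<dots> = (sqrt (S * exp ((2 * k + 1) * S)))\<^sup>2" using S by simp
        also have "\<dots> \<le> ((1 / \<epsilon>) ^ N)\<^sup>2" using N S by (intro power_mono) (auto simp: k_def)
        finally have X: "exp ((2 * k + 1) * \<bar>t - s\<bar>) \<le> ((1 / \<epsilon>) ^ N)\<^sup>2" .
        have "(norm (w s))\<^sup>2 + (\<epsilon> ^ M)\<^sup>2 * \<bar>t - s\<bar> \<le> (\<epsilon> ^ M)\<^sup>2 + (\<epsilon> ^ M)\<^sup>2 * S"
          using ws ts by (intro add_mono power_mono mult_left_mono) auto
        then have "?R \<le> ((\<epsilon> ^ M)\<^sup>2 + (\<epsilon> ^ M)\<^sup>2 * S) * ((1 / \<epsilon>) ^ N)\<^sup>2"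
          using X S by (intro mult_mono) auto
        also have "\<dots> = (1 + S) * (\<epsilon> ^ M * (1 / \<epsilon>) ^ N)\<^sup>2" by (simp only: power_mult_distrib) (simp add: algebra_simps)
        also have "\<epsilon> ^ M * (1 / \<epsilon>) ^ N = \<epsilon> ^ Suc n" using \<epsilon> by (simp add: M_def power_add power_one_over)
        also have "(1 + S) * (\<epsilon> ^ Suc n)\<^sup>2 = (\<epsilon> * (1 + S)) * \<epsilon> ^ Suc (2 * n)"
          by (simp add: power2_eq_square mult_2 power_add)
        also have "\<dots> \<le> 1 * \<epsilon> ^ Suc (2 * n)" using \<epsilon> by (intro mult_right_mono) auto
        finally show ?thesis by simp
      qed
      have "(norm (w t))\<^sup>2 \<le> ?R"
      proof (rule gronwall_local[OF cT _ t k0 \<rho>])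
        show "s \<in> T" using \<tau>T by (simp add: s_def)
        have "\<epsilon> ^ Suc (2 * n) \<le> \<epsilon> ^ 1" using \<epsilon> by (intro power_decreasing) auto
        then show "?R < \<rho>\<^sup>2" using R \<epsilon>(4) by simp
        fix r assume r: "r \<in> T"
        have rJ: "r \<in> J" using r TJ by auto
        show "(w has_vector_derivative v' \<epsilon> r - F \<epsilon> (r, y \<epsilon> r, q \<epsilon>)) (at r within T)"
          unfolding w_def[abs_def] using vd yd r rJ
          by (intro has_vector_derivative_at_within[OF has_vector_derivative_diff]) auto
        assume small: "norm (w r) \<le> \<rho>"
        have yb: "y \<epsilon> r \<in> cball (\<xi> \<epsilon>) \<beta>"
          using ynear[OF r] \<rho> by (simp add: dist_norm norm_minus_commute \<rho>_def)
        have "norm (v \<epsilon> r - \<xi> \<epsilon>) \<le> norm (w r) + norm (y \<epsilon> r - \<xi> \<epsilon>)"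
          using norm_triangle_ineq[of "w r" "y \<epsilon> r - \<xi> \<epsilon>"] by (simp add: w_def)
        then have vb: "v \<epsilon> r \<in> cball (\<xi> \<epsilon>) \<beta>"
          using small ynear[OF r] by (simp add: dist_norm norm_minus_commute \<rho>_def)
        have "v' \<epsilon> r - F \<epsilon> (r, y \<epsilon> r, q \<epsilon>)
            = (F \<epsilon> (r, v \<epsilon> r, q \<epsilon>) - F \<epsilon> (r, y \<epsilon> r, q \<epsilon>)) + (v' \<epsilon> r - F \<epsilon> (r, v \<epsilon> r, q \<epsilon>))" by simp
        also have "norm \<dots> \<le> k * norm (w r) + \<epsilon> ^ M"
          using Flip[OF r vb yb] E1 r by (intro norm_triangle_mono) (auto simp: w_def)
        finally show "norm (v' \<epsilon> r - F \<epsilon> (r, y \<epsilon> r, q \<epsilon>)) \<le> k * norm (w r) + \<epsilon> ^ M" .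
      qed
      also have "?R \<le> \<epsilon> ^ (2 * n)" 
        by (rule order_trans[OF R power_decreasing]) (use \<epsilon> in auto)
      finally have "(norm (w t))\<^sup>2 \<le> (\<epsilon> ^ n)\<^sup>2" by (simp add: power_mult[symmetric] mult.commute)
      then show "norm (v \<epsilon> t - y \<epsilon> t) \<le> \<epsilon> ^ n" using \<epsilon> power2_le_imp_le[of "norm (w t)" "\<epsilon> ^ n"] by (simp add: w_def)
    qed
  qed
  then show "\<forall>\<^sub>F \<epsilon> in at_right 0. \<forall>t\<in>K. norm (v \<epsilon> t - y \<epsilon> t) \<le> \<epsilon> ^ n"
    by (rule eventually_mono) (use c1(3) in \<open>auto simp: T_def\<close>)
qed

lemma cpt_point_of_bounded_net:
  fixes q :: "'p::euclidean_space pnet"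
  assumes K: "K \<subset>\<subset> P" and q: "\<And>\<epsilon>. q \<epsilon> \<in> K"
  shows "\<exists>p\<in>cpt_points P. q \<in> p"
proof -
  define p where "p = {(x, y). x \<in> moderate_points P \<and> y \<in> moderate_points P \<and> points_equiv x y} `` {q}"
  obtain B where B: "\<forall>x\<in>K. norm x \<le> B"
    using compact_imp_bounded[OF cpt_insideD(1)[OF K]] unfolding bounded_iff by auto
  have "(\<lambda>\<epsilon>. norm (q \<epsilon>)) \<in> O[at_right 0](\<lambda>\<epsilon>. 1 / \<epsilon> ^ 0)"
    by (rule bigoI[of _ B]) (use B q in auto)
  then have qm: "q \<in> moderate_points P"
    using q cpt_insideD(2)[OF K] unfolding moderate_points_def by blast
  moreover have "points_equiv q q"
    unfolding points_equiv_iff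
  proof
    fix m :: nat
    show "\<forall>\<^sub>F \<epsilon> in at_right 0. norm (q \<epsilon> - q \<epsilon>) \<le> \<epsilon> ^ m"
      using eventually_at_right_0_Ioc1 by eventually_elim simp
  qed
  ultimately have qp: "q \<in> p" by (simp add: p_def)
  have "p \<in> gen_points P" unfolding p_def gen_points_def by (rule quotientI[OF qm])
  moreover have "\<forall>\<^sub>F \<epsilon> in at_right 0. q \<epsilon> \<in> K" by (rule always_eventually) (simp add: q)
  ultimately have "p \<in> cpt_points P"
    unfolding cpt_points_def eventually_Ioc_iff using qp K by blast
  then show ?thesis using qp by blast
qed

text \<open>One parameter per \<open>\<epsilon>\<close> suffices to witness a violation of the bound \<open>\<epsilon> ^ m\<close> on \<open>K\<close>, if there is one.\<close>

lemma worst_parameter_exists: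
  fixes w :: "('p \<times> real, 'b::real_normed_vector) net"
  assumes K: "K \<noteq> {}"
  obtains q where "\<And>\<epsilon>. q \<epsilon> \<in> fst ` K"
    "\<And>\<epsilon> z. z \<in> K \<Longrightarrow> norm (w \<epsilon> z) > \<epsilon> ^ m \<Longrightarrow> \<exists>t. (q \<epsilon>, t) \<in> K \<and> norm (w \<epsilon> (q \<epsilon>, t)) > \<epsilon> ^ m"
proof -
  have "\<exists>p. p \<in> fst ` K \<and> (\<forall>z\<in>K. norm (w \<epsilon> z) > \<epsilon> ^ m \<longrightarrow> (\<exists>t. (p, t) \<in> K \<and> norm (w \<epsilon> (p, t)) > \<epsilon> ^ m))" for \<epsilon>
  proof (cases "\<exists>z\<in>K. norm (w \<epsilon> z) > \<epsilon> ^ m")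
    case True
    then obtain z where z: "z \<in> K" "norm (w \<epsilon> z) > \<epsilon> ^ m" by blast
    show ?thesis by (rule exI[of _ "fst z"]) (use z in \<open>auto intro!: exI[of _ "snd z"]\<close>)
  next
    case False
    then show ?thesis using K by blast
  qed
  then obtain q where "\<And>\<epsilon>. q \<epsilon> \<in> fst ` K \<and> (\<forall>z\<in>K. norm (w \<epsilon> z) > \<epsilon> ^ m \<longrightarrow>
      (\<exists>t. (q \<epsilon>, t) \<in> K \<and> norm (w \<epsilon> (q \<epsilon>, t)) > \<epsilon> ^ m))" by metis
  then show ?thesis by (intro that[of q]) blast+
qed

text \<open>The parameters of \<open>worst_parameter_exists\<close> form a compactly supported generalized point, and an estimate at this single
  point covers all of \<open>K\<close>.\<close>

lemma locally_negligible_by_parameters: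
  fixes w :: "('p::euclidean_space \<times> real, 'b::real_normed_vector) net"
  assumes P: "open P" and J: "open J"
    and slices: "\<And>p q. p \<in> cpt_points P \<Longrightarrow> q \<in> p \<Longrightarrow> locally_negligible J (\<lambda>\<epsilon> t. w \<epsilon> (q \<epsilon>, t))"
  shows "locally_negligible (P \<times> J) w"
  unfolding locally_negligible_def negligible_on_def
proof (intro allI impI)
  fix K and m :: nat assume K: "K \<subset>\<subset> P \<times> J"
  show "\<forall>\<^sub>F \<epsilon> in at_right 0. \<forall>z\<in>K. norm (w \<epsilon> z) \<le> \<epsilon> ^ m"
  proof (cases "K = {}")
    case False
    obtain q where q: "\<And>\<epsilon>. q \<epsilon> \<in> fst ` K"
      "\<And>\<epsilon> z. z \<in> K \<Longrightarrow> norm (w \<epsilon> z) > \<epsilon> ^ m \<Longrightarrow> \<exists>t. (q \<epsilon>, t) \<in> K \<and> norm (w \<epsilon> (q \<epsilon>, t)) > \<epsilon> ^ m"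
      by (rule worst_parameter_exists[OF False, where w = w and m = m]) blast
    have "fst ` K \<subset>\<subset> P"
      by (rule cpt_insideI[OF compact_continuous_image[OF continuous_on_fst[OF continuous_on_id] cpt_insideD(1)[OF K]] _ P])
        (use cpt_insideD(2)[OF K] in auto)
    then have "\<exists>p\<in>cpt_points P. q \<in> p" using q(1) by (rule cpt_point_of_bounded_net)
    then obtain p where p: "p \<in> cpt_points P" "q \<in> p" by (rule bexE)
    have "snd ` K \<subset>\<subset> J"
      by (rule cpt_insideI[OF compact_continuous_image[OF continuous_on_snd[OF continuous_on_id] cpt_insideD(1)[OF K]] _ J])
        (use cpt_insideD(2)[OF K] in auto)
    then have "\<forall>\<^sub>F \<epsilon> in at_right 0. \<forall>t\<in>snd ` K. norm (w \<epsilon> (q \<epsilon>, t)) \<le> \<epsilon> ^ m"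
      using slices[OF p] unfolding locally_negligible_def negligible_on_def by blast
    then show ?thesis
    proof eventually_elim
      case (elim \<epsilon>)
      show ?case
      proof (rule ballI, rule ccontr)
        fix z assume "z \<in> K" "\<not> norm (w \<epsilon> z) \<le> \<epsilon> ^ m"
        then obtain t where "(q \<epsilon>, t) \<in> K" "norm (w \<epsilon> (q \<epsilon>, t)) > \<epsilon> ^ m" using q(2)[of z \<epsilon>] by auto
        then show False using elim by force
      qed
    qed
  qed simp
qed

section \<open>The initial value problem\<close>

theorem theorem3p8:
  fixes I :: "real set" and U :: "(real ^ 'n) set" and P :: "(real ^ 'l) set"
    and T\<^sub>0 :: "real pnet set" and t\<^sub>0 :: real
    and X\<^sub>0 :: "(real ^ 'n) pnet set" and x\<^sub>0 :: "(real ^ 'n) pnet"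
    and F :: "(real \<times> (real ^ 'n) \<times> (real ^ 'l), real ^ 'n) net set"
    and F\<^sub>r :: "(real \<times> (real ^ 'n) \<times> (real ^ 'l), real ^ 'n) net"
    and L L\<^sub>\<beta> W :: "(real ^ 'n) set" and Q :: "(real \<times> (real ^ 'n)) set" and J :: "real set"
    and \<alpha> \<beta> a \<epsilon>\<^sub>0 h :: real
  assumes "open I" and "is_interval I" and "open U" and "open P"
    and "near_standard_at I T\<^sub>0 t\<^sub>0"
    and "X\<^sub>0 \<in> cpt_points U"
    and "F \<in> colombeau (I \<times> U \<times> P)"
    and "\<alpha> > 0" and "{t\<^sub>0 - \<alpha>..t\<^sub>0 + \<alpha>} \<subset>\<subset> I"
    and "x\<^sub>0 \<in> X\<^sub>0" and "L \<subset>\<subset> U" and "\<epsilon>\<^sub>0 \<in> {0<..1}"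
    and "\<forall>\<epsilon> \<in> {0<..\<epsilon>\<^sub>0}. x\<^sub>0 \<epsilon> \<in> L"
    and "\<beta> > 0" and "L\<^sub>\<beta> = {x + y |x y. x \<in> L \<and> y \<in> cball 0 \<beta>}" and "L\<^sub>\<beta> \<subset>\<subset> U"
    and "Q = {t\<^sub>0 - \<alpha>..t\<^sub>0 + \<alpha>} \<times> L\<^sub>\<beta>"
    and "F\<^sub>r \<in> F" and "a > 0"
    and "\<forall>\<epsilon> \<in> {0<..\<epsilon>\<^sub>0}. \<forall>(t, x) \<in> Q. \<forall>p \<in> P. norm (F\<^sub>r \<epsilon> (t, x, p)) \<le> a"
    and "\<forall>K. compact K \<and> K \<subseteq> P \<longrightarrow>
           sup_bigo (Q \<times> K)
             (\<lambda>\<epsilon> ((t, x), p). onorm (frechet_derivative (\<lambda>y. F\<^sub>r \<epsilon> (t, y, p)) (at x)))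
             (\<lambda>\<epsilon>. \<bar>ln \<epsilon>\<bar>)"
    and "h = min \<alpha> (\<beta> / a)" and "J = {t\<^sub>0 - h<..<t\<^sub>0 + h}"
    and "W = {x + y |x y. x \<in> L \<and> y \<in> ball 0 \<beta>}"
  shows "\<exists>u \<in> colombeau_into (P \<times> J) W.
    (\<forall>p \<in> cpt_points P.
       insert_first J u p \<in> colombeau_into J W \<and>
       ivp_solution I U (insert_third (I \<times> U) F p) T\<^sub>0 X\<^sub>0 J (insert_first J u p)) \<and>
    (\<forall>v \<in> colombeau_into (P \<times> J) U.
       (\<forall>p \<in> cpt_points P.
          ivp_solution I U (insert_third (I \<times> U) F p) T\<^sub>0 X\<^sub>0 J (insert_first J v p)) \<longrightarrow>
       v = u)"
proof -
  have tI: "{t\<^sub>0 - \<alpha>..t\<^sub>0 + \<alpha>} \<subseteq> I" by (rule cpt_insideD(2)[OF assms(9)])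
  have h: "h > 0" "h \<le> \<alpha>" "a * h \<le> \<beta>"
    using \<open>\<alpha> > 0\<close> \<open>\<beta> > 0\<close> \<open>a > 0\<close> by (auto simp: \<open>h = _\<close> min_def field_simps)
  have Jt: "J \<subseteq> {t\<^sub>0 - \<alpha>..t\<^sub>0 + \<alpha>}" using h by (auto simp: \<open>J = _\<close>)
  have J: "open J" "J \<subseteq> I" "t\<^sub>0 \<in> J" using h Jt tI by (auto simp: \<open>J = _\<close>)
  have L: "compact L" using \<open>L \<subset>\<subset> U\<close> by (rule cpt_insideD(1))
  have L\<beta>: "L\<^sub>\<beta> = (\<Union>x\<in>L. cball x \<beta>)" and W: "W = (\<Union>x\<in>L. ball x \<beta>)"
    unfolding \<open>L\<^sub>\<beta> = _\<close> \<open>W = _\<close> by (rule Minkowski_ball_eq)+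
  have L\<beta>U: "(\<Union>x\<in>L. cball x \<beta>) \<subseteq> U" using cpt_insideD(2)[OF \<open>L\<^sub>\<beta> \<subset>\<subset> U\<close>] by (simp only: L\<beta>)
  have "W \<subseteq> (\<Union>x\<in>L. cball x \<beta>)" unfolding W by (intro UN_mono order_refl ball_subset_cball)
  then have WU: "W \<subseteq> U" using L\<beta>U by blast
  have op: "open (P \<times> J)" "open (I \<times> U \<times> P)" using \<open>open P\<close> \<open>open I\<close> \<open>open U\<close> J by (auto intro!: open_Times)
  note F\<^sub>r = colombeau_eq_class[OF op(2) \<open>F \<in> colombeau (I \<times> U \<times> P)\<close> \<open>F\<^sub>r \<in> F\<close>]
  have X\<^sub>0: "X\<^sub>0 \<in> gen_points U" using \<open>X\<^sub>0 \<in> cpt_points U\<close> by (simp add: cpt_points_def)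
  obtain \<tau> where \<tau>: "\<tau> \<in> T\<^sub>0" "(\<tau> \<longlongrightarrow> t\<^sub>0) (at_right 0)"
    using \<open>near_standard_at I T\<^sub>0 t\<^sub>0\<close> unfolding near_standard_at_def by blast
  have bound: "norm (F\<^sub>r \<epsilon> (t, x, p)) \<le> a"
    if "\<epsilon> \<in> {0<..\<epsilon>\<^sub>0}" "t \<in> J" "x \<in> (\<Union>x\<in>L. cball x \<beta>)" "p \<in> P" for \<epsilon> t x p
  proof -
    have "(t, x) \<in> Q" unfolding \<open>Q = _\<close> L\<beta> using that Jt by blast
    then show ?thesis using assms(20) that by blast
  qed
  have log: "\<exists>C. \<forall>\<^sub>F \<epsilon> in at_right 0. \<forall>t\<in>J. \<forall>x\<in>(\<Union>x\<in>L. cball x \<beta>). \<forall>p\<in>K. \<forall>v.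
      norm (frechet_derivative (\<lambda>y. F\<^sub>r \<epsilon> (t, y, p)) (at x) v) \<le> C * \<bar>ln \<epsilon>\<bar> * norm v"
    if K: "compact K" "K \<subseteq> P" for K
  proof -
    obtain C where C: "\<forall>\<^sub>F \<epsilon> in at_right 0. \<forall>z\<in>Q \<times> K.
        norm ((\<lambda>((t, x), p). onorm (frechet_derivative (\<lambda>y. F\<^sub>r \<epsilon> (t, y, p)) (at x))) z) \<le> C * \<bar>\<bar>ln \<epsilon>\<bar>\<bar>"
      using mp[OF spec[OF assms(21), of K] conjI[OF K]] unfolding sup_bigo_def by (rule exE)
    from C eventually_at_right_0_Ioc1
    have "\<forall>\<^sub>F \<epsilon> in at_right 0. \<forall>t\<in>J. \<forall>x\<in>(\<Union>x\<in>L. cball x \<beta>). \<forall>p\<in>K. \<forall>v.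
        norm (frechet_derivative (\<lambda>y. F\<^sub>r \<epsilon> (t, y, p)) (at x) v) \<le> C * \<bar>ln \<epsilon>\<bar> * norm v"
    proof eventually_elim
      case (elim \<epsilon>)
      show ?case
      proof (intro ballI allI)
        fix t x p v assume t: "t \<in> J" and x: "x \<in> (\<Union>x\<in>L. cball x \<beta>)" and p: "p \<in> K"
        let ?D = "frechet_derivative (\<lambda>y. F\<^sub>r \<epsilon> (t, y, p)) (at x)"
        have "((t, x), p) \<in> Q \<times> K" unfolding \<open>Q = _\<close> L\<beta> using t x p Jt by blast
        from bspec[OF elim(1) this] have o: "onorm ?D \<le> C * \<bar>ln \<epsilon>\<bar>" by simp
        have tx: "t \<in> I" "x \<in> U" "p \<in> P" using subsetD[OF J(2) t] subsetD[OF L\<beta>U x] subsetD[OF K(2) p] by blast+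
        have "bounded_linear ?D"
          by (rule has_derivative_bounded_linear[OF partial_has_derivative[OF F\<^sub>r(1) elim(2) tx]])
        then have "norm (?D v) \<le> onorm ?D * norm v" by (rule onorm)
        also have "\<dots> \<le> C * \<bar>ln \<epsilon>\<bar> * norm v" using o by (rule mult_right_mono) simp
        finally show "norm (?D v) \<le> C * \<bar>ln \<epsilon>\<bar> * norm v" .
      qed
    qed
    then show ?thesis by blast
  qed
  have x\<^sub>0L: "x\<^sub>0 \<epsilon> \<in> L" if "\<epsilon> \<in> {0<..\<epsilon>\<^sub>0}" for \<epsilon> using assms(13) that by blast
  obtain u where u: "c_bounded (P \<times> J) W u"
    "\<forall>\<^sub>F \<epsilon> in at_right 0. \<forall>p\<in>P. u \<epsilon> (p, \<tau> \<epsilon>) = x\<^sub>0 \<epsilon> \<and> (\<forall>t\<in>J. norm (u \<epsilon> (p, t) - x\<^sub>0 \<epsilon>) \<le> a * \<bar>t - \<tau> \<epsilon>\<bar>)"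
    "\<And>K. K \<subset>\<subset> J \<Longrightarrow> \<forall>\<^sub>F \<epsilon> in at_right 0. \<forall>p\<in>P. \<forall>t\<in>K.
      ((\<lambda>t. u \<epsilon> (p, t)) has_vector_derivative F\<^sub>r \<epsilon> (t, u \<epsilon> (p, t), p)) (at t)"
    unfolding W \<open>J = _\<close>
    by (rule flow_net_exists[OF \<open>open I\<close> \<open>open U\<close> \<open>open P\<close> F\<^sub>r(1) h(1) J(2)[unfolded \<open>J = _\<close>] L L\<beta>U
          \<open>a > 0\<close> \<open>\<beta> > 0\<close> h(3) \<open>\<epsilon>\<^sub>0 \<in> _\<close> bound[unfolded \<open>J = _\<close>] log[unfolded \<open>J = _\<close>] \<tau>(2) x\<^sub>0L]) blast+
  have uU: "c_bounded (P \<times> J) U u" by (rule c_bounded_mono[OF u(1) WU \<open>open U\<close>])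
  define u' where "u' = colombeau_class (P \<times> J) u"
  have ivp_iff: "ivp_solution I U (insert_third (I \<times> U) F p) T\<^sub>0 X\<^sub>0 J (insert_first J (colombeau_class (P \<times> J) w) p) \<longleftrightarrow>
      locally_negligible J (\<lambda>\<epsilon> t. vector_derivative (\<lambda>t. w \<epsilon> (q \<epsilon>, t)) (at t) - F\<^sub>r \<epsilon> (t, w \<epsilon> (q \<epsilon>, t), q \<epsilon>)) \<and>
      points_equiv (\<lambda>\<epsilon>. w \<epsilon> (q \<epsilon>, \<tau> \<epsilon>)) x\<^sub>0"
    if "p \<in> cpt_points P" "q \<in> p" "c_bounded (P \<times> J) U w" for p q w
    by (rule ivp_solution_insert_first_iff[OF \<open>open I\<close> \<open>open U\<close> \<open>open P\<close> J(1,2) \<open>near_standard_at I T\<^sub>0 t\<^sub>0\<close> \<tau>(1) J(3)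
          X\<^sub>0 \<open>x\<^sub>0 \<in> X\<^sub>0\<close> \<open>F \<in> colombeau _\<close> \<open>F\<^sub>r \<in> F\<close> that])
  show ?thesis
  proof (intro bexI[of _ u'] conjI ballI impI)
    show "u' \<in> colombeau_into (P \<times> J) W" unfolding u'_def by (rule colombeau_intoI[OF op(1) u(1)])
  next
    fix p assume p: "p \<in> cpt_points P"
    then obtain q where q: "q \<in> p" unfolding cpt_points_def by blast
    note qP = cpt_points_memD(1)[OF \<open>open P\<close> p q]
    show "insert_first J u' p \<in> colombeau_into J W"
      unfolding u'_def insert_first_class[OF \<open>open P\<close> J(1) p q iffD1[OF c_bounded_iff u(1), THEN conjunct1]]
      by (rule colombeau_intoI[OF J(1) slice_moderate_nets(2)[OF \<open>open P\<close> J(1) p q u(1)]])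
    have "locally_negligible J (\<lambda>\<epsilon> t. vector_derivative (\<lambda>t. u \<epsilon> (q \<epsilon>, t)) (at t) - F\<^sub>r \<epsilon> (t, u \<epsilon> (q \<epsilon>, t), q \<epsilon>))"
    proof (rule locally_negligible_zero)
      fix K assume "K \<subset>\<subset> J"
      from u(3)[OF this] eventually_at_right_0_Ioc1
      show "\<forall>\<^sub>F \<epsilon> in at_right 0. \<forall>t\<in>K. vector_derivative (\<lambda>t. u \<epsilon> (q \<epsilon>, t)) (at t) - F\<^sub>r \<epsilon> (t, u \<epsilon> (q \<epsilon>, t), q \<epsilon>) = 0"
      proof eventually_elim
        case (elim \<epsilon>)
        show ?case
        proof
          fix t assume "t \<in> K"
          then have "((\<lambda>t. u \<epsilon> (q \<epsilon>, t)) has_vector_derivative F\<^sub>r \<epsilon> (t, u \<epsilon> (q \<epsilon>, t), q \<epsilon>)) (at t)"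
            using elim(1) qP[OF elim(2)] by blast
          from vector_derivative_at[OF this]
          show "vector_derivative (\<lambda>t. u \<epsilon> (q \<epsilon>, t)) (at t) - F\<^sub>r \<epsilon> (t, u \<epsilon> (q \<epsilon>, t), q \<epsilon>) = 0" by simp
        qed
      qed
    qed
    moreover have "points_equiv (\<lambda>\<epsilon>. u \<epsilon> (q \<epsilon>, \<tau> \<epsilon>)) x\<^sub>0"
      unfolding points_equiv_iff
    proof
      fix m :: nat
      from u(2) eventually_at_right_0_Ioc1 show "\<forall>\<^sub>F \<epsilon> in at_right 0. norm (u \<epsilon> (q \<epsilon>, \<tau> \<epsilon>) - x\<^sub>0 \<epsilon>) \<le> \<epsilon> ^ m"
      proof eventually_elim
        case (elim \<epsilon>)
        then have "u \<epsilon> (q \<epsilon>, \<tau> \<epsilon>) = x\<^sub>0 \<epsilon>" using qP by blast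
        then show ?case using elim(2) by simp
      qed
    qed
    ultimately show "ivp_solution I U (insert_third (I \<times> U) F p) T\<^sub>0 X\<^sub>0 J (insert_first J u' p)"
      unfolding u'_def ivp_iff[OF p q uU] by blast
  next
    fix v assume v: "v \<in> colombeau_into (P \<times> J) U"
      and sol: "\<forall>p\<in>cpt_points P. ivp_solution I U (insert_third (I \<times> U) F p) T\<^sub>0 X\<^sub>0 J (insert_first J v p)"
    obtain v' where v': "v' \<in> v" "c_bounded (P \<times> J) U v'" "v \<in> colombeau (P \<times> J)"
      using v unfolding colombeau_into_def by blast
    note vv = colombeau_eq_class[OF op(1) v'(3,1)]
    have "locally_negligible (P \<times> J) (\<lambda>\<epsilon> z. v' \<epsilon> z - u \<epsilon> z)"
    proof (rule locally_negligible_by_parameters[OF \<open>open P\<close> J(1)])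
      fix p q assume p: "p \<in> cpt_points P" and q: "q \<in> p"
      note qP = cpt_points_memD(1)[OF \<open>open P\<close> p q]
      obtain K where K: "K \<subset>\<subset> P" "\<forall>\<^sub>F \<epsilon> in at_right 0. q \<epsilon> \<in> K" using cpt_points_memD(2)[OF \<open>open P\<close> p q] by blast
      obtain C where C: "\<forall>\<^sub>F \<epsilon> in at_right 0. \<forall>t\<in>J. \<forall>x\<in>(\<Union>x\<in>L. cball x \<beta>). \<forall>p\<in>K. \<forall>v.
          norm (frechet_derivative (\<lambda>y. F\<^sub>r \<epsilon> (t, y, p)) (at x) v) \<le> C * \<bar>ln \<epsilon>\<bar> * norm v"
        using log[OF cpt_insideD(1,2)[OF K(1)]] by blast
      have "ivp_solution I U (insert_third (I \<times> U) F p) T\<^sub>0 X\<^sub>0 J (insert_first J (colombeau_class (P \<times> J) v') p)"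
        using sol p vv(2) by simp
      then have res: "locally_negligible J (\<lambda>\<epsilon> t. vector_derivative (\<lambda>t. v' \<epsilon> (q \<epsilon>, t)) (at t) - F\<^sub>r \<epsilon> (t, v' \<epsilon> (q \<epsilon>, t), q \<epsilon>))"
        and init: "points_equiv (\<lambda>\<epsilon>. v' \<epsilon> (q \<epsilon>, \<tau> \<epsilon>)) x\<^sub>0"
        unfolding ivp_iff[OF p q v'(2)] by blast+
      have vm: "(\<lambda>\<epsilon> t. v' \<epsilon> (q \<epsilon>, t)) \<in> moderate_nets J"
        by (rule slice_moderate_nets(1)[OF \<open>open P\<close> J(1) p q vv(1)])
      show "locally_negligible J (\<lambda>\<epsilon> t. v' \<epsilon> (q \<epsilon>, t) - u \<epsilon> (q \<epsilon>, t))"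
      proof (rule ivp_net_unique[where ?t0.0 = t\<^sub>0 and h = h and q = q, folded \<open>J = _\<close>,
            OF F\<^sub>r(1) h(1) J(2) L\<beta>U \<open>a > 0\<close> h(3) C cpt_insideD(2)[OF K(1)] K(2) \<tau>(2) _ _ _ _ res init])
        show "\<forall>\<^sub>F \<epsilon> in at_right 0. x\<^sub>0 \<epsilon> \<in> L"
          using eventually_at_right_0_Ioc[of \<epsilon>\<^sub>0] \<open>\<epsilon>\<^sub>0 \<in> _\<close> by (auto elim!: eventually_mono intro: x\<^sub>0L)
        from u(2) eventually_at_right_0_Ioc1
        show "\<forall>\<^sub>F \<epsilon> in at_right 0. \<forall>t\<in>J. norm (u \<epsilon> (q \<epsilon>, t) - x\<^sub>0 \<epsilon>) \<le> a * \<bar>t - \<tau> \<epsilon>\<bar>"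
          by eventually_elim (use qP in blast)
        show "\<forall>\<^sub>F \<epsilon> in at_right 0. \<forall>t\<in>M. ((\<lambda>t. u \<epsilon> (q \<epsilon>, t)) has_vector_derivative F\<^sub>r \<epsilon> (t, u \<epsilon> (q \<epsilon>, t), q \<epsilon>)) (at t)"
          if "M \<subset>\<subset> J" for M
          using u(3)[OF that] eventually_at_right_0_Ioc1 by eventually_elim (use qP in blast)
        show "\<forall>\<^sub>F \<epsilon> in at_right 0. \<forall>t\<in>J. ((\<lambda>t. v' \<epsilon> (q \<epsilon>, t)) has_vector_derivative vector_derivative (\<lambda>t. v' \<epsilon> (q \<epsilon>, t)) (at t)) (at t)"
          using eventually_at_right_0_Ioc1
          by eventually_elim (use moderate_nets_vector_derivative(2)[OF J(1) vm] in blast)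
      qed
    qed
    moreover have "u \<in> moderate_nets (P \<times> J)" using u(1) by (simp add: c_bounded_iff)
    ultimately show "v = u'"
      unfolding u'_def vv(2)
      using colombeau_class_eq_iff[OF op(1) moderate_nets_eventually_moderate[OF vv(1)] moderate_nets_eventually_moderate]
      by blast
  qed
qed

end
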